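(* Let $N\ge1$, $1\le p<\infty$, $0<s<1$, and let $q$ satisfy $q\ge p$ together with $q\le p^*_s$ if $s\,p<N$, $q<\infty$ if $s\,p=N$, $q\le\infty$ if $s\,p>N$. There exists a constant $M=M(N,p,s,q,R/r)>0$ such that for every $x_0\in\mathbb{R}^N$, $r>0$, $R>\sqrt N\,r$, every compact set $\Sigma\subseteq\overline{B_r(x_0)}$ and every $u\in C^\infty_0(\mathbb{R}^N)$ such that $u\equiv0$ on $\Sigma$, we have $$\frac{M}{r^{\frac Nq}}\left(\widetilde{\mathrm{cap}}_{s,p}(\Sigma;B_R(x_0))\right)^{\frac1p}\|u\|_{L^q(B_r(x_0))}\le\left(\iint_{B_R(x_0)\times\mathbb{R}^N}\frac{|u(x)-u(y)|^p}{|x-y|^{N+s\,p}}\,dx\,dy\right)^{\frac1p}.$$ Moreover, $$M\left(N,p,s,q,\frac Rr\right)\sim1\quad\text{as }s\searrow0\text{ and }s\nearrow1,$$ and $$0<\lim_{R/r\to\sqrt N}\frac{M(N,p,s,q,R/r)}{(R/r-\sqrt N)^s}<\infty,\qquad0<\lim_{R/r\to\infty}\left(\frac Rr\right)^{\frac Nq}M\left(N,p,s,q,\frac Rr\right)<\infty.$$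
   Context: $p^*_s=\frac{Np}{N-sp}$ if $sp<N$. $B_r(x_0)$ is the open ball of centre $x_0$ and radius $r$ in $\mathbb{R}^N$; $N/q=0$ if $q=\infty$. For an open set $E\subseteq\mathbb{R}^N$ and a compact set $\Sigma\subseteq E$, the relative $(s,p)$-capacity is $$\widetilde{\mathrm{cap}}_{s,p}(\Sigma;E)=\inf_{\varphi\in C^\infty_0(E)}\left\{\iint_{\mathbb{R}^N\times\mathbb{R}^N}\frac{|\varphi(x)-\varphi(y)|^p}{|x-y|^{N+sp}}\,dx\,dy:\ \varphi\ge1\text{ on }\Sigma\right\}.$$ The notation $u\sim v$ for $x\to x_0$ means $0<\liminf_{x\to x_0}u(x)/v(x)\le\limsup_{x\to x_0}u(x)/v(x)<\infty$. In the limits in $s$, the exponents are always subject to the stated constraint on $q$. *)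

theory Defs
  imports "HOL-Analysis.Analysis" "HOL-Probability.Essential_Supremum"
begin

text \<open>
  The space $\mathbb{R}^N$ is an arbitrary type of class \<open>euclidean_space\<close> with \<open>N = DIM('a)\<close>; in
  particular $N \ge 1$. The differentiability exponent \<open>s\<close> and the exponent \<open>p\<close> are real, whereas
  \<open>q\<close> is an extended real because $q = \infty$ is allowed.
\<close>

text \<open>Being of class $C^{k+1}$ is being differentiable with all first partial derivatives of class
  $C^k$ (\<open>Basis\<close> is the standard orthonormal basis).\<close>

primrec C_class :: "nat \<Rightarrow> ('a::euclidean_space \<Rightarrow> real) \<Rightarrow> bool" where
  "C_class 0 f \<longleftrightarrow> continuous_on UNIV f"
| "C_class (Suc k) f \<longleftrightarrow> (\<forall>x. f differentiable (at x)) \<and>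
     (\<forall>b\<in>Basis. C_class k (\<lambda>x. frechet_derivative f (at x) b))"

text \<open>$C^\infty_0(E)$; its elements are extended by zero to the whole space.\<close>

definition test_functions :: "'a::euclidean_space set \<Rightarrow> ('a \<Rightarrow> real) set" where
  "test_functions E = {\<phi>. (\<forall>k. C_class k \<phi>) \<and>
     compact (closure (support_on UNIV \<phi>)) \<and> closure (support_on UNIV \<phi>) \<subseteq> E}"

definition gagliardo ::
    "real \<Rightarrow> real \<Rightarrow> 'a::euclidean_space set \<Rightarrow> 'a set \<Rightarrow> ('a \<Rightarrow> real) \<Rightarrow> ennreal" where
  "gagliardo p s A B u =
     (\<integral>\<^sup>+z\<in>A \<times> B. ennreal (\<bar>u (fst z) - u (snd z)\<bar> powr p /
          norm (fst z - snd z) powr (real DIM('a) + s * p)) \<partial>(lborel \<Otimes>\<^sub>M lborel))"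

definition rel_capacity ::
    "real \<Rightarrow> real \<Rightarrow> 'a::euclidean_space set \<Rightarrow> 'a set \<Rightarrow> ennreal" where
  "rel_capacity p s K E =
     (INF \<phi>\<in>{\<phi> \<in> test_functions E. \<forall>x\<in>K. 1 \<le> \<phi> x}. gagliardo p s UNIV UNIV \<phi>)"

text \<open>Real powers of extended nonnegative numbers, meant for positive exponents.\<close>

definition ennreal_powr :: "ennreal \<Rightarrow> real \<Rightarrow> ennreal" where
  "ennreal_powr x a = (if x = \<infinity> then \<infinity> else ennreal (enn2real x powr a))"

definition Lq_norm :: "ereal \<Rightarrow> 'a::euclidean_space set \<Rightarrow> ('a \<Rightarrow> real) \<Rightarrow> ennreal" where
  "Lq_norm q A u =
     (if q = \<infinity> then esssup (restrict_space lborel A) (\<lambda>x. ennreal \<bar>u x\<bar>)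
      else ennreal_powr (\<integral>\<^sup>+x\<in>A. ennreal (\<bar>u x\<bar> powr real_of_ereal q) \<partial>lborel)
             (1 / real_of_ereal q))"

definition div_exponent :: "nat \<Rightarrow> ereal \<Rightarrow> real" where
  "div_exponent N q = (if q = \<infinity> then 0 else real N / real_of_ereal q)"

text \<open>The Sobolev exponent $p^*_s$, meant for $s p < N$.\<close>

definition sobolev_exponent :: "nat \<Rightarrow> real \<Rightarrow> real \<Rightarrow> real" where
  "sobolev_exponent N p s = real N * p / (real N - s * p)"

text \<open>For $s p > N$ every $q \in [p, \infty]$ is admissible.\<close>

definition admissible :: "nat \<Rightarrow> real \<Rightarrow> real \<Rightarrow> ereal \<Rightarrow> bool" where
  "admissible N p s q \<longleftrightarrow> ereal p \<le> q \<and>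
     (s * p < real N \<longrightarrow> q \<le> ereal (sobolev_exponent N p s)) \<and>
     (s * p = real N \<longrightarrow> q < \<infinity>)"

text \<open>The relation $u \sim v$ along a filter.\<close>

definition comparable :: "('b \<Rightarrow> real) \<Rightarrow> ('b \<Rightarrow> real) \<Rightarrow> 'b filter \<Rightarrow> bool" where
  "comparable u v F \<longleftrightarrow>
     0 < Liminf F (\<lambda>x. ereal (u x / v x)) \<and>
     Liminf F (\<lambda>x. ereal (u x / v x)) \<le> Limsup F (\<lambda>x. ereal (u x / v x)) \<and>
     Limsup F (\<lambda>x. ereal (u x / v x)) < \<infinity>"

text \<open>
  The limits in \<open>s\<close>. When $s \searrow 0$ the constraint on \<open>q\<close> shrinks to $q = p$, so \<open>q\<close> cannot be
  kept fixed unless $q = p$; hence \<open>q\<close> is allowed to vary with \<open>s\<close>, within the constraint. When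
  $s \nearrow 1$ the exponents are required to tend to a limit that satisfies the constraint for
  $s = 1$. This includes every fixed \<open>q\<close> that is admissible for \<open>s\<close> close to 1, and it only excludes,
  up to subsequences, the case $q \to \infty$ for $p = N$.
\<close>

definition comparable_1_at_0 :: "nat \<Rightarrow> real \<Rightarrow> (real \<Rightarrow> ereal \<Rightarrow> real) \<Rightarrow> bool" where
  "comparable_1_at_0 N p m \<longleftrightarrow>
     (\<forall>q. (\<forall>\<^sub>F s in at_right 0. admissible N p s (q s)) \<longrightarrow>
        comparable (\<lambda>s. m s (q s)) (\<lambda>_. 1) (at_right 0))"

definition comparable_1_at_1 :: "nat \<Rightarrow> real \<Rightarrow> (real \<Rightarrow> ereal \<Rightarrow> real) \<Rightarrow> bool" where
  "comparable_1_at_1 N p m \<longleftrightarrow>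
     (\<forall>q q\<^sub>1. (\<forall>\<^sub>F s in at_left 1. admissible N p s (q s)) \<and>
        (q \<longlongrightarrow> q\<^sub>1) (at_left 1) \<and> admissible N p 1 q\<^sub>1 \<longrightarrow>
        comparable (\<lambda>s. m s (q s)) (\<lambda>_. 1) (at_left 1))"

end

theory Submission
  imports Defs
begin

text \<open>Write $N$ for the dimension, $E$ for the $p$-th power of the right-hand side, that is the energy of
  $u$ on $B_R \times \mathbb{R}^N$, and $\delta = \min(1, R/r - \sqrt N)$.

  If $u$ vanishes on $\Sigma$, if $m \ne 0$ is a constant and $\eta$ is a cutoff between $B_r$ and
  $B_R$, then $(1 - u/m)\eta$ competes for the capacity. Multiplied by $|m|^p$, its energy is at most
  a constant times $E$ plus $\|u - m\|_{L^p(B_R)}^p$ times the energy density of the cutoff, which is of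
  order $(R\delta)^{-sp}/(s(1-s))$ (\<open>capacity_le\<close>). A suitable $m$ satisfies the Poincare inequality
  $\|u - m\|_{L^p(B_R)}^p \le C s(1-s) R^{sp} E$ (\<open>poincare\<close>), so the two factors $s(1-s)$ cancel and
  $|m|^p\,\mathrm{cap} \le C \delta^{-sp} E$. The choice $u = 0$, $m = 1$ bounds the capacity itself by
  $C\delta^{-sp}R^{N-sp}/(s(1-s))$. Hence the inequality follows, with a constant
  $M = c\,\delta^s (R/r)^{-N/q}$, from a Sobolev-Poincare inequality for $\|u - m\|_{L^q(B_R)}$ that has the
  same factor $s(1-s)$ (\<open>mazya_from_poincare_sobolev\<close>). Both limits in $R/r$ can be read off from this
  formula. The limits in $s$ hold because, for fixed $N$ and $p$, $c$ depends on $q$ and $s$ only through an upper bound of $q$ or,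
  when $q$ is large or infinite, through a positive lower bound of $sp/N - 1$. Since the energy is
  integrated over $B_R \times \mathbb{R}^N$ and not over $B_R \times B_R$, this remains true as $s \to 0$.

  The factor $1-s$ has an elementary source. Let $F(t)$ be the integral of $|u(x) - u(y)|^p$ over the
  pairs in $B_R \times B_R$ at distance less than $t$. Inserting midpoints gives $F(2t) \le 2^{N+p}F(t)$
  (\<open>osc_double\<close>). The energy dominates $\sum_j t_j^{-N-sp} F(t_j)$ over dyadic scales $t_j = 2^{-j}t$, and by
  the doubling inequality this is at least $t^{-N-sp}F(t)$ times a geometric series of ratio
  $2^{-(1-s)p}$ (\<open>osc_le_gagliardo\<close>). The factor $s$ comes from comparing two points of $B_R$ with all points
  outside $B_R$ (\<open>osc_le_gagliardo_exterior\<close>).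

  To improve $L^p$ to $L^q$, $|u - m|$ is cut into slices between consecutive levels. The bound for $F$,
  applied to one slice at the scale at which the part of every ball inside $B_R$ has at least twice the volume of its support, bounds
  the volume of a superlevel set by a power of the volume of the preceding one, with the factor $1-s$. The
  factor $s$ comes from the larger scales up to $R$, and what lies beyond $R$ is left to the Poincare
  inequality (\<open>level_estimate\<close>). With dyadic levels
  the energies of the slices add up to at most the energy of $u$, and an elementary lemma on sequences gives
  the $L^q$ bound up to and including the critical exponent, for every $p \ge 1$
  (\<open>sobolev_by_slicing\<close>). If $sp > N$ the recursion is superlinear, and levels converging to a finite limit
  give a bound for the supremum (\<open>sup_bound_by_iteration\<close>).\<close>

abbreviation power_integral :: "real \<Rightarrow> 'a::euclidean_space set \<Rightarrow> ('a \<Rightarrow> real) \<Rightarrow> ennreal" where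
  "power_integral p A f \<equiv> \<integral>\<^sup>+x\<in>A. ennreal (\<bar>f x\<bar> powr p) \<partial>lborel"

abbreviation energy_on :: "real \<Rightarrow> real \<Rightarrow> 'a::euclidean_space set \<Rightarrow> ('a \<Rightarrow> real) \<Rightarrow> ennreal" where
  "energy_on p s A f \<equiv> gagliardo p s A A f"

text \<open>An upper bound for the energy density $\int |\eta(x) - \eta(y)|^p |x - y|^{-N - sp}\,dy$ of a
  cutoff \<open>\<eta>\<close> whose transition layer has width \<open>d\<close>, up to the $p$-th power of a numerical factor.\<close>

abbreviation cutoff_energy :: "nat \<Rightarrow> real \<Rightarrow> real \<Rightarrow> real \<Rightarrow> real" where
  "cutoff_energy n p s d \<equiv>
     unit_ball_vol (real n) * 2 powr (2 * real n + p + 1) * d powr - (s * p) / (s * (1 - s))"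

section \<open>Dyadic kernel sums and elementary inequalities\<close>

lemma geometric_powr_sum_le:
  fixes t a :: real
  assumes t: "0 < t" and a: "1 \<le> a"
  shows "(\<Sum>j<n. (t * 2 ^ j) powr - a) \<le> 2 * t powr - a"
  using t
proof (induction n arbitrary: t)
  case (Suc n)
  have half: "(t * 2) powr - a \<le> t powr - a / 2"
  proof -
    have "(2::real) powr - a \<le> 2 powr - 1" using a by (intro powr_mono) auto
    then show ?thesis using Suc.prems by (simp add: powr_mult powr_minus field_simps)
  qed
  have "(\<Sum>j<n. (t * 2 ^ Suc j) powr - a) = (\<Sum>j<n. ((t * 2) * 2 ^ j) powr - a)"
    by (simp add: mult.assoc)
  also have "\<dots> \<le> 2 * (t * 2) powr - a" using Suc by simp
  finally show ?case using half by (simp add: sum.lessThan_Suc_shift del: sum.lessThan_Suc power_Suc)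
qed simp

text \<open>The indicator removes all radii below \<open>h\<close>; the remaining terms decay at least like a geometric
  series of ratio $1/2$ and start below $h^{-a}$. With \<open>a = N + s p\<close>, this lemma and the next bound a weighted
  sum of indicators of the events $|x - y| < t_j$ by the kernel $|x - y|^{-N-sp}$.\<close>

lemma increasing_radii_sum_le:
  fixes t a h :: real
  assumes t: "0 < t" and a: "1 \<le> a" and h: "0 < h"
  shows "(\<Sum>j<n. if h < t * 2 ^ j then (t * 2 ^ j) powr - a else 0) \<le> 2 * h powr - a"
  using t
proof (induction n arbitrary: t)
  case (Suc n)
  show ?case
  proof (cases "h < t")
    case True
    have "(\<Sum>j<Suc n. if h < t * 2 ^ j then (t * 2 ^ j) powr - a else 0) \<le> (\<Sum>j<Suc n. (t * 2 ^ j) powr - a)"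
      by (intro sum_mono) auto
    also have "\<dots> \<le> 2 * t powr - a" using geometric_powr_sum_le[OF Suc.prems a] .
    also have "\<dots> \<le> 2 * h powr - a" using True h a by (auto intro!: powr_mono2')
    finally show ?thesis .
  next
    case False
    have "(\<Sum>j<n. if h < t * 2 ^ Suc j then (t * 2 ^ Suc j) powr - a else 0)
        = (\<Sum>j<n. if h < (t * 2) * 2 ^ j then ((t * 2) * 2 ^ j) powr - a else 0)"
      by (intro sum.cong refl) (auto simp: mult.assoc)
    also have "\<dots> \<le> 2 * h powr - a" using Suc by simp
    finally show ?thesis using False
      by (simp add: sum.lessThan_Suc_shift del: sum.lessThan_Suc power_Suc)
  qed
qed simp

lemma decreasing_radii_sum_le:
  fixes t a h :: real
  assumes t: "0 < t" and a: "1 \<le> a" and h: "0 < h"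
  shows "(\<Sum>j<n. if h < t / 2 ^ j then (t / 2 ^ j) powr - a else 0) \<le> 2 * h powr - a"
proof (induction n)
  case (Suc n)
  show ?case
  proof (cases "h < t / 2 ^ n")
    case True
    have "(\<Sum>j<Suc n. if h < t / 2 ^ j then (t / 2 ^ j) powr - a else 0) \<le> (\<Sum>j<Suc n. (t / 2 ^ j) powr - a)"
      by (intro sum_mono) auto
    also have "\<dots> = (\<Sum>j<Suc n. (t / 2 ^ (Suc n - Suc j)) powr - a)"
      by (rule sum.nat_diff_reindex[symmetric])
    also have "\<dots> = (\<Sum>j<Suc n. ((t / 2 ^ n) * 2 ^ j) powr - a)"
      by (intro sum.cong refl arg_cong[where f="\<lambda>x. x powr - a"]) (auto simp: power_diff field_simps)
    also have "\<dots> \<le> 2 * (t / 2 ^ n) powr - a" by (rule geometric_powr_sum_le) (use t a in auto)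
    also have "\<dots> \<le> 2 * h powr - a" using True h a by (auto intro!: powr_mono2')
    finally show ?thesis .
  next
    case False
    then show ?thesis using Suc by simp
  qed
qed simp

text \<open>Dividing by a geometric series in this form turns \<open>\<rho> = 2 powr - (s * p)\<close> or
  \<open>\<rho> = 2 powr - ((1 - s) * p)\<close> into a factor of order \<open>s\<close> or \<open>1 - s\<close>, by the next lemmas. It is
  stated for partial sums because these arise as finite sums of integrals.\<close>

lemma geometric_bound:
  fixes x y \<rho> :: real
  assumes \<rho>: "0 < \<rho>" "\<rho> < 1" and le: "\<And>n. (\<Sum>j<n. \<rho> ^ j) * x \<le> y"
  shows "x \<le> (1 - \<rho>) * y"
proof -
  have "(\<lambda>n. (\<Sum>j<n. \<rho> ^ j) * x) \<longlonglongrightarrow> (1 / (1 - \<rho>)) * x"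
    using geometric_sums[of \<rho>] \<rho> unfolding sums_def by (intro tendsto_mult) auto
  then have "(1 / (1 - \<rho>)) * x \<le> y" using le by (intro LIMSEQ_le_const2) auto
  then show ?thesis using \<rho> by (simp add: field_simps)
qed

lemma geometric_bound_ennreal:
  fixes X Y :: ennreal and \<rho> :: real
  assumes \<rho>: "0 < \<rho>" "\<rho> < 1" and le: "\<And>n. ennreal (\<Sum>j<n. \<rho> ^ j) * X \<le> Y"
  shows "X \<le> ennreal (1 - \<rho>) * Y"
proof (cases Y)
  case (real y)
  have "X \<le> Y" using le[of 1] by simp
  then obtain x where x: "X = ennreal x" "0 \<le> x"
    using real by (metis ennreal_cases neq_top_trans ennreal_neq_top)
  have "(\<Sum>j<n. \<rho> ^ j) * x \<le> y" for n
    using le[of n] real x \<rho> by (simp add: ennreal_mult[symmetric] sum_nonneg)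
  then have "x \<le> (1 - \<rho>) * y" by (rule geometric_bound[OF \<rho>])
  then show ?thesis using x real \<rho> by (simp add: ennreal_mult[symmetric])
next
  case top
  then show ?thesis using \<rho> by (simp add: ennreal_mult_top)
qed

lemma one_minus_two_powr_le: "1 - 2 powr - x \<le> x" if "0 \<le> x" for x :: real
proof -
  have "1 + (- x * ln 2) \<le> exp (- x * ln 2)" by (rule exp_ge_add_one_self)
  moreover have "x * ln 2 \<le> x * 1" using that ln_2_less_1 by (intro mult_left_mono) auto
  ultimately show ?thesis by (simp add: powr_def)
qed

lemma one_minus_two_powr_ge: "x / 2 \<le> 1 - 2 powr - x" if "0 \<le> x" "x \<le> 1" for x :: real
proof -
  have "convex_on UNIV (exp :: real \<Rightarrow> real)"
    by (rule exp_convex)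
  then have "exp ((1 - x) *\<^sub>R 0 + x *\<^sub>R (- ln 2)) \<le> (1 - x) * exp 0 + x * exp (- ln 2 :: real)"
    using that by (intro convex_onD) auto
  then show ?thesis by (simp add: powr_def exp_minus field_simps)
qed

text \<open>The sharp constant $2^{p-1}$ matters: in the doubling inequality for oscillations any larger one
  would destroy the exact power $2^{N+p}$ on which the factor \<open>1 - s\<close> rests.\<close>

lemma powr_add_le:
  fixes a b p :: real
  assumes "0 \<le> a" "0 \<le> b" "1 \<le> p"
  shows "(a + b) powr p \<le> 2 powr (p - 1) * (a powr p + b powr p)"
proof (cases "a = 0 \<or> b = 0")
  case True
  have "1 \<le> (2::real) powr (p - 1)" using assms by (simp add: ge_one_powr_ge_zero)
  then show ?thesis using True assms mult_right_mono[of 1 "2 powr (p - 1)" "a powr p"]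
     mult_right_mono[of 1 "2 powr (p - 1)" "b powr p"] by auto
next
  case False
  with assms have "0 < a" "0 < b" by auto
  then have "((1 - 1/2) *\<^sub>R a + (1/2) *\<^sub>R b) powr p \<le> (1 - 1/2) * a powr p + (1/2) * b powr p"
    using assms by (intro convex_onD[OF powr_convex]) auto
  then have "((a + b) / 2) powr p \<le> (a powr p + b powr p) / 2" by (simp add: field_simps)
  then show ?thesis using assms by (simp add: powr_divide powr_diff field_simps)
qed

section \<open>Oscillation at a fixed scale\<close>

definition osc :: "real \<Rightarrow> 'a::euclidean_space set \<Rightarrow> real \<Rightarrow> ('a \<Rightarrow> real) \<Rightarrow> ennreal" where
  "osc p \<Omega> t u =
     (\<integral>\<^sup>+x. \<integral>\<^sup>+y. (if x \<in> \<Omega> \<and> y \<in> \<Omega> \<and> dist x y < t then ennreal (\<bar>u x - u y\<bar> powr p) else 0) \<partial>lborel \<partial>lborel)"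

lemma gagliardo_iterated:
  fixes u :: "'a::euclidean_space \<Rightarrow> real"
  assumes [measurable]: "A \<in> sets borel" "B \<in> sets borel" "u \<in> borel_measurable borel"
  shows "gagliardo p s A B u =
    (\<integral>\<^sup>+x. \<integral>\<^sup>+y. (if x \<in> A \<and> y \<in> B
       then ennreal (\<bar>u x - u y\<bar> powr p / norm (x - y) powr (real DIM('a) + s * p)) else 0) \<partial>lborel \<partial>lborel)"
  unfolding gagliardo_def
  by (subst lborel.nn_integral_fst[symmetric])
     (auto intro!: nn_integral_cong simp: indicator_def split: if_splits)

lemma nn_integral_midpoint:
  fixes f :: "'a::euclidean_space \<Rightarrow> ennreal"
  assumes [measurable]: "f \<in> borel_measurable borel"
  shows "(\<integral>\<^sup>+y. f (x + (1/2) *\<^sub>R (y - x)) \<partial>lborel) = ennreal (2 powr DIM('a)) * (\<integral>\<^sup>+y. f y \<partial>lborel)"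
proof -
  have eq: "x + (1/2::real) *\<^sub>R (y - x) = (1/2) *\<^sub>R x + (1/2) *\<^sub>R y" for y
    by (rule euclidean_eqI) (simp add: inner_simps field_simps)
  have "(\<integral>\<^sup>+y. f y \<partial>lborel) = ennreal ((1/2) ^ DIM('a)) * (\<integral>\<^sup>+y. f ((1/2) *\<^sub>R x + (1/2) *\<^sub>R y) \<partial>lborel)"
    by (subst lborel_affine[of "1/2" "(1/2) *\<^sub>R x"])
       (auto simp add: nn_integral_density nn_integral_distr nn_integral_cmult)
  then show ?thesis
    by (simp add: eq mult.assoc[symmetric] ennreal_mult[symmetric] powr_realpow power_mult_distrib[symmetric])
qed

text \<open>For \<open>x, y \<in> \<Omega>\<close> at distance less than \<open>2 t\<close> the midpoint lies in the convex set \<open>\<Omega>\<close> at distance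
  less than \<open>t\<close> from both. The triangle inequality costs $2^{p-1}$ for each of two equal terms, and the
  substitution of the midpoint for one variable costs $2^N$.\<close>

lemma osc_double:
  fixes u :: "'a::euclidean_space \<Rightarrow> real"
  assumes conv: "convex \<Omega>" and [measurable]: "\<Omega> \<in> sets borel" "u \<in> borel_measurable borel" and p: "1 \<le> p"
  shows "osc p \<Omega> (2 * t) u \<le> ennreal (2 powr (real DIM('a) + p)) * osc p \<Omega> t u"
proof -
  define g where "g x z = (if x \<in> \<Omega> \<and> z \<in> \<Omega> \<and> dist x z < t then ennreal (\<bar>u x - u z\<bar> powr p) else 0)" for x z
  let ?m = "\<lambda>x y::'a. x + (1/2) *\<^sub>R (y - x)"
  have [measurable]: "case_prod g \<in> borel_measurable (borel \<Otimes>\<^sub>M borel)"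
    unfolding g_def by measurable
  have pt: "(if x \<in> \<Omega> \<and> y \<in> \<Omega> \<and> dist x y < 2 * t then ennreal (\<bar>u x - u y\<bar> powr p) else 0)
     \<le> ennreal (2 powr (p - 1)) * (g x (?m x y) + g y (?m y x))" for x y
  proof (cases "x \<in> \<Omega> \<and> y \<in> \<Omega> \<and> dist x y < 2 * t")
    case True
    have m: "?m y x = ?m x y" by (rule euclidean_eqI) (simp add: inner_simps field_simps)
    have "?m x y = (1 - 1/2) *\<^sub>R x + (1/2) *\<^sub>R y" by (rule euclidean_eqI) (simp add: inner_simps field_simps)
    then have in\<Omega>: "?m x y \<in> \<Omega>" using convexD_alt[OF conv, of x y "1/2"] True by auto
    have d: "dist x (?m x y) < t" "dist y (?m y x) < t"
      using True by (auto simp: dist_norm norm_minus_commute)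
    have "\<bar>u x - u y\<bar> powr p \<le> (\<bar>u x - u (?m x y)\<bar> + \<bar>u y - u (?m x y)\<bar>) powr p"
      using p by (intro powr_mono2) auto
    also have "\<dots> \<le> 2 powr (p - 1) * (\<bar>u x - u (?m x y)\<bar> powr p + \<bar>u y - u (?m x y)\<bar> powr p)"
      using p by (intro powr_add_le) auto
    finally show ?thesis using True in\<Omega> d unfolding g_def m
      by (simp add: ennreal_mult[symmetric] ennreal_plus[symmetric] del: ennreal_plus)
  qed auto
  have I1: "(\<integral>\<^sup>+x. \<integral>\<^sup>+y. g x (?m x y) \<partial>lborel \<partial>lborel) = ennreal (2 powr DIM('a)) * osc p \<Omega> t u"
  proof -
    have "osc p \<Omega> t u = (\<integral>\<^sup>+x. \<integral>\<^sup>+y. g x y \<partial>lborel \<partial>lborel)" by (simp add: osc_def g_def)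
    then show ?thesis by (subst nn_integral_midpoint) (simp_all add: nn_integral_cmult)
  qed
  have I2: "(\<integral>\<^sup>+x. \<integral>\<^sup>+y. g y (?m y x) \<partial>lborel \<partial>lborel) = (\<integral>\<^sup>+x. \<integral>\<^sup>+y. g x (?m x y) \<partial>lborel \<partial>lborel)"
  proof -
    have "(\<lambda>(x, y). g x (?m x y)) \<in> borel_measurable (lborel \<Otimes>\<^sub>M lborel)" by measurable
    from lborel_pair.Fubini'[OF this] show ?thesis .
  qed
  have "osc p \<Omega> (2 * t) u \<le> (\<integral>\<^sup>+x. \<integral>\<^sup>+y. ennreal (2 powr (p - 1)) * (g x (?m x y) + g y (?m y x)) \<partial>lborel \<partial>lborel)"
    unfolding osc_def by (intro nn_integral_mono pt)
  also have "\<dots> = ennreal (2 powr (p - 1)) * ((\<integral>\<^sup>+x. \<integral>\<^sup>+y. g x (?m x y) \<partial>lborel \<partial>lborel) + (\<integral>\<^sup>+x. \<integral>\<^sup>+y. g y (?m y x) \<partial>lborel \<partial>lborel))"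
    by (simp add: nn_integral_cmult nn_integral_add)
  also have "\<dots> = ennreal (2 powr (p - 1)) * (2 * (ennreal (2 powr DIM('a)) * osc p \<Omega> t u))"
    unfolding I2 I1 by (simp add: mult_2)
  also have "\<dots> = ennreal (2 powr (p - 1) * 2 * 2 powr DIM('a)) * osc p \<Omega> t u"
    by (simp add: ennreal_mult mult.assoc)
  also have "2 powr (p - 1) * 2 * 2 powr DIM('a) = 2 powr (real DIM('a) + p)"
    by (simp add: powr_diff powr_add)
  finally show ?thesis .
qed

lemma powr_div_minus: "(t / c) powr - a = t powr - a * c powr a" if "0 < t" "0 < c" for a t c :: real
  using that by (simp add: powr_divide powr_minus field_simps)

text \<open>Exchanging the finite sum and the integrals, a kernel bound for the radii \<open>t j\<close> becomes a bound of
  the oscillations at these scales by the energy.\<close>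

lemma sum_osc_le_gagliardo:
  fixes u :: "'a::euclidean_space \<Rightarrow> real" and t :: "nat \<Rightarrow> real"
  assumes [measurable]: "\<Omega> \<in> sets borel" "u \<in> borel_measurable borel" and p: "1 \<le> p"
    and kernel: "\<And>h. 0 < h \<Longrightarrow> (\<Sum>j<n. if h < t j then t j powr - (real DIM('a) + s * p) else 0)
                     \<le> 2 * h powr - (real DIM('a) + s * p)"
  shows "(\<Sum>j<n. ennreal (t j powr - (real DIM('a) + s * p)) * osc p \<Omega> (t j) u) \<le> 2 * energy_on p s \<Omega> u"
proof -
  let ?a = "real DIM('a) + s * p"
  define g where "g r x y = (if x \<in> \<Omega> \<and> y \<in> \<Omega> \<and> dist x y < r then ennreal (\<bar>u x - u y\<bar> powr p) else 0)" for r x y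
  have [measurable]: "case_prod (g r) \<in> borel_measurable (borel \<Otimes>\<^sub>M borel)" for r
    unfolding g_def by measurable
  have "(\<Sum>j<n. ennreal (t j powr - ?a) * osc p \<Omega> (t j) u)
      = (\<integral>\<^sup>+x. \<integral>\<^sup>+y. (\<Sum>j<n. ennreal (t j powr - ?a) * g (t j) x y) \<partial>lborel \<partial>lborel)"
    by (simp add: nn_integral_sum nn_integral_cmult osc_def g_def[symmetric])
  also have "\<dots> \<le> (\<integral>\<^sup>+x. \<integral>\<^sup>+y. 2 * (if x \<in> \<Omega> \<and> y \<in> \<Omega>
       then ennreal (\<bar>u x - u y\<bar> powr p / norm (x - y) powr ?a) else 0) \<partial>lborel \<partial>lborel)"
  proof (intro nn_integral_mono)
    fix x y
    show "(\<Sum>j<n. ennreal (t j powr - ?a) * g (t j) x y)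
      \<le> 2 * (if x \<in> \<Omega> \<and> y \<in> \<Omega> then ennreal (\<bar>u x - u y\<bar> powr p / norm (x - y) powr ?a) else 0)"
    proof (cases "x \<in> \<Omega> \<and> y \<in> \<Omega> \<and> x \<noteq> y")
      case True
      have "(\<Sum>j<n. ennreal (t j powr - ?a) * g (t j) x y)
        = (\<Sum>j<n. ennreal ((if dist x y < t j then t j powr - ?a else 0) * \<bar>u x - u y\<bar> powr p))"
        using True by (intro sum.cong refl) (auto simp: g_def ennreal_mult)
      also have "\<dots> = ennreal ((\<Sum>j<n. if dist x y < t j then t j powr - ?a else 0) * \<bar>u x - u y\<bar> powr p)"
        by (subst sum_ennreal) (auto simp: sum_distrib_right)
      also have "\<dots> \<le> ennreal (2 * dist x y powr - ?a * \<bar>u x - u y\<bar> powr p)"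
        using True kernel[of "dist x y"] by (intro ennreal_leI mult_right_mono) auto
      also have "\<dots> = 2 * ennreal (\<bar>u x - u y\<bar> powr p / norm (x - y) powr ?a)"
      proof -
        have "2 * dist x y powr - ?a * \<bar>u x - u y\<bar> powr p = 2 * (\<bar>u x - u y\<bar> powr p / norm (x - y) powr ?a)"
          unfolding dist_norm powr_minus_divide by simp
        then show ?thesis by (simp only:) (subst ennreal_mult, auto)
      qed
      finally show ?thesis using True by simp
    qed (auto simp: g_def)
  qed
  also have "\<dots> = 2 * energy_on p s \<Omega> u"
    by (simp add: nn_integral_cmult gagliardo_iterated)
  finally show ?thesis .
qed

text \<open>The Bourgain-Brezis-Mironescu factor \<open>1 - s\<close>: by doubling, each scale $t/2^j$ contributes to the
  energy at least $2^{-j(1-s)p}$ times the contribution of the scale \<open>t\<close>.\<close>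

lemma osc_le_gagliardo:
  fixes u :: "'a::euclidean_space \<Rightarrow> real"
  assumes conv: "convex \<Omega>" and [measurable]: "\<Omega> \<in> sets borel" "u \<in> borel_measurable borel"
    and p: "1 \<le> p" and s: "0 < s" "s < 1" and t: "0 < t"
  shows "ennreal (t powr - (real DIM('a) + s * p)) * osc p \<Omega> t u
    \<le> ennreal (2 * p * (1 - s)) * energy_on p s \<Omega> u"
proof -
  let ?a = "real DIM('a) + s * p" and ?b = "real DIM('a) + p"
  define \<rho> where "\<rho> = (2::real) powr - ((1 - s) * p)"
  have a1: "1 \<le> ?a" using s p DIM_positive[where 'a='a] by (smt (verit) mult_pos_pos of_nat_less_iff of_nat_0 One_nat_def Suc_leI of_nat_1 of_nat_mono)
  have \<rho>: "0 < \<rho>" "\<rho> < 1" using s p by (auto simp: \<rho>_def intro!: powr_less_one)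
  have doubling: "osc p \<Omega> t u \<le> ennreal ((2 powr ?b) ^ j) * osc p \<Omega> (t / 2 ^ j) u" for j
  proof (induction j)
    case (Suc j)
    have "osc p \<Omega> (t / 2 ^ j) u \<le> ennreal (2 powr ?b) * osc p \<Omega> (t / 2 ^ Suc j) u"
      using osc_double[OF conv assms(2,3) p, of "t / 2 ^ Suc j"] by simp
    then have "ennreal ((2 powr ?b) ^ j) * osc p \<Omega> (t / 2 ^ j) u
      \<le> ennreal ((2 powr ?b) ^ j) * (ennreal (2 powr ?b) * osc p \<Omega> (t / 2 ^ Suc j) u)"
      by (rule mult_left_mono) simp
    also have "\<dots> = ennreal ((2 powr ?b) ^ Suc j) * osc p \<Omega> (t / 2 ^ Suc j) u"
      by (simp add: ennreal_mult mult.assoc mult.left_commute)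
    finally have step: "ennreal ((2 powr ?b) ^ j) * osc p \<Omega> (t / 2 ^ j) u
      \<le> ennreal ((2 powr ?b) ^ Suc j) * osc p \<Omega> (t / 2 ^ Suc j) u" .
    show ?case by (rule order_trans[OF Suc step])
  qed (simp only: power_0 ennreal_1 mult_1 div_by_1 order_refl)
  have "ennreal (\<Sum>j<n. \<rho> ^ j) * (ennreal (t powr - ?a) * osc p \<Omega> t u) \<le> 2 * energy_on p s \<Omega> u" for n
  proof -
    have "ennreal (\<Sum>j<n. \<rho> ^ j) * (ennreal (t powr - ?a) * osc p \<Omega> t u)
       = (\<Sum>j<n. ennreal (\<rho> ^ j) * (ennreal (t powr - ?a) * osc p \<Omega> t u))"
      using \<rho> by (subst sum_ennreal[symmetric]) (auto simp only: sum_distrib_right zero_le_power less_imp_le)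
    also have "\<dots> \<le> (\<Sum>j<n. ennreal ((t / 2 ^ j) powr - ?a) * osc p \<Omega> (t / 2 ^ j) u)"
    proof (intro sum_mono)
      fix j
      have e: "\<rho> ^ j * t powr - ?a * (2 powr ?b) ^ j = (t / 2 ^ j) powr - ?a"
      proof -
        have "(2::real) powr -((1 - s) * p) * 2 powr ?b = 2 powr ?a"
          unfolding powr_add[symmetric] by (simp add: algebra_simps)
        then have "\<rho> ^ j * (2 powr ?b) ^ j = (2 powr ?a) ^ j"
          unfolding \<rho>_def power_mult_distrib[symmetric] by simp
        also have "\<dots> = (2 ^ j) powr ?a"
        proof -
          have "(2 ^ j) powr ?a = (2 powr real j) powr ?a" by (simp add: powr_realpow)
          then show ?thesis by (simp add: powr_powr powr_power mult.commute)
        qed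
        finally show ?thesis unfolding powr_div_minus[OF t zero_less_power[OF zero_less_numeral]]
          by (simp add: mult_ac)
      qed
      have "ennreal (\<rho> ^ j) * (ennreal (t powr - ?a) * osc p \<Omega> t u)
        \<le> ennreal (\<rho> ^ j) * (ennreal (t powr - ?a) * (ennreal ((2 powr ?b) ^ j) * osc p \<Omega> (t / 2 ^ j) u))"
        by (intro mult_left_mono doubling) auto
      also have "\<dots> = ennreal ((t / 2 ^ j) powr - ?a) * osc p \<Omega> (t / 2 ^ j) u"
        unfolding e[symmetric] using \<rho> by (simp add: ennreal_mult mult.assoc)
      finally show "ennreal (\<rho> ^ j) * (ennreal (t powr - ?a) * osc p \<Omega> t u) \<le> \<dots>" .
    qed
    also have "\<dots> \<le> 2 * energy_on p s \<Omega> u"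
      using decreasing_radii_sum_le[OF t a1]
      by (intro sum_osc_le_gagliardo assms) auto
    finally show ?thesis .
  qed
  then have "ennreal (t powr - ?a) * osc p \<Omega> t u \<le> ennreal (1 - \<rho>) * (2 * energy_on p s \<Omega> u)"
    by (rule geometric_bound_ennreal[OF \<rho>])
  also have "\<dots> \<le> ennreal ((1 - s) * p) * (2 * energy_on p s \<Omega> u)"
    using one_minus_two_powr_le[of "(1 - s) * p"] s p by (intro mult_right_mono ennreal_leI) (auto simp: \<rho>_def)
  also have "\<dots> = ennreal (2 * p * (1 - s)) * energy_on p s \<Omega> u"
  proof -
    have "ennreal (2 * p * (1 - s)) = ennreal ((1 - s) * p) * ennreal 2"
      using s p by (subst ennreal_mult[symmetric]) (auto simp: mult_ac)
    then show ?thesis by (simp add: mult.assoc)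
  qed
  finally show ?thesis .
qed

section \<open>The fractional Poincare inequality\<close>

lemma ennreal_cancel_const:
  fixes X Y :: ennreal
  assumes "0 < c" "0 \<le> K" "ennreal c * X \<le> ennreal K * Y"
  shows "X \<le> ennreal (K / c) * Y"
proof -
  have "ennreal (1 / c) * (ennreal c * X) \<le> ennreal (1 / c) * (ennreal K * Y)"
    by (rule mult_left_mono[OF assms(3)]) simp
  moreover have "ennreal (1 / c) * (ennreal c * X) = X"
    using assms by (simp add: mult.assoc[symmetric] ennreal_mult[symmetric])
  moreover have "ennreal (1 / c) * (ennreal K * Y) = ennreal (K / c) * Y"
    using assms by (simp add: mult.assoc[symmetric] ennreal_mult[symmetric])
  ultimately show ?thesis by simp
qed

text \<open>The kernel dominates half the sum of $t_j^{-N-sp}$ times indicators of balls with $t_j = 2^{j+1}R$.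
  At least half of each of these balls lies outside \<open>ball x0 R\<close>, which leaves the geometric series
  $\sum_j t_j^{-sp}$ of size $R^{-sp}/s$.\<close>

lemma exterior_kernel_ge:
  fixes x0 :: "'a::euclidean_space"
  assumes R: "0 < R" and s: "0 < s" "s < 1" and p: "1 \<le> p"
  shows "ennreal (unit_ball_vol (real DIM('a)) / 2 * (2 * R) powr - (s * p))
    \<le> ennreal (2 * s * p) * (\<integral>\<^sup>+y. (if R \<le> dist x0 y then ennreal (dist x0 y powr - (real DIM('a) + s * p)) else 0) \<partial>lborel)"
proof -
  define a where "a = real DIM('a) + s * p"
  define \<omega> where "\<omega> = unit_ball_vol (real DIM('a))"
  define t where "t j = 2 * R * 2 ^ j" for j :: nat
  define \<rho> where "\<rho> = (2::real) powr - (s * p)"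
  define T where "T = (\<integral>\<^sup>+y. (if R \<le> dist x0 y then ennreal (dist x0 y powr - a) else 0) \<partial>lborel)"
  have \<omega>: "0 < \<omega>" by (simp add: \<omega>_def)
  have sp: "0 < s * p" using s p by simp
  have a1: "1 \<le> a" using sp DIM_positive[where 'a='a] unfolding a_def by linarith
  have \<rho>: "0 < \<rho>" "\<rho> < 1" using sp by (auto simp: \<rho>_def intro!: powr_less_one)
  have t: "2 * R \<le> t j" "0 < t j" for j
    using R mult_left_mono[of 1 "2 ^ j" "2 * R"] by (auto simp: t_def)
  \<comment> \<open>Since $t_j \ge 2R$ and $N \ge 1$, removing the ball of radius \<open>R\<close> takes away at most half of the volume.\<close>
  have shell: "ennreal (\<omega> / 2 * t j ^ DIM('a)) \<le> emeasure lborel (ball x0 (t j) - ball x0 R)" for j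
  proof -
    have "R ^ DIM('a) \<le> (t j / 2) ^ DIM('a)" using t[of j] R by (intro power_mono) auto
    also have "\<dots> \<le> t j ^ DIM('a) / 2"
      unfolding power_divide
      using t(2)[of j] self_le_power[of "2::real" "DIM('a)"] DIM_positive[where 'a='a]
      by (intro divide_left_mono) auto
    finally have "R ^ DIM('a) \<le> t j ^ DIM('a) / 2" .
    then have "\<omega> * R ^ DIM('a) \<le> \<omega> * (t j ^ DIM('a) / 2)" using \<omega> by simp
    then have "ennreal (\<omega> / 2 * t j ^ DIM('a)) \<le> ennreal (\<omega> * t j ^ DIM('a) - \<omega> * R ^ DIM('a))"
      by (intro ennreal_leI) (simp add: field_simps)
    also have "\<dots> = emeasure lborel (ball x0 (t j)) - emeasure lborel (ball x0 R)"
      using R t[of j] \<omega> by (simp add: emeasure_ball ennreal_minus \<omega>_def)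
    also have "\<dots> = emeasure lborel (ball x0 (t j) - ball x0 R)"
      using R t[of j] by (intro emeasure_Diff[symmetric]) (auto simp: emeasure_ball subset_ball)
    finally show ?thesis .
  qed
  have "ennreal (\<Sum>j<n. \<rho> ^ j) * ennreal (\<omega> / 2 * (2 * R) powr - (s * p)) \<le> 2 * T" for n
  proof -
    define f where "f j y = ennreal (t j powr - a) * indicator (ball x0 (t j) - ball x0 R) y" for j and y :: 'a
    have f: "j \<in> {..<n} \<Longrightarrow> f j \<in> borel_measurable lborel" for j
      unfolding f_def by (intro borel_measurable_times_ennreal borel_measurable_const borel_measurable_indicator sets.Diff) (auto simp del: mem_ball)
    have "ennreal (\<Sum>j<n. \<rho> ^ j) * ennreal (\<omega> / 2 * (2 * R) powr - (s * p))
      = ennreal (\<Sum>j<n. \<rho> ^ j * (\<omega> / 2 * (2 * R) powr - (s * p)))"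
      unfolding sum_distrib_right[symmetric] using \<omega> \<rho> by (subst ennreal_mult) (auto intro!: sum_nonneg)
    also have "\<dots> = (\<Sum>j<n. ennreal (\<rho> ^ j * (\<omega> / 2 * (2 * R) powr - (s * p))))"
      using \<omega> \<rho> by (subst sum_ennreal) auto
    also have "\<dots> = (\<Sum>j<n. ennreal (t j powr - a) * ennreal (\<omega> / 2 * t j ^ DIM('a)))"
    proof (intro sum.cong refl)
      fix j
      have "\<rho> ^ j = (2 ^ j) powr - (s * p)"
      proof -
        have "(2 ^ j) powr - (s * p) = (2 powr real j) powr - (s * p)" by (simp add: powr_realpow)
        then show ?thesis by (simp add: \<rho>_def powr_powr powr_power)
      qed
      then have "\<rho> ^ j * (2 * R) powr - (s * p) = t j powr - (s * p)"
        using R by (simp add: t_def powr_mult mult_ac)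
      also have "\<dots> = t j powr - a * t j ^ DIM('a)"
        using t(2)[of j] by (simp add: a_def powr_realpow[symmetric] powr_add[symmetric] del: powr_realpow)
      finally show "ennreal (\<rho> ^ j * (\<omega> / 2 * (2 * R) powr - (s * p)))
        = ennreal (t j powr - a) * ennreal (\<omega> / 2 * t j ^ DIM('a))"
        using \<omega> t(2)[of j] by (subst ennreal_mult[symmetric]) (auto simp: mult_ac)
    qed
    also have "\<dots> \<le> (\<Sum>j<n. ennreal (t j powr - a) * emeasure lborel (ball x0 (t j) - ball x0 R))"
      by (intro sum_mono mult_left_mono shell) auto
    also have "\<dots> = (\<integral>\<^sup>+y. (\<Sum>j<n. f j y) \<partial>lborel)"
    proof -
      have "(\<Sum>j<n. ennreal (t j powr - a) * emeasure lborel (ball x0 (t j) - ball x0 R)) = (\<Sum>j<n. integral\<^sup>N lborel (f j))"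
        unfolding f_def by (rule sum.cong[OF refl]) (rule nn_integral_cmult_indicator[symmetric], simp)
      then show ?thesis by (simp only: nn_integral_sum[OF f])
    qed
    also have "\<dots> \<le> (\<integral>\<^sup>+y. 2 * (if R \<le> dist x0 y then ennreal (dist x0 y powr - a) else 0) \<partial>lborel)"
    proof (intro nn_integral_mono)
      fix y
      show "(\<Sum>j<n. f j y)
         \<le> 2 * (if R \<le> dist x0 y then ennreal (dist x0 y powr - a) else 0)"
      proof (cases "R \<le> dist x0 y")
        case True
        have "(\<Sum>j<n. f j y)
          = (\<Sum>j<n. ennreal (if dist x0 y < 2 * R * 2 ^ j then (2 * R * 2 ^ j) powr - a else 0))"
          using True by (intro sum.cong) (auto simp: f_def t_def indicator_def)
        also have "\<dots> = ennreal (\<Sum>j<n. (if dist x0 y < 2 * R * 2 ^ j then (2 * R * 2 ^ j) powr - a else 0))"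
          by (subst sum_ennreal) auto
        also have "\<dots> \<le> ennreal (2 * dist x0 y powr - a)"
          using True R a1 by (intro ennreal_leI increasing_radii_sum_le) auto
        also have "\<dots> = 2 * ennreal (dist x0 y powr - a)" by (subst ennreal_mult) auto
        finally show ?thesis using True by simp
      qed (auto simp: f_def indicator_def)
    qed
    also have "\<dots> = 2 * T" by (simp add: T_def nn_integral_cmult)
    finally show ?thesis .
  qed
  then have "ennreal (\<omega> / 2 * (2 * R) powr - (s * p)) \<le> ennreal (1 - \<rho>) * (2 * T)"
    by (rule geometric_bound_ennreal[OF \<rho>])
  also have "\<dots> \<le> ennreal (s * p) * (2 * T)"
    using one_minus_two_powr_le[of "s * p"] sp by (intro mult_right_mono ennreal_leI) (auto simp: \<rho>_def)
  also have "\<dots> = ennreal (2 * s * p) * T"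
  proof -
    have "ennreal (2 * s * p) = ennreal (s * p) * ennreal 2"
      using sp by (subst ennreal_mult[symmetric]) (auto simp: mult_ac)
    then show ?thesis by (simp add: mult.assoc)
  qed
  finally show ?thesis unfolding T_def a_def \<omega>_def .
qed

text \<open>The Maz'ya-Shaposhnikova factor \<open>s\<close>: two points of the ball are compared through every point \<open>y\<close>
  outside the ball. The two resulting terms are controlled by the energy on \<open>ball x0 R \<times> UNIV\<close>, while
  the integral of the kernel over all such \<open>y\<close> is of order $R^{-sp}/s$.\<close>

lemma osc_le_gagliardo_exterior:
  fixes u :: "'a::euclidean_space \<Rightarrow> real"
  assumes [measurable]: "u \<in> borel_measurable borel"
    and R: "0 < R" and s: "0 < s" "s < 1" and p: "1 \<le> p"
  shows "osc p (ball x0 R) (2 * R) u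
    \<le> ennreal (8 * p * 2 powr (real DIM('a) + 3 * p) * s * R powr (real DIM('a) + s * p)) * gagliardo p s (ball x0 R) UNIV u"
proof -
  define a where "a = real DIM('a) + s * p"
  define \<omega> where "\<omega> = unit_ball_vol (real DIM('a))"
  define T where "T = (\<integral>\<^sup>+y. (if R \<le> dist x0 y then ennreal (dist x0 y powr - a) else 0) \<partial>lborel)"
  define h where "h x = (\<integral>\<^sup>+y. ennreal (\<bar>u x - u y\<bar> powr p / norm (x - y) powr a) \<partial>lborel)" for x
  define G where "G = gagliardo p s (ball x0 R) UNIV u"
  define c where "c = \<omega> / 2 * (2 * R) powr - (s * p)"
  define K where "K = 2 * s * p * 2 powr (p - 1 + a)"
  have \<omega>: "0 < \<omega>" by (simp add: \<omega>_def)
  have sp: "0 < s * p" using s p by simp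
  have a0: "0 < a" using sp unfolding a_def by (simp add: add_nonneg_pos)
  have c: "0 < c" using \<omega> R by (simp add: c_def)
  have K: "0 \<le> K" using s p by (simp add: K_def)
  have [measurable]: "h \<in> borel_measurable borel" unfolding h_def by measurable
  have Gh: "G = (\<integral>\<^sup>+x. indicator (ball x0 R) x * h x \<partial>lborel)"
    unfolding G_def by (subst gagliardo_iterated)
      (auto simp: h_def a_def indicator_def intro!: nn_integral_cong)
  have cT: "ennreal c \<le> ennreal (2 * s * p) * T"
    unfolding c_def T_def a_def \<omega>_def by (rule exterior_kernel_ge[OF R s p])
  have three: "ennreal (\<bar>u x - u x'\<bar> powr p) * T \<le> ennreal (2 powr (p - 1 + a)) * (h x + h x')"
    if x: "x \<in> ball x0 R" "x' \<in> ball x0 R" for x x'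
  proof -
    have "ennreal (\<bar>u x - u x'\<bar> powr p) * T
       = (\<integral>\<^sup>+y. ennreal (\<bar>u x - u x'\<bar> powr p) * (if R \<le> dist x0 y then ennreal (dist x0 y powr - a) else 0) \<partial>lborel)"
      unfolding T_def by (subst nn_integral_cmult) auto
    also have "\<dots> \<le> (\<integral>\<^sup>+y. ennreal (2 powr (p - 1 + a)) * (ennreal (\<bar>u x - u y\<bar> powr p / norm (x - y) powr a)
         + ennreal (\<bar>u x' - u y\<bar> powr p / norm (x' - y) powr a)) \<partial>lborel)"
    proof (intro nn_integral_mono)
      fix y
      show "ennreal (\<bar>u x - u x'\<bar> powr p) * (if R \<le> dist x0 y then ennreal (dist x0 y powr - a) else 0)
        \<le> ennreal (2 powr (p - 1 + a)) * (ennreal (\<bar>u x - u y\<bar> powr p / norm (x - y) powr a)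
         + ennreal (\<bar>u x' - u y\<bar> powr p / norm (x' - y) powr a))"
      proof (cases "R \<le> dist x0 y")
        case True
        \<comment> \<open>As $|y - x_0| \ge R$ and $z \in B_R$, the distances from \<open>y\<close> to \<open>z\<close> and to the centre are comparable.\<close>
        have near: "dist x0 y powr - a \<le> 2 powr a / norm (z - y) powr a" if "z \<in> ball x0 R" for z
        proof -
          have "norm (z - y) \<le> 2 * dist x0 y" "0 < norm (z - y)"
            using that True dist_triangle[of z y x0] R by (auto simp: dist_norm[symmetric] dist_commute)
          then have "norm (z - y) powr a \<le> (2 * dist x0 y) powr a" using a0 by (intro powr_mono2) auto
          also have "\<dots> = 2 powr a * dist x0 y powr a" by (simp add: powr_mult)
          finally have "norm (z - y) powr a \<le> 2 powr a * dist x0 y powr a" .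
          moreover have "0 < dist x0 y" using True R by linarith
          ultimately show ?thesis using \<open>0 < norm (z - y)\<close>
            by (simp add: powr_minus divide_simps mult_ac)
        qed
        have "\<bar>u x - u x'\<bar> powr p \<le> (\<bar>u x - u y\<bar> + \<bar>u x' - u y\<bar>) powr p"
          using p by (intro powr_mono2) auto
        also have "\<dots> \<le> 2 powr (p - 1) * (\<bar>u x - u y\<bar> powr p + \<bar>u x' - u y\<bar> powr p)"
          using p by (intro powr_add_le) auto
        finally have "\<bar>u x - u x'\<bar> powr p * dist x0 y powr - a
          \<le> 2 powr (p - 1) * (\<bar>u x - u y\<bar> powr p + \<bar>u x' - u y\<bar> powr p) * dist x0 y powr - a"
          by (intro mult_right_mono) auto
        also have "\<dots> = 2 powr (p - 1) * (\<bar>u x - u y\<bar> powr p * dist x0 y powr - a + \<bar>u x' - u y\<bar> powr p * dist x0 y powr - a)"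
          by (simp add: algebra_simps)
        also have "\<dots> \<le> 2 powr (p - 1) * (\<bar>u x - u y\<bar> powr p * (2 powr a / norm (x - y) powr a)
            + \<bar>u x' - u y\<bar> powr p * (2 powr a / norm (x' - y) powr a))"
          using x near by (intro mult_left_mono add_mono) auto
        also have "\<dots> = 2 powr (p - 1 + a) * (\<bar>u x - u y\<bar> powr p / norm (x - y) powr a
            + \<bar>u x' - u y\<bar> powr p / norm (x' - y) powr a)"
          by (simp only: powr_add) (simp add: distrib_left mult_ac)
        finally show ?thesis using True
          by (simp add: ennreal_mult[symmetric] ennreal_plus[symmetric] del: ennreal_plus)
      qed auto
    qed
    also have "\<dots> = ennreal (2 powr (p - 1 + a)) * (h x + h x')"
      unfolding h_def by (subst nn_integral_cmult) (auto simp: nn_integral_add)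
    finally show ?thesis .
  qed
  have pt: "ennreal c * (if x \<in> ball x0 R \<and> x' \<in> ball x0 R \<and> dist x x' < 2 * R then ennreal (\<bar>u x - u x'\<bar> powr p) else 0)
     \<le> ennreal K * (indicator (ball x0 R) x' * (indicator (ball x0 R) x * h x) + indicator (ball x0 R) x * (indicator (ball x0 R) x' * h x'))"
    for x x'
  proof (cases "x \<in> ball x0 R \<and> x' \<in> ball x0 R")
    case True
    have "ennreal c * ennreal (\<bar>u x - u x'\<bar> powr p) \<le> ennreal (2 * s * p) * T * ennreal (\<bar>u x - u x'\<bar> powr p)"
      by (intro mult_right_mono cT) auto
    also have "\<dots> = ennreal (2 * s * p) * (ennreal (\<bar>u x - u x'\<bar> powr p) * T)" by (simp add: mult_ac)
    also have "\<dots> \<le> ennreal (2 * s * p) * (ennreal (2 powr (p - 1 + a)) * (h x + h x'))"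
      using True by (intro mult_left_mono three) auto
    also have "\<dots> = ennreal K * (h x + h x')" using s p by (simp add: K_def ennreal_mult mult.assoc)
    finally show ?thesis using True by simp
  qed auto
  have "ennreal c * osc p (ball x0 R) (2 * R) u
     = (\<integral>\<^sup>+x. \<integral>\<^sup>+x'. ennreal c * (if x \<in> ball x0 R \<and> x' \<in> ball x0 R \<and> dist x x' < 2 * R then ennreal (\<bar>u x - u x'\<bar> powr p) else 0) \<partial>lborel \<partial>lborel)"
    unfolding osc_def by (simp add: nn_integral_cmult)
  also have "\<dots> \<le> (\<integral>\<^sup>+x. \<integral>\<^sup>+x'. ennreal K * (indicator (ball x0 R) x' * (indicator (ball x0 R) x * h x) + indicator (ball x0 R) x * (indicator (ball x0 R) x' * h x')) \<partial>lborel \<partial>lborel)"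
    by (intro nn_integral_mono pt)
  also have "\<dots> = (\<integral>\<^sup>+x. ennreal K * (emeasure lborel (ball x0 R) * (indicator (ball x0 R) x * h x) + indicator (ball x0 R) x * G) \<partial>lborel)"
  proof (intro nn_integral_cong)
    fix x
    show "(\<integral>\<^sup>+x'. ennreal K * (indicator (ball x0 R) x' * (indicator (ball x0 R) x * h x) + indicator (ball x0 R) x * (indicator (ball x0 R) x' * h x')) \<partial>lborel)
      = ennreal K * (emeasure lborel (ball x0 R) * (indicator (ball x0 R) x * h x) + indicator (ball x0 R) x * G)"
    proof -
      define i where "i = (indicator (ball x0 R) :: 'a \<Rightarrow> ennreal)"
      define g where "g x = i x * h x" for x
      have i[measurable]: "i \<in> borel_measurable lborel" unfolding i_def by (rule borel_measurable_indicator) simp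
      have g[measurable]: "g \<in> borel_measurable lborel" unfolding g_def by simp
      have "(\<integral>\<^sup>+x'. ennreal K * (i x' * g x + i x * g x') \<partial>lborel)
         = ennreal K * (integral\<^sup>N lborel i * g x + i x * integral\<^sup>N lborel g)"
        by (simp add: nn_integral_cmult nn_integral_add nn_integral_multc)
      then show ?thesis unfolding Gh g_def i_def by simp
    qed
  qed
  also have "\<dots> = ennreal K * (emeasure lborel (ball x0 R) * G + emeasure lborel (ball x0 R) * G)"
  proof -
    define i where "i = (indicator (ball x0 R) :: 'a \<Rightarrow> ennreal)"
    define g where "g x = i x * h x" for x
    have i[measurable]: "i \<in> borel_measurable lborel" unfolding i_def by (rule borel_measurable_indicator) simp
    have g[measurable]: "g \<in> borel_measurable lborel" unfolding g_def by simp
    have "(\<integral>\<^sup>+x. ennreal K * (emeasure lborel (ball x0 R) * g x + i x * G) \<partial>lborel)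
       = ennreal K * (emeasure lborel (ball x0 R) * integral\<^sup>N lborel g + integral\<^sup>N lborel i * G)"
      by (simp add: nn_integral_cmult nn_integral_add nn_integral_multc)
    moreover have "integral\<^sup>N lborel g = G" unfolding Gh g_def i_def ..
    moreover have "integral\<^sup>N lborel i = emeasure lborel (ball x0 R)" unfolding i_def by simp
    ultimately show ?thesis unfolding g_def i_def by simp
  qed
  also have "\<dots> = ennreal K * (2 * (ennreal (\<omega> * R ^ DIM('a)) * G))"
    using R by (simp add: emeasure_ball \<omega>_def mult_2)
  also have "\<dots> = ennreal (K * 2 * (\<omega> * R ^ DIM('a))) * G"
    using K \<omega> R by (simp add: ennreal_mult mult.assoc)
  finally have "osc p (ball x0 R) (2 * R) u \<le> ennreal (K * 2 * (\<omega> * R ^ DIM('a)) / c) * G"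
    using c K \<omega> R by (intro ennreal_cancel_const) auto
  also have "\<dots> \<le> ennreal (8 * p * 2 powr (real DIM('a) + 3 * p) * s * R powr (real DIM('a) + s * p)) * G"
  proof (intro mult_right_mono ennreal_leI)
    have "K * 2 * (\<omega> * R ^ DIM('a)) / c = K * 4 * (2 * R) powr (s * p) * R ^ DIM('a)"
      using \<omega> R by (simp add: c_def powr_minus field_simps)
    also have "\<dots> = 8 * p * s * (2 powr (p - 1 + a) * 2 powr (s * p)) * (R powr (s * p) * R powr DIM('a))"
      using R by (simp add: K_def powr_mult powr_realpow)
    also have "\<dots> = 8 * p * s * 2 powr (p - 1 + a + s * p) * R powr (real DIM('a) + s * p)"
      by (simp add: powr_add[symmetric] add_ac)
    also have "\<dots> \<le> 8 * p * s * 2 powr (real DIM('a) + 3 * p) * R powr (real DIM('a) + s * p)"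
    proof (intro mult_right_mono mult_left_mono powr_mono)
      have "s * p \<le> p" using s p by (simp add: mult_le_cancel_right1)
      then show "p - 1 + a + s * p \<le> real DIM('a) + 3 * p" unfolding a_def by linarith
    qed (use s p in auto)
    finally show "K * 2 * (\<omega> * R ^ DIM('a)) / c \<le> 8 * p * 2 powr (real DIM('a) + 3 * p) * s * R powr (real DIM('a) + s * p)"
      by (simp add: mult_ac)
  qed auto
  finally show ?thesis unfolding G_def .
qed

lemma gagliardo_mono_set:
  assumes "A \<subseteq> A'" "B \<subseteq> B'"
  shows "gagliardo p s A B u \<le> gagliardo p s A' B' u"
  unfolding gagliardo_def using assms by (intro nn_integral_mono mult_left_mono) (auto simp: indicator_def)

text \<open>Every pair of points of the ball is at distance less than \<open>2 R\<close>, so this is a Poincare inequality in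
  terms of mean differences. It combines the two bounds with factors \<open>s\<close> and \<open>1 - s\<close>, since
  \<open>min s (1 - s) \<le> 2 * s * (1 - s)\<close>.\<close>

lemma poincare_osc:
  fixes u :: "'a::euclidean_space \<Rightarrow> real"
  assumes [measurable]: "u \<in> borel_measurable borel"
    and R: "0 < R" and s: "0 < s" "s < 1" and p: "1 \<le> p" and H: "0 \<le> H"
    and GH: "gagliardo p s (ball x0 R) UNIV u \<le> ennreal H"
  shows "osc p (ball x0 R) (2 * R) u
    \<le> ennreal (16 * p * 2 powr (real DIM('a) + 3 * p) * (s * (1 - s)) * R powr (real DIM('a) + s * p) * H)"
proof -
  define a where "a = real DIM('a) + s * p"
  define K where "K = 8 * p * 2 powr (real DIM('a) + 3 * p)"
  have K0: "0 < K" using p by (simp add: K_def)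
  have spp: "s * p \<le> p" "0 < s * p" using s p by (auto simp: mult_le_cancel_right1)
  have 1: "osc p (ball x0 R) (2 * R) u \<le> ennreal (K * s * R powr a * H)"
  proof -
    have "osc p (ball x0 R) (2 * R) u \<le> ennreal (K * s * R powr a) * gagliardo p s (ball x0 R) UNIV u"
      unfolding K_def a_def by (rule osc_le_gagliardo_exterior) (use assms in auto)
    also have "\<dots> \<le> ennreal (K * s * R powr a) * ennreal H" by (intro mult_left_mono GH) auto
    also have "\<dots> = ennreal (K * s * R powr a * H)" using K0 s H by (simp add: ennreal_mult)
    finally show ?thesis .
  qed
  have 2: "osc p (ball x0 R) (2 * R) u \<le> ennreal (K * (1 - s) * R powr a * H)"
  proof -
    have "ennreal ((2 * R) powr - a) * osc p (ball x0 R) (2 * R) u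
        \<le> ennreal (2 * p * (1 - s)) * energy_on p s (ball x0 R) u"
      unfolding a_def by (rule osc_le_gagliardo) (use assms in auto)
    also have "\<dots> \<le> ennreal (2 * p * (1 - s)) * ennreal H"
      by (intro mult_left_mono order_trans[OF gagliardo_mono_set GH]) auto
    finally have "osc p (ball x0 R) (2 * R) u \<le> ennreal (2 * p * (1 - s) / (2 * R) powr - a) * ennreal H"
      using s p R by (intro ennreal_cancel_const) auto
    also have "\<dots> = ennreal (2 * p * (1 - s) / (2 * R) powr - a * H)"
      using s p H by (subst ennreal_mult) auto
    also have "\<dots> \<le> ennreal (K * (1 - s) * R powr a * H)"
    proof (intro ennreal_leI mult_right_mono)
      have "2 * p * (1 - s) / (2 * R) powr - a = 2 * p * 2 powr a * (1 - s) * R powr a"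
        using R by (simp add: powr_minus powr_mult field_simps)
      also have "\<dots> \<le> K * (1 - s) * R powr a"
        unfolding K_def using s p spp
        by (intro mult_right_mono mult_mono powr_mono) (auto simp: a_def)
      finally show "2 * p * (1 - s) / (2 * R) powr - a \<le> K * (1 - s) * R powr a" .
    qed (use H in auto)
    finally show ?thesis .
  qed
  have "min s (1 - s) \<le> 2 * (s * (1 - s))"
  proof (cases "s \<le> 1 / 2")
    case True
    then have "s * 1 \<le> s * (2 * (1 - s))" using s by (intro mult_left_mono) auto
    then have "s \<le> 2 * (s * (1 - s))" by (simp only: mult_1_right mult.left_commute)
    then show ?thesis using min.cobounded1[of s "1 - s"] by linarith
  next
    case False
    then have "1 * (1 - s) \<le> (2 * s) * (1 - s)" using s by (intro mult_right_mono) auto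
    then show ?thesis using min.cobounded2[of s "1 - s"] by simp
  qed
  then have "(K * R powr a * H) * min s (1 - s) \<le> (K * R powr a * H) * (2 * (s * (1 - s)))"
    using K0 H by (intro mult_left_mono) auto
  moreover have "osc p (ball x0 R) (2 * R) u \<le> ennreal ((K * R powr a * H) * min s (1 - s))"
    using 1 2 by (auto simp: min_def mult_ac)
  ultimately have "osc p (ball x0 R) (2 * R) u \<le> ennreal ((K * R powr a * H) * (2 * (s * (1 - s))))"
    by (meson ennreal_leI order_trans)
  also have "(K * R powr a * H) * (2 * (s * (1 - s))) = 16 * p * 2 powr (real DIM('a) + 3 * p) * (s * (1 - s)) * R powr (real DIM('a) + s * p) * H"
    by (simp add: K_def a_def)
  finally show ?thesis .
qed

text \<open>The constant is a value of \<open>u\<close> at a point at which the inner integral does not exceed twice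
  the bound for its mean; this replaces the average of \<open>u\<close>.\<close>

lemma exists_good_constant:
  fixes u :: "'a::euclidean_space \<Rightarrow> real"
  assumes [measurable]: "u \<in> borel_measurable borel" and R: "0 < R" and L: "0 < L"
    and le: "osc p (ball x0 R) (2 * R) u \<le> ennreal (L * R powr real DIM('a))"
  shows "\<exists>m. power_integral p (ball x0 R) (\<lambda>x. u x - m) \<le> ennreal (2 * L / unit_ball_vol (real DIM('a)))"
proof (rule ccontr)
  define \<omega> where "\<omega> = unit_ball_vol (real DIM('a))"
  have \<omega>: "0 < \<omega>" by (simp add: \<omega>_def)
  assume "\<not> ?thesis"
  \<comment> \<open>If no constant worked, every inner integral would exceed twice the mean value that the hypothesis allows.\<close>
  then have less: "ennreal (2 * L / \<omega>) < power_integral p (ball x0 R) (\<lambda>x. u x - m)" for m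
    by (auto simp: not_le \<omega>_def)
  have "ennreal (2 * L * R powr real DIM('a)) = (\<integral>\<^sup>+x\<in>ball x0 R. ennreal (2 * L / \<omega>) \<partial>lborel)"
    using R \<omega> L by (subst nn_integral_cmult_indicator)
      (auto simp: emeasure_ball \<omega>_def[symmetric] ennreal_mult[symmetric] powr_realpow)
  also have "\<dots> \<le> (\<integral>\<^sup>+x\<in>ball x0 R. (\<integral>\<^sup>+y\<in>ball x0 R. ennreal (\<bar>u y - u x\<bar> powr p) \<partial>lborel) \<partial>lborel)"
    by (intro nn_integral_mono mult_right_mono less_imp_le[OF less]) auto
  also have "\<dots> = osc p (ball x0 R) (2 * R) u"
    unfolding osc_def
  proof (intro nn_integral_cong)
    fix x
    have "dist x y < 2 * R" if "x \<in> ball x0 R" "y \<in> ball x0 R" for y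
      using that dist_triangle[of x y x0] by (auto simp: dist_commute)
    then show "(\<integral>\<^sup>+y\<in>ball x0 R. ennreal (\<bar>u y - u x\<bar> powr p) \<partial>lborel) * indicator (ball x0 R) x
      = (\<integral>\<^sup>+y. (if x \<in> ball x0 R \<and> y \<in> ball x0 R \<and> dist x y < 2 * R then ennreal (\<bar>u x - u y\<bar> powr p) else 0) \<partial>lborel)"
      by (cases "x \<in> ball x0 R") (auto intro!: nn_integral_cong simp: indicator_def abs_minus_commute simp del: mem_ball)
  qed
  also have "\<dots> \<le> ennreal (L * R powr real DIM('a))" by (rule le)
  finally show False using L R by (simp add: ennreal_le_iff)
qed

section \<open>Energy estimates for superlevel sets\<close>

lemma ball_density:
  fixes x0 x :: "'a::euclidean_space"
  assumes x: "x \<in> ball x0 R" and t: "0 < t" "t \<le> 2 * R"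
  shows "\<exists>z. ball z (t / 4) \<subseteq> ball x t \<inter> ball x0 R"
proof (intro exI)
  define l where "l = t / (4 * R)"
  have R: "0 < R" using t by simp
  have l: "0 < l" "l \<le> 1 / 2" "l * R = t / 4" using t R by (auto simp: l_def field_simps)
  have xx: "norm (x0 - x) \<le> R" using x by (simp add: dist_norm)
  have d1: "dist x (x + l *\<^sub>R (x0 - x)) \<le> t / 4"
  proof -
    have "l * norm (x0 - x) \<le> t / 4" using l mult_left_mono[OF xx, of l] by linarith
    then show ?thesis using l by (simp add: dist_norm)
  qed
  have "x0 - (x + l *\<^sub>R (x0 - x)) = (1 - l) *\<^sub>R (x0 - x)" by (simp add: algebra_simps)
  then have d2: "dist x0 (x + l *\<^sub>R (x0 - x)) \<le> R - t / 4"
  proof -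
    have "(1 - l) * norm (x0 - x) \<le> (1 - l) * R" using l xx by (intro mult_left_mono) auto
    also have "\<dots> = R - t / 4" using l by (simp add: algebra_simps)
    finally show ?thesis using l \<open>x0 - (x + l *\<^sub>R (x0 - x)) = (1 - l) *\<^sub>R (x0 - x)\<close> by (simp add: dist_norm)
  qed
  show "ball (x + l *\<^sub>R (x0 - x)) (t / 4) \<subseteq> ball x t \<inter> ball x0 R"
  proof
    fix y assume "y \<in> ball (x + l *\<^sub>R (x0 - x)) (t / 4)"
    then have d3: "dist (x + l *\<^sub>R (x0 - x)) y < t / 4" by simp
    have "dist x y < t" using d1 d3 t dist_triangle[of x y "x + l *\<^sub>R (x0 - x)"] by simp
    moreover have "dist x0 y < R" using d2 d3 dist_triangle[of x0 y "x + l *\<^sub>R (x0 - x)"] by simp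
    ultimately show "y \<in> ball x t \<inter> ball x0 R" by simp
  qed
qed

text \<open>A ball of radius \<open>t\<close> centred in \<open>ball x0 R\<close>, with \<open>t \<le> 2 R\<close>, contains a ball of radius $t/4$ that
  lies in \<open>ball x0 R\<close>; this is the volume of such a ball divided by $t^N$.\<close>

definition density_const :: "nat \<Rightarrow> real" where "density_const n = unit_ball_vol (real n) / 4 ^ n"

lemma density_const_pos: "0 < density_const n" by (simp add: density_const_def)

text \<open>If the support \<open>A\<close> of \<open>v\<close> fills at most half of the volume that every ball of radius \<open>t\<close> centred in
  the domain is known to share with the domain, each point of \<open>B\<close> sees a jump of height \<open>\<gamma>\<close> to the other half.\<close>

lemma osc_ge_level:
  fixes v :: "'a::euclidean_space \<Rightarrow> real"
  assumes [measurable]: "v \<in> borel_measurable borel" "A \<in> sets borel" "B \<in> sets borel"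
    and B: "B \<subseteq> ball x0 R" and A: "A \<subseteq> ball x0 R"
    and vB: "\<And>x. x \<in> B \<Longrightarrow> v x = \<gamma>" and vA: "\<And>x. x \<in> ball x0 R - A \<Longrightarrow> v x = 0"
    and \<gamma>: "0 < \<gamma>" and t: "0 < t" "t \<le> 2 * R"
    and small: "2 * measure lborel A \<le> density_const DIM('a) * t ^ DIM('a)"
  shows "ennreal (\<gamma> powr p * (density_const DIM('a) / 2 * t ^ DIM('a))) * emeasure lborel B \<le> osc p (ball x0 R) t v"
proof -
  let ?c = "density_const DIM('a)"
  have R: "0 < R" using t by simp
  have finA: "emeasure lborel A = ennreal (measure lborel A)"
  proof (rule emeasure_eq_ennreal_measure)
    have "emeasure lborel A \<le> emeasure lborel (ball x0 R)" using A by (intro emeasure_mono) auto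
    then show "emeasure lborel A \<noteq> top" using R by (auto simp: emeasure_ball top_unique)
  qed
  have inner: "ennreal (?c / 2 * t ^ DIM('a)) \<le> emeasure lborel (ball x t \<inter> ball x0 R - A)" if "x \<in> B" for x
  proof -
    have "x \<in> ball x0 R" using that B by blast
    from ball_density[OF this t] obtain z where z: "ball z (t / 4) \<subseteq> ball x t \<inter> ball x0 R" by blast
    have "ennreal (?c * t ^ DIM('a)) = emeasure lborel (ball z (t / 4))"
      using t by (simp add: emeasure_ball density_const_def power_divide)
    also have "\<dots> \<le> emeasure lborel ((ball x t \<inter> ball x0 R - A) \<union> A)"
      using z by (intro emeasure_mono) auto
    also have "\<dots> \<le> emeasure lborel (ball x t \<inter> ball x0 R - A) + emeasure lborel A"
      by (intro emeasure_subadditive) auto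
    finally have 1: "ennreal (?c * t ^ DIM('a)) \<le> emeasure lborel (ball x t \<inter> ball x0 R - A) + ennreal (measure lborel A)"
      by (simp add: finA)
    have "ennreal (?c / 2 * t ^ DIM('a)) \<le> ennreal (?c * t ^ DIM('a)) - ennreal (measure lborel A)"
      using small by (subst ennreal_minus) (auto intro!: ennreal_leI)
    also have "\<dots> \<le> emeasure lborel (ball x t \<inter> ball x0 R - A)"
      using 1 by (subst ennreal_minus_le_iff) (auto simp: add.commute)
    finally show ?thesis .
  qed
  have "ennreal (\<gamma> powr p * (?c / 2 * t ^ DIM('a))) * emeasure lborel B
     = (\<integral>\<^sup>+x. ennreal (\<gamma> powr p * (?c / 2 * t ^ DIM('a))) * indicator B x \<partial>lborel)"
    by (rule nn_integral_cmult_indicator[symmetric]) simp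
  also have "\<dots> \<le> osc p (ball x0 R) t v"
    unfolding osc_def
  proof (intro nn_integral_mono)
    fix x
    show "ennreal (\<gamma> powr p * (?c / 2 * t ^ DIM('a))) * indicator B x
      \<le> (\<integral>\<^sup>+y. (if x \<in> ball x0 R \<and> y \<in> ball x0 R \<and> dist x y < t then ennreal (\<bar>v x - v y\<bar> powr p) else 0) \<partial>lborel)"
    proof (cases "x \<in> B")
      case True
      have "ennreal (\<gamma> powr p * (?c / 2 * t ^ DIM('a))) = ennreal (\<gamma> powr p) * ennreal (?c / 2 * t ^ DIM('a))"
        by (intro ennreal_mult) (use t density_const_pos[of "DIM('a)"] in auto)
      also have "\<dots> \<le> ennreal (\<gamma> powr p) * emeasure lborel (ball x t \<inter> ball x0 R - A)"
        by (intro mult_left_mono inner True) auto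
      also have "\<dots> = (\<integral>\<^sup>+y. ennreal (\<gamma> powr p) * indicator (ball x t \<inter> ball x0 R - A) y \<partial>lborel)"
        by (rule nn_integral_cmult_indicator[symmetric]) simp
      also have "\<dots> \<le> (\<integral>\<^sup>+y. (if x \<in> ball x0 R \<and> y \<in> ball x0 R \<and> dist x y < t then ennreal (\<bar>v x - v y\<bar> powr p) else 0) \<partial>lborel)"
        using True B \<gamma> by (intro nn_integral_mono) (auto simp: indicator_def vB vA)
      finally show ?thesis using True by simp
    qed auto
  qed
  finally show ?thesis .
qed

text \<open>Dyadic radii beyond the size \<open>L\<close> of the domain, where the oscillation no longer grows, contribute
  only a tail of the order $L^{-b}$.\<close>

lemma large_radii_sum_le:
  fixes t L b :: real
  assumes t: "0 < t" and L: "0 < L" and b: "0 < b"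
  shows "(\<Sum>j<n. (t * 2 ^ j) powr - b)
    \<le> (\<Sum>j<n. if t * 2 ^ j \<le> L then (t * 2 ^ j) powr - b else 0) + L powr - b / (1 - 2 powr - b)"
  using t
proof (induction n arbitrary: t)
  case 0
  have "2 powr - b < 1" using b by (auto intro!: powr_less_one)
  then show ?case by simp
next
  case (Suc n)
  show ?case
  proof (cases "t \<le> L")
    case True
    have eq: "(\<Sum>j<n. (t * 2 ^ Suc j) powr - b) = (\<Sum>j<n. ((t * 2) * 2 ^ j) powr - b)"
      "(\<Sum>j<n. if t * 2 ^ Suc j \<le> L then (t * 2 ^ Suc j) powr - b else 0)
      = (\<Sum>j<n. if (t * 2) * 2 ^ j \<le> L then ((t * 2) * 2 ^ j) powr - b else 0)"
      by (auto simp: mult.assoc intro!: sum.cong)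
    show ?thesis using Suc.IH[of "t * 2"] True Suc.prems unfolding sum.lessThan_Suc_shift eq
      by simp
  next
    case False
    define \<rho> where "\<rho> = (2::real) powr - b"
    have \<rho>: "0 < \<rho>" "\<rho> < 1" using b by (auto simp: \<rho>_def intro!: powr_less_one)
    have e: "(t * 2 ^ j) powr - b = t powr - b * \<rho> ^ j" for j
    proof -
      have "(2 ^ j) powr - b = (2 powr real j) powr - b" by (simp add: powr_realpow)
      then show ?thesis using Suc.prems by (simp add: \<rho>_def powr_powr powr_power powr_mult)
    qed
    have "(\<Sum>j<Suc n. (t * 2 ^ j) powr - b) = t powr - b * (\<Sum>j<Suc n. \<rho> ^ j)"
      by (simp only: e sum_distrib_left)
    also have "(\<Sum>j<Suc n. \<rho> ^ j) \<le> 1 / (1 - \<rho>)"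
    proof -
      have "(\<Sum>j<Suc n. \<rho> ^ j) \<le> (\<Sum>j. \<rho> ^ j)" using \<rho> by (intro sum_le_suminf) auto
      then show ?thesis using \<rho> by (simp add: suminf_geometric)
    qed
    then have "t powr - b * (\<Sum>j<Suc n. \<rho> ^ j) \<le> L powr - b * (1 / (1 - \<rho>))"
      using False L b \<rho> by (intro mult_mono powr_mono2') (auto intro!: sum_nonneg add_nonneg_nonneg)
    finally have "(\<Sum>j<Suc n. (t * 2 ^ j) powr - b) \<le> L powr - b / (1 - 2 powr - b)"
      by (simp only: \<rho>_def mult_1_right times_divide_eq_right)
    moreover have "0 \<le> (\<Sum>j<Suc n. if t * 2 ^ j \<le> L then (t * 2 ^ j) powr - b else 0)"
      by (intro sum_nonneg) auto
    ultimately show ?thesis by linarith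
  qed
qed

text \<open>The constant of the next estimate; it depends on neither \<open>s\<close> nor the domain.\<close>

definition level_const :: "nat \<Rightarrow> real \<Rightarrow> real" where
  "level_const n p = max 1 (2 / density_const n) powr p * (8 * p / density_const n + 4 * p)"

lemma level_const_nonneg: "1 \<le> p \<Longrightarrow> 0 < level_const n p"
  using density_const_pos[of n] unfolding level_const_def by (intro mult_pos_pos add_pos_pos) auto

text \<open>The scale \<open>t\<close> is chosen such that \<open>A\<close> fills exactly half of the guaranteed volume at that scale, that
  is $t^N$ is proportional to \<open>|A|\<close>. The scales below \<open>t\<close> provide the factor \<open>1 - s\<close>. The scales above \<open>t\<close>
  provide the factor \<open>s\<close>, but only up to the diameter of the domain; what is missing is the last summand
  on the right, which the Poincare inequality absorbs later.\<close>

lemma level_estimate: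
  fixes v :: "'a::euclidean_space \<Rightarrow> real"
  assumes [measurable]: "v \<in> borel_measurable borel" "A \<in> sets borel" "B \<in> sets borel"
    and B: "B \<subseteq> ball x0 R" and A: "A \<subseteq> ball x0 R"
    and vB: "\<And>x. x \<in> B \<Longrightarrow> v x = \<gamma>" and vA: "\<And>x. x \<in> ball x0 R - A \<Longrightarrow> v x = 0"
    and \<gamma>: "0 < \<gamma>" and R: "0 < R" and p: "1 \<le> p" and s: "0 < s" "s < 1"
    and D: "0 \<le> D" "energy_on p s (ball x0 R) v \<le> ennreal D"
    and small: "2 * measure lborel A \<le> density_const DIM('a) * (2 * R) ^ DIM('a)"
  shows "\<gamma> powr p * measure lborel B * (measure lborel A / R ^ DIM('a)) powr - (s * p / DIM('a))
    \<le> level_const DIM('a) p * (s * (1 - s)) * R powr (s * p) * (D + \<gamma> powr p * measure lborel B * R powr - (s * p) / s)"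
proof (cases "measure lborel A = 0")
  case True
  then show ?thesis using D s level_const_nonneg[OF p, of "DIM('a)"] by simp
next
  case False
  define N where "N = real DIM('a)"
  define a where "a = N + s * p"
  define c where "c = density_const DIM('a)"
  define mA where "mA = measure lborel A"
  define X where "X = \<gamma> powr p * measure lborel B"
  define t where "t = (2 * mA / c) powr (1 / N)"
  have c: "0 < c" by (simp add: c_def density_const_pos)
  have N: "1 \<le> N" using DIM_positive[where 'a='a] unfolding N_def by linarith
  have mA: "0 < mA" using False by (simp add: mA_def zero_less_measure_iff)
  have sp: "0 < s * p" "s * p \<le> p" using s p by (auto simp: mult_le_cancel_right1)
  have a1: "1 \<le> a" using N sp by (simp add: a_def)
  have t0: "0 < t" using mA c by (simp add: t_def)
  have tN: "t powr N = 2 * mA / c" using mA c N by (simp add: t_def powr_powr)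
  have tN': "t ^ DIM('a) = 2 * mA / c" using tN t0 by (simp add: N_def powr_realpow)
  have tR: "t \<le> 2 * R"
  proof -
    have "t ^ DIM('a) \<le> (2 * R) ^ DIM('a)" using small c by (simp add: tN' mA_def c_def field_simps)
    then show ?thesis using R t0 by (intro iffD1[OF power_mono_iff[of t "2 * R" "DIM('a)"]]) auto
  qed
  have X0: "0 \<le> X" by (simp add: X_def)
  have emB: "emeasure lborel B = ennreal (measure lborel B)"
  proof (rule emeasure_eq_ennreal_measure)
    have "emeasure lborel B \<le> emeasure lborel (ball x0 R)" using B by (intro emeasure_mono) auto
    then show "emeasure lborel B \<noteq> top" using R by (auto simp: emeasure_ball top_unique)
  qed
  have lower: "ennreal (X * (c / 2) * r ^ DIM('a)) \<le> osc p (ball x0 R) r v" if "t \<le> r" "r \<le> 2 * R" for r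
  proof -
    have "2 * mA = c * t ^ DIM('a)" using c by (simp add: tN')
    also have "\<dots> \<le> c * r ^ DIM('a)" using that t0 c by (intro mult_left_mono power_mono) auto
    finally have "ennreal (\<gamma> powr p * (c / 2 * r ^ DIM('a))) * emeasure lborel B \<le> osc p (ball x0 R) r v"
      unfolding c_def mA_def using that t0 by (intro osc_ge_level[OF assms(1-3) B A vB vA \<gamma>]) auto
    then show ?thesis using c that t0 by (simp add: emB ennreal_mult[symmetric] X_def mult_ac)
  qed
  \<comment> \<open>Here the oscillations at the scales $2^j t$ are used, up to the diameter of the ball.\<close>
  have small_s: "X * t powr - (s * p) \<le> s * p * (4 / c * D + X * (2 * R) powr - (s * p) * (2 / s))"
  proof -
    define \<rho> where "\<rho> = (2::real) powr - (s * p)"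
    have \<rho>: "0 < \<rho>" "\<rho> < 1" using sp by (auto simp: \<rho>_def intro!: powr_less_one)
    have e: "(t * 2 ^ j) powr - (s * p) = t powr - (s * p) * \<rho> ^ j" for j
    proof -
      have "(2 ^ j) powr - (s * p) = (2 powr real j) powr - (s * p)" by (simp add: powr_realpow)
      then show ?thesis using t0 by (simp add: \<rho>_def powr_powr powr_power powr_mult)
    qed
    have \<rho>s: "1 / (1 - \<rho>) \<le> 2 / s"
    proof -
      have "s / 2 \<le> 1 - 2 powr - s" using s by (intro one_minus_two_powr_ge) auto
      also have "\<dots> \<le> 1 - \<rho>" unfolding \<rho>_def using s p by (intro diff_left_mono powr_mono) (auto simp: mult_le_cancel_left1)
      finally show ?thesis using \<rho> s by (simp add: field_simps)
    qed
    have "(\<Sum>j<n. \<rho> ^ j) * (X * t powr - (s * p)) \<le> 4 / c * D + X * (2 * R) powr - (s * p) * (2 / s)" for n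
    proof -
      have "ennreal (\<Sum>j<n. if t * 2 ^ j \<le> 2 * R then X * (c / 2) * (t * 2 ^ j) powr - (s * p) else 0)
        = (\<Sum>j<n. ennreal (if t * 2 ^ j \<le> 2 * R then X * (c / 2) * (t * 2 ^ j) powr - (s * p) else 0))"
        using X0 c by (subst sum_ennreal) auto
      also have "\<dots> \<le> (\<Sum>j<n. ennreal ((t * 2 ^ j) powr - a) * osc p (ball x0 R) (t * 2 ^ j) v)"
      proof (intro sum_mono)
        fix j
        show "ennreal (if t * 2 ^ j \<le> 2 * R then X * (c / 2) * (t * 2 ^ j) powr - (s * p) else 0)
          \<le> ennreal ((t * 2 ^ j) powr - a) * osc p (ball x0 R) (t * 2 ^ j) v"
        proof (cases "t * 2 ^ j \<le> 2 * R")
          case True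
          have r: "t \<le> t * 2 ^ j" "0 < t * 2 ^ j" using t0 by auto
          have "(t * 2 ^ j) powr - (s * p) = (t * 2 ^ j) powr - a * (t * 2 ^ j) powr N"
            unfolding powr_add[symmetric] by (simp add: a_def)
          then have "(t * 2 ^ j) powr - (s * p) = (t * 2 ^ j) powr - a * (t * 2 ^ j) ^ DIM('a)"
            unfolding N_def powr_realpow[OF r(2)] .
          then have "ennreal (X * (c / 2) * (t * 2 ^ j) powr - (s * p)) = ennreal ((t * 2 ^ j) powr - a) * ennreal (X * (c / 2) * (t * 2 ^ j) ^ DIM('a))"
            using X0 c r by (subst ennreal_mult[symmetric]) (auto simp: mult_ac)
          also have "\<dots> \<le> ennreal ((t * 2 ^ j) powr - a) * osc p (ball x0 R) (t * 2 ^ j) v"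
            by (intro mult_left_mono lower r True) auto
          finally show ?thesis using True by simp
        qed auto
      qed
      also have "\<dots> \<le> 2 * energy_on p s (ball x0 R) v"
        unfolding a_def N_def using p t0 a1
        by (intro sum_osc_le_gagliardo increasing_radii_sum_le) (auto simp: a_def N_def)
      also have "\<dots> \<le> 2 * ennreal D" by (intro mult_left_mono D) auto
      also have "\<dots> = ennreal (2 * D)" using D by (simp add: ennreal_mult)
      finally have "(\<Sum>j<n. if t * 2 ^ j \<le> 2 * R then X * (c / 2) * (t * 2 ^ j) powr - (s * p) else 0) \<le> 2 * D"
        using D by (subst (asm) ennreal_le_iff) auto
      also have "(\<Sum>j<n. if t * 2 ^ j \<le> 2 * R then X * (c / 2) * (t * 2 ^ j) powr - (s * p) else 0)
         = X * (c / 2) * (\<Sum>j<n. if t * 2 ^ j \<le> 2 * R then (t * 2 ^ j) powr - (s * p) else 0)"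
        unfolding sum_distrib_left by (intro sum.cong) auto
      finally have 1: "X * (\<Sum>j<n. if t * 2 ^ j \<le> 2 * R then (t * 2 ^ j) powr - (s * p) else 0) \<le> 4 / c * D"
        using c by (simp add: field_simps)
      have "(\<Sum>j<n. \<rho> ^ j) * (X * t powr - (s * p)) = X * (\<Sum>j<n. (t * 2 ^ j) powr - (s * p))"
        unfolding e sum_distrib_left sum_distrib_right by (intro sum.cong) (auto simp: mult_ac)
      also have "\<dots> \<le> X * ((\<Sum>j<n. if t * 2 ^ j \<le> 2 * R then (t * 2 ^ j) powr - (s * p) else 0) + (2 * R) powr - (s * p) / (1 - \<rho>))"
        unfolding \<rho>_def using t0 R sp X0 by (intro mult_left_mono large_radii_sum_le) auto
      also have "\<dots> \<le> 4 / c * D + X * ((2 * R) powr - (s * p) / (1 - \<rho>))"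
        using 1 by (simp add: distrib_left)
      also have "X * ((2 * R) powr - (s * p) / (1 - \<rho>)) \<le> X * (2 * R) powr - (s * p) * (2 / s)"
        using X0 mult_left_mono[OF \<rho>s, of "X * (2 * R) powr - (s * p)"] by simp
      finally show ?thesis by simp
    qed
    then have "X * t powr - (s * p) \<le> (1 - \<rho>) * (4 / c * D + X * (2 * R) powr - (s * p) * (2 / s))"
      by (rule geometric_bound[OF \<rho>])
    also have "\<dots> \<le> s * p * (4 / c * D + X * (2 * R) powr - (s * p) * (2 / s))"
      using one_minus_two_powr_le[of "s * p"] sp X0 D c s unfolding \<rho>_def
      by (intro mult_right_mono) auto
    finally show ?thesis .
  qed
  \<comment> \<open>Here only the oscillation at scale \<open>t\<close> is used, and the smaller scales enter through the factor \<open>1 - s\<close>.\<close>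
  have large_s: "X * t powr - (s * p) \<le> 4 * p / c * (1 - s) * D"
  proof -
    have "ennreal (t powr - a) * ennreal (X * (c / 2) * t ^ DIM('a)) \<le> ennreal (t powr - a) * osc p (ball x0 R) t v"
      using tR by (intro mult_left_mono lower) auto
    also have "\<dots> \<le> ennreal (2 * p * (1 - s)) * energy_on p s (ball x0 R) v"
      unfolding a_def N_def using p s t0 by (intro osc_le_gagliardo) auto
    also have "\<dots> \<le> ennreal (2 * p * (1 - s)) * ennreal D" by (intro mult_left_mono D) auto
    finally have "ennreal (t powr - a * (X * (c / 2) * t ^ DIM('a))) \<le> ennreal (2 * p * (1 - s) * D)"
      using X0 c t0 p s D by (simp add: ennreal_mult[symmetric])
    then have "t powr - a * (X * (c / 2) * t ^ DIM('a)) \<le> 2 * p * (1 - s) * D"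
      using p s D by (subst (asm) ennreal_le_iff) auto
    moreover have "t powr - a * t ^ DIM('a) = t powr - (s * p)"
      using t0 by (simp add: powr_realpow[symmetric] powr_add[symmetric] a_def N_def del: powr_realpow)
    ultimately have "X * (c / 2) * t powr - (s * p) \<le> 2 * p * (1 - s) * D" by (simp add: mult_ac)
    then show ?thesis using c by (simp add: field_simps)
  qed
  define Z where "Z = D + X * R powr - (s * p) / s"
  have Z: "D \<le> Z" "X * R powr - (s * p) / s \<le> Z" "0 \<le> Z" using D X0 s by (auto simp: Z_def)
  have key: "X * t powr - (s * p) \<le> (8 * p / c + 4 * p) * (s * (1 - s)) * Z"
  proof (cases "s < 1 / 2")
    case True
    have "X * (2 * R) powr - (s * p) * (2 / s) \<le> X * R powr - (s * p) * (2 / s)"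
      using X0 R s sp by (intro mult_right_mono mult_left_mono powr_mono2') auto
    also have "\<dots> = 2 * (X * R powr - (s * p) / s)" by simp
    also have "\<dots> \<le> 2 * Z" using Z by linarith
    finally have "4 / c * D + X * (2 * R) powr - (s * p) * (2 / s) \<le> 4 / c * Z + 2 * Z"
      using Z(1) c by (intro add_mono mult_left_mono) auto
    then have "s * p * (4 / c * D + X * (2 * R) powr - (s * p) * (2 / s)) \<le> s * p * (4 / c * Z + 2 * Z)"
      using sp by (intro mult_left_mono) auto
    also have "\<dots> = (4 * p / c + 2 * p) * (s * 1) * Z" by (simp add: algebra_simps)
    also have "\<dots> \<le> (4 * p / c + 2 * p) * (s * (2 * (1 - s))) * Z"
      using True s p c Z by (intro mult_right_mono mult_left_mono) auto
    also have "\<dots> = (2 * (4 * p / c + 2 * p)) * (s * (1 - s)) * Z" by (simp only: mult_ac)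
    also have "2 * (4 * p / c + 2 * p) = 8 * p / c + 4 * p" by simp
    finally show ?thesis by (rule order_trans[OF small_s])
  next
    case False
    have "4 * p / c * (1 - s) * D \<le> 4 * p / c * (1 - s) * Z"
      using p c s Z by (intro mult_left_mono) auto
    also have "\<dots> = 4 * p / c * (1 * (1 - s)) * Z" by simp
    also have "\<dots> \<le> 4 * p / c * ((2 * s) * (1 - s)) * Z"
      using False p c s Z by (intro mult_right_mono mult_left_mono) auto
    also have "\<dots> = 8 * p / c * (s * (1 - s)) * Z" by simp
    also have "\<dots> \<le> (8 * p / c + 4 * p) * (s * (1 - s)) * Z"
      using p c s Z by (intro mult_right_mono) auto
    finally show ?thesis using large_s by linarith
  qed
  have conv: "(mA / R ^ DIM('a)) powr - (s * p / N) \<le> max 1 (2 / c) powr p * (t powr - (s * p) * R powr (s * p))"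
  proof -
    have e1: "mA / R ^ DIM('a) = (t / R) powr N * (c / 2)"
    proof -
      have "(t / R) powr N = t powr N / R powr N" using R t0 by (simp add: powr_divide)
      also have "\<dots> = 2 * mA / c / R ^ DIM('a)" using R by (simp only: tN) (simp add: N_def powr_realpow)
      finally show ?thesis using c by simp
    qed
    have "(mA / R ^ DIM('a)) powr - (s * p / N) = (t / R) powr - (s * p) * (c / 2) powr - (s * p / N)"
      unfolding e1 using R c t0 N by (subst powr_mult) (auto simp: powr_powr)
    also have "\<dots> = (2 / c) powr (s * p / N) * (t powr - (s * p) * R powr (s * p))"
    proof -
      have "(t / R) powr - (s * p) = t powr - (s * p) * R powr (s * p)"
        using t0 R by (rule powr_div_minus)
      moreover have "(c / 2) powr - (s * p / N) = (2 / c) powr (s * p / N)"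
        using c by (simp add: powr_minus powr_divide field_simps)
      ultimately show ?thesis by simp
    qed
    also have "\<dots> \<le> max 1 (2 / c) powr p * (t powr - (s * p) * R powr (s * p))"
    proof (rule mult_right_mono)
      have "s * p / N \<le> s * p / 1" using N sp by (intro divide_left_mono) auto
      then have "max 1 (2 / c) powr (s * p / N) \<le> max 1 (2 / c) powr p"
        using sp by (intro powr_mono) auto
      moreover have "(2 / c) powr (s * p / N) \<le> max 1 (2 / c) powr (s * p / N)"
        using c sp N by (intro powr_mono2) auto
      ultimately show "(2 / c) powr (s * p / N) \<le> max 1 (2 / c) powr p" by linarith
    qed auto
    finally show ?thesis .
  qed
  have "X * (mA / R ^ DIM('a)) powr - (s * p / N) \<le> X * (max 1 (2 / c) powr p * (t powr - (s * p) * R powr (s * p)))"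
    by (intro mult_left_mono conv X0)
  also have "\<dots> = max 1 (2 / c) powr p * R powr (s * p) * (X * t powr - (s * p))" by (simp add: mult_ac)
  also have "\<dots> \<le> max 1 (2 / c) powr p * R powr (s * p) * ((8 * p / c + 4 * p) * (s * (1 - s)) * Z)"
    by (intro mult_left_mono key) auto
  finally show ?thesis by (simp add: level_const_def c_def mA_def X_def N_def Z_def mult_ac)
qed

section \<open>Slicing a function by its levels\<close>

lemma sum_powr_le:
  fixes a :: "nat \<Rightarrow> real"
  assumes a: "\<And>k. 0 \<le> a k" and p: "1 \<le> p"
  shows "(\<Sum>k<n. a k powr p) \<le> (\<Sum>k<n. a k) powr p"
proof -
  have "a k powr p \<le> a k * (\<Sum>k<n. a k) powr (p - 1)" if "k < n" for k
  proof (cases "a k = 0")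
    case False
    have "a k \<le> (\<Sum>k<n. a k)" using that a by (intro member_le_sum) auto
    then have "a k * a k powr (p - 1) \<le> a k * (\<Sum>k<n. a k) powr (p - 1)"
      using a[of k] p by (intro mult_left_mono powr_mono2) auto
    moreover have "a k * a k powr (p - 1) = a k powr p"
      using a[of k] False by (simp add: powr_diff)
    ultimately show ?thesis by simp
  qed simp
  then have "(\<Sum>k<n. a k powr p) \<le> (\<Sum>k<n. a k * (\<Sum>k<n. a k) powr (p - 1))"
    by (intro sum_mono) auto
  also have "\<dots> = (\<Sum>k<n. a k) * (\<Sum>k<n. a k) powr (p - 1)" by (simp add: sum_distrib_right)
  also have "\<dots> = (\<Sum>k<n. a k) powr p"
    using sum_nonneg[of "{..<n}" a] a by (cases "(\<Sum>k<n. a k) = 0") (auto simp: powr_diff)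
  finally show ?thesis .
qed

definition slice :: "real \<Rightarrow> real \<Rightarrow> real \<Rightarrow> real" where
  "slice \<alpha> \<beta> z = min z \<beta> - min z \<alpha>"

text \<open>All slices move in the same direction between two values, so their differences add up without
  cancellation; then the power function is superadditive.\<close>

lemma sum_slice_powr_le:
  fixes l :: "nat \<Rightarrow> real"
  assumes l: "\<And>k. l k \<le> l (Suc k)" and p: "1 \<le> p"
  shows "(\<Sum>k<n. \<bar>slice (l k) (l (Suc k)) z - slice (l k) (l (Suc k)) z'\<bar> powr p) \<le> \<bar>z - z'\<bar> powr p"
proof -
  have *: "(\<Sum>k<n. \<bar>slice (l k) (l (Suc k)) z - slice (l k) (l (Suc k)) z'\<bar> powr p) \<le> (z - z') powr p"
    if "z' \<le> z" for z z'
  proof -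
    define d where "d k = slice (l k) (l (Suc k)) z - slice (l k) (l (Suc k)) z'" for k
    define f where "f k = min z (l k) - min z' (l k)" for k
    have d0: "0 \<le> d k" for k using that l[of k] by (auto simp: d_def slice_def min_def)
    have "(\<Sum>k<n. \<bar>d k\<bar> powr p) = (\<Sum>k<n. d k powr p)" using d0 by simp
    also have "\<dots> \<le> (\<Sum>k<n. d k) powr p" by (rule sum_powr_le[OF d0 p])
    also have "(\<Sum>k<n. d k) = (\<Sum>k<n. f (Suc k) - f k)"
      by (intro sum.cong) (auto simp: d_def f_def slice_def)
    also have "\<dots> = f n - f 0" by (rule sum_lessThan_telescope)
    also have "(f n - f 0) powr p \<le> (z - z') powr p"
    proof (rule powr_mono2)
      have "0 \<le> (\<Sum>k<n. f (Suc k) - f k)"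
        using d0 by (intro sum_nonneg) (auto simp: d_def f_def slice_def algebra_simps)
      then show "0 \<le> f n - f 0" by (simp add: sum_lessThan_telescope)
      show "f n - f 0 \<le> z - z'" using that by (auto simp: f_def min_def)
    qed (use p in auto)
    finally show ?thesis unfolding d_def .
  qed
  show ?thesis
  proof (cases "z' \<le> z")
    case True
    then show ?thesis using *[OF True] by simp
  next
    case False
    then show ?thesis using *[of z z'] by (simp add: abs_minus_commute)
  qed
qed

lemma sum_gagliardo_slice_le:
  fixes w :: "'a::euclidean_space \<Rightarrow> real"
  assumes l: "\<And>k. l k \<le> l (Suc k)" and p: "1 \<le> p"
    and [measurable]: "\<Omega> \<in> sets borel" "w \<in> borel_measurable borel"
  shows "(\<Sum>k<n. energy_on p s \<Omega> (\<lambda>x. slice (l k) (l (Suc k)) \<bar>w x\<bar>)) \<le> energy_on p s \<Omega> w"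
proof -
  let ?a = "real DIM('a) + s * p"
  have [measurable]: "(\<lambda>x. slice (l k) (l (Suc k)) \<bar>w x\<bar>) \<in> borel_measurable borel" for k
    unfolding slice_def by measurable
  have "(\<Sum>k<n. energy_on p s \<Omega> (\<lambda>x. slice (l k) (l (Suc k)) \<bar>w x\<bar>))
    = (\<integral>\<^sup>+z. (\<Sum>k<n. ennreal (\<bar>slice (l k) (l (Suc k)) \<bar>w (fst z)\<bar> - slice (l k) (l (Suc k)) \<bar>w (snd z)\<bar>\<bar> powr p
        / norm (fst z - snd z) powr ?a) * indicator (\<Omega> \<times> \<Omega>) z) \<partial>(lborel \<Otimes>\<^sub>M lborel))"
    unfolding gagliardo_def by (rule nn_integral_sum[symmetric]) simp
  also have "\<dots> \<le> energy_on p s \<Omega> w"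
    unfolding gagliardo_def
  proof (intro nn_integral_mono)
    fix z :: "'a \<times> 'a"
    have "(\<Sum>k<n. \<bar>slice (l k) (l (Suc k)) \<bar>w (fst z)\<bar> - slice (l k) (l (Suc k)) \<bar>w (snd z)\<bar>\<bar> powr p)
      \<le> \<bar>\<bar>w (fst z)\<bar> - \<bar>w (snd z)\<bar>\<bar> powr p"
      by (rule sum_slice_powr_le[where l = l, OF l p])
    also have "\<dots> \<le> \<bar>w (fst z) - w (snd z)\<bar> powr p" using p by (intro powr_mono2) auto
    finally have "(\<Sum>k<n. ennreal (\<bar>slice (l k) (l (Suc k)) \<bar>w (fst z)\<bar> - slice (l k) (l (Suc k)) \<bar>w (snd z)\<bar>\<bar> powr p
        / norm (fst z - snd z) powr ?a)) \<le> ennreal (\<bar>w (fst z) - w (snd z)\<bar> powr p / norm (fst z - snd z) powr ?a)"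
      by (subst sum_ennreal) (auto simp: sum_divide_distrib[symmetric] intro!: ennreal_leI divide_right_mono)
    then show "(\<Sum>k<n. ennreal (\<bar>slice (l k) (l (Suc k)) \<bar>w (fst z)\<bar> - slice (l k) (l (Suc k)) \<bar>w (snd z)\<bar>\<bar> powr p
        / norm (fst z - snd z) powr ?a) * indicator (\<Omega> \<times> \<Omega>) z)
      \<le> ennreal (\<bar>w (fst z) - w (snd z)\<bar> powr p / norm (fst z - snd z) powr ?a) * indicator (\<Omega> \<times> \<Omega>) z"
      unfolding sum_distrib_right[symmetric] by (rule mult_right_mono) simp
  qed
  finally show ?thesis .
qed

text \<open>This is the summation lemma behind the elementary proofs of the fractional Sobolev inequality. A term
  that drops by a small factor, $b_{k+1} \le \mu b_k$, is absorbed by the preceding term of the same sum. A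
  term that does not drop satisfies $b_{k+1}^{p/q} \le \mu^{-(1-p/q)} b_{k+1} b_k^{-(1-p/q)}$ and is paid for by
  the hypothesis. The resulting constant depends on \<open>q\<close> only through an upper bound.\<close>

lemma level_sequence_sum_le:
  fixes b :: "nat \<Rightarrow> real"
  assumes b: "\<And>k. 0 \<le> b k" "\<And>k. b k \<le> 1" "\<And>k. b (Suc k) \<le> b k"
    and pq: "1 \<le> p" "p \<le> q" and Y0: "0 \<le> Y0"
    and Y: "(\<Sum>k<n. 2 powr (p * k) * b (Suc k) * b k powr - (1 - p / q)) \<le> Y0"
  shows "(\<Sum>k<n. 2 powr (p * k) * b k powr (p / q)) \<le> 2 + 2 powr ((p + 1) * (q / p)) * Y0"
proof -
  define \<tau> where "\<tau> = (2::real) powr - (p + 1)"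
  define M where "M = (2::real) powr ((p + 1) * (q / p - 1))"
  define X where "X m = (\<Sum>k<m. 2 powr (p * k) * b k powr (p / q))" for m :: nat
  have pq0: "0 < p" "0 < q" using pq by auto
  have step: "b (Suc k) powr (p / q) \<le> \<tau> * b k powr (p / q) + M * (b (Suc k) * b k powr - (1 - p / q))" for k
  proof -
    \<comment> \<open>A drop by \<open>\<mu>\<close> makes the power $p/q$ drop by \<open>\<tau>\<close>, which beats the weight $2^p$ by a factor 2.\<close>
    define \<mu> where "\<mu> = \<tau> powr (q / p)"
    have \<mu>: "0 < \<mu>" by (simp add: \<mu>_def \<tau>_def)
    have \<mu>1: "\<mu> powr (p / q) = \<tau>" using pq0 by (simp add: \<mu>_def powr_powr \<tau>_def)
    have \<mu>2: "\<mu> powr - (1 - p / q) = M"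
    proof -
      have e: "(q / p) * (1 - p / q) = q / p - 1" using pq0 by (simp add: right_diff_distrib)
      have "\<mu> powr - (1 - p / q) = 2 powr (- (p + 1) * (q / p) * - (1 - p / q))"
        by (simp only: \<mu>_def \<tau>_def powr_powr)
      also have "- (p + 1) * (q / p) * - (1 - p / q) = (p + 1) * ((q / p) * (1 - p / q))"
        by (simp only: mult_minus_left mult_minus_right minus_minus mult.assoc)
      finally have "\<mu> powr - (1 - p / q) = 2 powr ((p + 1) * ((q / p) * (1 - p / q)))" .
      then show ?thesis unfolding e M_def .
    qed
    show ?thesis
    proof (cases "b (Suc k) \<le> \<mu> * b k")
      case True
      then have "b (Suc k) powr (p / q) \<le> (\<mu> * b k) powr (p / q)" using b pq0 by (intro powr_mono2) auto
      also have "\<dots> = \<tau> * b k powr (p / q)" using \<mu> b by (simp add: powr_mult \<mu>1)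
      finally show ?thesis using b by (simp add: M_def add_increasing2)
    next
      case False
      then have pos: "0 < b (Suc k)" using \<mu> b(1)[of k] by (smt (verit) mult_nonneg_nonneg)
      then have bk: "0 < b k" using b(3)[of k] by linarith
      have "b (Suc k) powr (p / q) = b (Suc k) * b (Suc k) powr - (1 - p / q)"
        using pos by (simp add: powr_diff)
      also have "\<dots> \<le> b (Suc k) * (\<mu> * b k) powr - (1 - p / q)"
        using False pos \<mu> bk pq by (intro mult_left_mono powr_mono2') auto
      also have "(\<mu> * b k) powr - (1 - p / q) = M * b k powr - (1 - p / q)"
        using \<mu> bk \<mu>2 powr_mult[of \<mu> "b k" "- (1 - p / q)"] by simp
      finally show ?thesis using b by (simp add: \<tau>_def add_increasing mult_ac)
    qed
  qed
  have "X n \<le> X (Suc n)" using b by (simp add: X_def)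
  also have "X (Suc n) = b 0 powr (p / q) + (\<Sum>k<n. 2 powr (p * Suc k) * b (Suc k) powr (p / q))"
    unfolding X_def by (subst sum.lessThan_Suc_shift) simp
  also have "\<dots> \<le> 1 + (\<Sum>k<n. 2 powr (p * Suc k) * (\<tau> * b k powr (p / q) + M * (b (Suc k) * b k powr - (1 - p / q))))"
    using b pq0 by (intro add_mono sum_mono mult_left_mono step powr_le1) auto
  also have "(\<Sum>k<n. 2 powr (p * Suc k) * (\<tau> * b k powr (p / q) + M * (b (Suc k) * b k powr - (1 - p / q))))
     = (\<Sum>k<n. 1 / 2 * (2 powr (p * k) * b k powr (p / q)) + 2 powr p * M * (2 powr (p * k) * b (Suc k) * b k powr - (1 - p / q)))"
  proof (intro sum.cong refl)
    fix k
    have e: "2 powr (p * real (Suc k)) = 2 powr p * 2 powr (p * k)"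
      by (simp add: powr_add[symmetric] distrib_left)
    have t2: "2 powr p * \<tau> = 1 / 2"
      by (simp add: \<tau>_def powr_add[symmetric] powr_minus_divide)
    have "2 powr (p * real (Suc k)) * (\<tau> * b k powr (p / q) + M * (b (Suc k) * b k powr - (1 - p / q)))
      = (2 powr p * \<tau>) * (2 powr (p * k) * b k powr (p / q)) + 2 powr p * M * (2 powr (p * k) * b (Suc k) * b k powr - (1 - p / q))"
      unfolding e by (simp only: distrib_left mult_ac)
    then show "2 powr (p * real (Suc k)) * (\<tau> * b k powr (p / q) + M * (b (Suc k) * b k powr - (1 - p / q)))
      = 1 / 2 * (2 powr (p * k) * b k powr (p / q)) + 2 powr p * M * (2 powr (p * k) * b (Suc k) * b k powr - (1 - p / q))"
      unfolding t2 .
  qed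
  also have "\<dots> = 1 / 2 * X n + 2 powr p * M * (\<Sum>k<n. 2 powr (p * k) * b (Suc k) * b k powr - (1 - p / q))"
    by (simp only: sum.distrib sum_distrib_left X_def)
  also have "\<dots> \<le> 1 / 2 * X n + 2 powr p * M * Y0"
    by (intro add_left_mono mult_left_mono Y) (auto simp: M_def)
  finally have "X n \<le> 2 + (2 * 2 powr p * M) * Y0" by simp
  also have "2 * 2 powr p * M = 2 powr ((p + 1) * (q / p))"
  proof -
    have "2 * 2 powr p * M = 2 powr 1 * 2 powr p * M" by simp
    also have "\<dots> = 2 powr (1 + p + (p + 1) * (q / p - 1))" unfolding M_def powr_add ..
    also have "1 + p + (p + 1) * (q / p - 1) = (p + 1) * (q / p)" by (simp add: algebra_simps)
    finally show ?thesis .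
  qed
  finally show ?thesis unfolding X_def .
qed

lemma dyadic_layers_powr_le:
  fixes z lam q :: real
  assumes "0 \<le> z" "0 < lam" "0 \<le> q" "z \<le> lam * 2 ^ n"
  shows "z powr q \<le> lam powr q + (\<Sum>k<n. if lam * 2 ^ k < z then (lam * 2 ^ Suc k) powr q else 0)"
  using assms(4)
proof (induction n)
  case 0
  then show ?case using assms by (simp add: powr_mono2)
next
  case (Suc n)
  show ?case
  proof (cases "z \<le> lam * 2 ^ n")
    case True
    then show ?thesis using Suc.IH[OF True] by simp
  next
    case False
    have "z powr q \<le> (lam * 2 ^ Suc n) powr q" using assms Suc.prems by (intro powr_mono2) auto
    moreover have "0 \<le> (\<Sum>k<n. if lam * 2 ^ k < z then (lam * 2 ^ Suc k) powr q else 0)"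
      by (intro sum_nonneg) auto
    ultimately show ?thesis using False by (simp add: add_increasing)
  qed
qed

section \<open>The Sobolev inequality for finite exponents\<close>

definition superlevel_volume :: "('a::euclidean_space \<Rightarrow> real) \<Rightarrow> 'a \<Rightarrow> real \<Rightarrow> real \<Rightarrow> real" where
  "superlevel_volume w x0 R c = measure lborel {x \<in> ball x0 R. c < \<bar>w x\<bar>}"

text \<open>Superlevel sets of at most this proportion of $R^N$ are small enough for \<open>level_estimate\<close>; the
  minimum with 1 makes negative powers of the normalised volume monotone in the exponent.\<close>

definition small_fraction :: "nat \<Rightarrow> real" where "small_fraction n = min 1 (density_const n * 2 ^ n / 2)"

lemma small_fraction: "0 < small_fraction n" "small_fraction n \<le> 1"
  using density_const_pos[of n] by (auto simp: small_fraction_def)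

lemma superlevel_volume_set_measurable:
  fixes w :: "'a::euclidean_space \<Rightarrow> real"
  assumes w: "w \<in> borel_measurable borel"
  shows "{x \<in> ball x0 R. c < \<bar>w x\<bar>} \<in> sets borel"
proof -
  have "{x \<in> space borel. c < \<bar>w x\<bar>} \<in> sets borel"
    by (intro borel_measurable_less borel_measurable_const borel_measurable_abs w)
  then have "ball x0 R \<inter> {x \<in> space borel. c < \<bar>w x\<bar>} \<in> sets borel" by (intro sets.Int) auto
  moreover have "ball x0 R \<inter> {x \<in> space borel. c < \<bar>w x\<bar>} = {x \<in> ball x0 R. c < \<bar>w x\<bar>}" by auto
  ultimately show ?thesis by simp
qed

lemma superlevel_volume_emeasure:
  fixes w :: "'a::euclidean_space \<Rightarrow> real"
  assumes [measurable]: "w \<in> borel_measurable borel" and R: "0 < R"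
  shows "emeasure lborel {x \<in> ball x0 R. c < \<bar>w x\<bar>} = ennreal (superlevel_volume w x0 R c)"
  unfolding superlevel_volume_def
proof (rule emeasure_eq_ennreal_measure)
  have "emeasure lborel {x \<in> ball x0 R. c < \<bar>w x\<bar>} \<le> emeasure lborel (ball x0 R)"
    by (intro emeasure_mono) auto
  then show "emeasure lborel {x \<in> ball x0 R. c < \<bar>w x\<bar>} \<noteq> top" using R by (auto simp: emeasure_ball top_unique)
qed

lemma superlevel_volume_nonneg: "0 \<le> superlevel_volume w x0 R c"
  by (simp add: superlevel_volume_def)

lemma superlevel_volume_antimono:
  fixes w :: "'a::euclidean_space \<Rightarrow> real"
  assumes "w \<in> borel_measurable borel" "0 < R" "c \<le> d"
  shows "superlevel_volume w x0 R d \<le> superlevel_volume w x0 R c"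
proof -
  have "emeasure lborel {x \<in> ball x0 R. d < \<bar>w x\<bar>} \<le> emeasure lborel {x \<in> ball x0 R. c < \<bar>w x\<bar>}"
    using assms superlevel_volume_set_measurable[OF assms(1)] by (intro emeasure_mono) auto
  then show ?thesis unfolding superlevel_volume_emeasure[OF assms(1,2)] by (simp add: superlevel_volume_nonneg ennreal_le_iff)
qed

lemma superlevel_volume_chebyshev:
  fixes w :: "'a::euclidean_space \<Rightarrow> real"
  assumes [measurable]: "w \<in> borel_measurable borel" and R: "0 < R" and c: "0 < c" and p: "1 \<le> p"
    and W: "0 \<le> W" "power_integral p (ball x0 R) w \<le> ennreal W"
  shows "c powr p * superlevel_volume w x0 R c \<le> W"
proof -
  have [measurable]: "{x \<in> ball x0 R. c < \<bar>w x\<bar>} \<in> sets borel" by (rule superlevel_volume_set_measurable) fact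
  have "ennreal (c powr p * superlevel_volume w x0 R c) = (\<integral>\<^sup>+x. ennreal (c powr p) * indicator {x \<in> ball x0 R. c < \<bar>w x\<bar>} x \<partial>lborel)"
    using R by (subst nn_integral_cmult_indicator) (auto simp: superlevel_volume_emeasure ennreal_mult superlevel_volume_nonneg simp del: mem_ball)
  also have "\<dots> \<le> power_integral p (ball x0 R) w"
    using c p by (intro nn_integral_mono) (auto simp: indicator_def intro!: ennreal_leI powr_mono2)
  finally have "ennreal (c powr p * superlevel_volume w x0 R c) \<le> ennreal W" using W(2) by (rule order_trans)
  then show ?thesis using W by (simp add: ennreal_le_iff)
qed

lemma slice_level_estimate:
  fixes w :: "'a::euclidean_space \<Rightarrow> real"
  assumes w[measurable]: "w \<in> borel_measurable borel"
    and ab: "0 < \<alpha>" "\<alpha> < \<beta>" and R: "0 < R" and p: "1 \<le> p" and s: "0 < s" "s < 1"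
    and D: "0 \<le> D" "energy_on p s (ball x0 R) (\<lambda>x. slice \<alpha> \<beta> \<bar>w x\<bar>) \<le> ennreal D"
    and small: "superlevel_volume w x0 R \<alpha> \<le> small_fraction DIM('a) * R ^ DIM('a)"
  shows "(\<beta> - \<alpha>) powr p * superlevel_volume w x0 R \<beta> * (superlevel_volume w x0 R \<alpha> / R ^ DIM('a)) powr - (s * p / DIM('a))
    \<le> level_const DIM('a) p * (s * (1 - s)) * R powr (s * p) * (D + (\<beta> - \<alpha>) powr p * superlevel_volume w x0 R \<beta> * R powr - (s * p) / s)"
proof -
  have "2 * superlevel_volume w x0 R \<alpha> \<le> 2 * ((density_const DIM('a) * 2 ^ DIM('a) / 2) * R ^ DIM('a))"
    using small R by (intro mult_left_mono order_trans[OF small] mult_right_mono) (auto simp: small_fraction_def)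
  then have "2 * superlevel_volume w x0 R \<alpha> \<le> density_const DIM('a) * (2 * R) ^ DIM('a)" by (simp add: power_mult_distrib)
  then show ?thesis unfolding superlevel_volume_def
    using ab R p s D superlevel_volume_set_measurable[OF w]
    by (intro level_estimate[where v = "\<lambda>x. slice \<alpha> \<beta> \<bar>w x\<bar>"]) (auto simp: slice_def)
qed

text \<open>The smallest level \<open>lam\<close> is chosen by Chebyshev's inequality, so that $|w| > lam$ only on a small
  fraction of the ball. Below it there is nothing to do. Above it the level estimate for the slices between
  $2^k lam$ and $2^{k+1} lam$ is summed over \<open>k\<close>; the energies of the slices add up to at most \<open>H\<close>, and their
  error terms to at most a multiple of the integral of $|w|^p$. The condition on \<open>q\<close> is \<open>q \<le> sobolev_exponent\<close> if
  \<open>s * p < N\<close> and is vacuous otherwise, and \<open>C\<close> depends on neither \<open>s\<close> nor on \<open>q \<le> Q\<close>.\<close>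

lemma sobolev_by_slicing:
  fixes p Q C0 :: real
  assumes p: "1 \<le> p" and Q: "p \<le> Q" and C0: "0 < C0"
  shows "\<exists>C>0. \<forall>(x0::'a::euclidean_space) R s q H w.
    0 < R \<longrightarrow> 0 < s \<longrightarrow> s < 1 \<longrightarrow> p \<le> q \<longrightarrow> q \<le> Q \<longrightarrow> 1 - p / q \<le> s * p / real DIM('a) \<longrightarrow> 0 < H \<longrightarrow>
    w \<in> borel_measurable borel \<longrightarrow> (\<exists>K. \<forall>x. \<bar>w x\<bar> \<le> K) \<longrightarrow>
    energy_on p s (ball x0 R) w \<le> ennreal H \<longrightarrow>
    power_integral p (ball x0 R) w \<le> ennreal (C0 * (s * (1 - s)) * R powr (s * p) * H) \<longrightarrow>
    power_integral q (ball x0 R) w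
      \<le> ennreal ((C * R powr (real DIM('a) / q) * (s * (1 - s) * R powr (s * p - real DIM('a)) * H) powr (1 / p)) powr q)"
proof -
  define N where "N = real DIM('a)"
  define \<theta> where "\<theta> = small_fraction DIM('a)"
  define L where "L = level_const DIM('a) p"
  define Y0 where "Y0 = L * (1 + C0) * \<theta> / C0"
  define X0 where "X0 = 2 + 2 powr ((p + 1) * (Q / p)) * Y0"
  define Z where "Z = max 1 (unit_ball_vol N + 2 powr Q * X0 powr (Q / p))"
  define C where "C = (C0 / \<theta>) powr (1 / p) * Z"
  have \<theta>: "0 < \<theta>" "\<theta> \<le> 1" by (auto simp: \<theta>_def small_fraction)
  have L: "0 < L" unfolding L_def by (rule level_const_nonneg[OF p])
  have Y0: "0 \<le> Y0" using L C0 \<theta> by (simp add: Y0_def)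
  have X0: "1 \<le> X0" using Y0 by (simp add: X0_def add_increasing2)
  have Z: "1 \<le> Z" by (simp add: Z_def)
  have C: "0 < C" using Z \<theta> C0 by (simp add: C_def)
  show ?thesis
  proof (intro exI[of _ C] conjI C allI impI)
    fix x0 :: 'a and R s q H :: real and w :: "'a \<Rightarrow> real"
    assume R: "0 < R" and s: "0 < s" "s < 1" and q: "p \<le> q" "q \<le> Q" and sig: "1 - p / q \<le> s * p / real DIM('a)"
      and H: "0 < H" and w[measurable]: "w \<in> borel_measurable borel" and "\<exists>K. \<forall>x. \<bar>w x\<bar> \<le> K"
      and gw: "energy_on p s (ball x0 R) w \<le> ennreal H"
      and ww: "power_integral p (ball x0 R) w \<le> ennreal (C0 * (s * (1 - s)) * R powr (s * p) * H)"
    then obtain K where K: "\<And>x. \<bar>w x\<bar> \<le> K" by auto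
    define E where "E = s * (1 - s) * R powr (s * p - N) * H"
    \<comment> \<open>Chosen such that Chebyshev's inequality gives the proportion \<open>\<theta>\<close> at level \<open>lam\<close>.\<close>
    define lam where "lam = (C0 * E / \<theta>) powr (1 / p)"
    define l where "l k = lam * 2 ^ k" for k :: nat
    define a where "a k = superlevel_volume w x0 R (l k)" for k
    define b where "b k = a k / R ^ DIM('a)" for k
    define W where "W = C0 * (s * (1 - s)) * R powr (s * p) * H"
    have pq0: "0 < p" "0 < q" using p q by auto
    have sp: "0 < s * p" using s p by simp
    have RN: "R powr N = R ^ DIM('a)" using R by (simp add: N_def powr_realpow)
    have E: "0 < E" using s R H by (simp add: E_def)
    have lam: "0 < lam" using E C0 \<theta> by (simp add: lam_def)
    have lamp: "lam powr p = C0 * E / \<theta>" using E C0 \<theta> p by (simp add: lam_def powr_powr)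
    have Rsp: "R powr (s * p) = R powr (s * p - N) * R ^ DIM('a)"
      unfolding RN[symmetric] powr_add[symmetric] by simp
    have WE: "W = C0 * E * R ^ DIM('a)" by (simp add: W_def E_def Rsp)
    have W0: "0 < W" using WE C0 E R by simp
    have l: "0 < l k" "l k < l (Suc k)" "l (Suc k) - l k = lam * 2 ^ k" for k using lam by (auto simp: l_def)
    have a0: "0 \<le> a k" for k by (simp add: a_def superlevel_volume_nonneg)
    have a_dec: "a (Suc k) \<le> a k" for k
      unfolding a_def by (intro superlevel_volume_antimono w R less_imp_le[OF l(2)])
    have a_small: "a k \<le> \<theta> * R ^ DIM('a)" for k
    proof (induction k)
      case 0
      have "lam powr p * a 0 \<le> W" unfolding a_def l_def W_def
        using superlevel_volume_chebyshev[OF w R lam p _ ww] s R H C0 by simp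
      then have "C0 * E * a 0 \<le> C0 * E * (\<theta> * R ^ DIM('a))" using \<theta> by (simp add: lamp WE field_simps)
      then show ?case using C0 E by simp
    next
      case (Suc k)
      then show ?case using a_dec[of k] by linarith
    qed
    have b: "0 \<le> b k" "b k \<le> 1" "b (Suc k) \<le> b k" for k
    proof -
      show "0 \<le> b k" using a0 R by (simp add: b_def)
      have "\<theta> * R ^ DIM('a) \<le> 1 * R ^ DIM('a)" using \<theta> R by (intro mult_right_mono) auto
      then have "a k \<le> 1 * R ^ DIM('a)" using a_small[of k] by linarith
      then show "b k \<le> 1" using R by (simp add: b_def)
      show "b (Suc k) \<le> b k" using a_dec R by (simp add: b_def divide_right_mono)
    qed
    define v where "v k x = slice (l k) (l (Suc k)) \<bar>w x\<bar>" for k x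
    define D where "D k = enn2real (energy_on p s (ball x0 R) (v k))" for k
    have sumg: "(\<Sum>k<n. energy_on p s (ball x0 R) (v k)) \<le> ennreal H" for n
    proof -
      have "(\<Sum>k<n. energy_on p s (ball x0 R) (v k)) \<le> energy_on p s (ball x0 R) w"
        unfolding v_def[abs_def] using l(2) p by (intro sum_gagliardo_slice_le) (auto intro: less_imp_le)
      also note gw
      finally show ?thesis .
    qed
    have gD: "energy_on p s (ball x0 R) (v k) = ennreal (D k)" for k
    proof -
      have "energy_on p s (ball x0 R) (v k) \<le> (\<Sum>k<Suc k. energy_on p s (ball x0 R) (v k))"
        by (simp add: add_increasing)
      also note sumg
      finally have "energy_on p s (ball x0 R) (v k) \<le> ennreal H" .
      then have "energy_on p s (ball x0 R) (v k) < top"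
        by (rule le_less_trans) (rule ennreal_less_top)
      then show ?thesis unfolding D_def by (rule ennreal_enn2real[symmetric])
    qed
    have D0: "0 \<le> D k" for k by (simp add: D_def)
    have sumD: "(\<Sum>k<n. D k) \<le> H" for n
    proof -
      have "ennreal (\<Sum>k<n. D k) \<le> ennreal H" using sumg[of n] D0 by (simp add: gD)
      then show ?thesis using H by (simp add: ennreal_le_iff)
    qed
    have sumA: "(\<Sum>k<n. (lam * 2 ^ k) powr p * a (Suc k)) \<le> W" for n
    proof -
      have "ennreal (\<Sum>k<n. (lam * 2 ^ k) powr p * a (Suc k))
         = (\<Sum>k<n. ennreal ((lam * 2 ^ k) powr p) * emeasure lborel {x \<in> ball x0 R. l (Suc k) < \<bar>w x\<bar>})"
        using a0 by (subst sum_ennreal[symmetric]) (auto simp: superlevel_volume_emeasure[OF w R] ennreal_mult a_def superlevel_volume_nonneg simp del: mem_ball)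
      also have "\<dots> = (\<Sum>k<n. \<integral>\<^sup>+x. ennreal ((lam * 2 ^ k) powr p) * indicator {x \<in> ball x0 R. l (Suc k) < \<bar>w x\<bar>} x \<partial>lborel)"
        using superlevel_volume_set_measurable[OF w] by (intro sum.cong refl nn_integral_cmult_indicator[symmetric]) simp
      also have "\<dots> = (\<integral>\<^sup>+x. (\<Sum>k<n. ennreal ((lam * 2 ^ k) powr p) * indicator {x \<in> ball x0 R. l (Suc k) < \<bar>w x\<bar>} x) \<partial>lborel)"
        using superlevel_volume_set_measurable[OF w]
        by (intro nn_integral_sum[symmetric] borel_measurable_times_ennreal borel_measurable_const borel_measurable_indicator) simp
      also have "\<dots> \<le> power_integral p (ball x0 R) w"
      proof (intro nn_integral_mono)
        fix x
        show "(\<Sum>k<n. ennreal ((lam * 2 ^ k) powr p) * indicator {x \<in> ball x0 R. l (Suc k) < \<bar>w x\<bar>} x)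
           \<le> ennreal (\<bar>w x\<bar> powr p) * indicator (ball x0 R) x"
        proof (cases "x \<in> ball x0 R")
          case True
          have "(\<Sum>k<n. ennreal ((lam * 2 ^ k) powr p) * indicator {x \<in> ball x0 R. l (Suc k) < \<bar>w x\<bar>} x)
             \<le> (\<Sum>k<n. ennreal (\<bar>slice (l k) (l (Suc k)) \<bar>w x\<bar> - slice (l k) (l (Suc k)) 0\<bar> powr p))"
          proof (intro sum_mono)
            fix k
            show "ennreal ((lam * 2 ^ k) powr p) * indicator {x \<in> ball x0 R. l (Suc k) < \<bar>w x\<bar>} x
              \<le> ennreal (\<bar>slice (l k) (l (Suc k)) \<bar>w x\<bar> - slice (l k) (l (Suc k)) 0\<bar> powr p)"
              using l(1)[of k] l(2,3)[of k] lam by (auto simp: indicator_def slice_def min_def)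
          qed
          also have "\<dots> = ennreal (\<Sum>k<n. \<bar>slice (l k) (l (Suc k)) \<bar>w x\<bar> - slice (l k) (l (Suc k)) 0\<bar> powr p)"
            by (subst sum_ennreal) auto
          also have "\<dots> \<le> ennreal (\<bar>\<bar>w x\<bar> - 0\<bar> powr p)"
            using l(2) p by (intro ennreal_leI sum_slice_powr_le) (auto intro: less_imp_le)
          finally show ?thesis using True by simp
        qed auto
      qed
      also have "\<dots> \<le> ennreal W" unfolding W_def by (rule ww)
      finally show ?thesis using W0 by (simp add: ennreal_le_iff)
    qed
    \<comment> \<open>Normalised volumes are at most 1, so the exponent $-sp/N$ of the level estimate may be raised to
      $-(1 - p/q)$.\<close>
    have bY: "(\<Sum>k<n. 2 powr (p * k) * b (Suc k) * b k powr - (1 - p / q)) \<le> Y0" for n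
    proof -
      have "lam powr p * R ^ DIM('a) * (\<Sum>k<n. 2 powr (p * k) * b (Suc k) * b k powr - (1 - p / q))
        = (\<Sum>k<n. (lam * 2 ^ k) powr p * a (Suc k) * b k powr - (1 - p / q))"
        unfolding sum_distrib_left
      proof (intro sum.cong refl)
        fix k
        have "(lam * 2 ^ k) powr p = lam powr p * (2 powr real k) powr p"
          using lam by (simp add: powr_mult powr_realpow)
        then show "lam powr p * R ^ DIM('a) * (2 powr (p * k) * b (Suc k) * b k powr - (1 - p / q))
          = (lam * 2 ^ k) powr p * a (Suc k) * b k powr - (1 - p / q)"
          using R by (simp add: powr_powr b_def mult_ac)
      qed
      also have "\<dots> \<le> (\<Sum>k<n. L * (s * (1 - s)) * R powr (s * p) * (D k + (lam * 2 ^ k) powr p * a (Suc k) * R powr - (s * p) / s))"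
      proof (intro sum_mono)
        fix k
        have "b k powr - (1 - p / q) \<le> b k powr - (s * p / N)"
          using b[of k] sig by (cases "b k = 0") (auto simp: N_def intro!: powr_mono')
        then have "(lam * 2 ^ k) powr p * a (Suc k) * b k powr - (1 - p / q) \<le> (lam * 2 ^ k) powr p * a (Suc k) * b k powr - (s * p / N)"
          using a0 by (intro mult_left_mono) auto
        also have "\<dots> \<le> L * (s * (1 - s)) * R powr (s * p) * (D k + (lam * 2 ^ k) powr p * a (Suc k) * R powr - (s * p) / s)"
          using slice_level_estimate[OF w l(1) l(2) R p s D0, of x0 k k] gD[of k] a_small[of k]
          unfolding l(3) L_def N_def b_def a_def \<theta>_def v_def[abs_def] by simp
        finally show "(lam * 2 ^ k) powr p * a (Suc k) * b k powr - (1 - p / q)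
          \<le> L * (s * (1 - s)) * R powr (s * p) * (D k + (lam * 2 ^ k) powr p * a (Suc k) * R powr - (s * p) / s)" .
      qed
      also have "\<dots> = L * (s * (1 - s)) * R powr (s * p) * ((\<Sum>k<n. D k) + (\<Sum>k<n. (lam * 2 ^ k) powr p * a (Suc k)) * (R powr - (s * p) / s))"
        by (simp only: sum_distrib_left[symmetric] sum_distrib_right[symmetric] sum.distrib times_divide_eq_right[symmetric])
      also have "\<dots> \<le> L * (s * (1 - s)) * R powr (s * p) * (H + W * (R powr - (s * p) / s))"
        using L s R by (intro mult_left_mono add_mono mult_right_mono sumD sumA) auto
      also have "W * (R powr - (s * p) / s) = C0 * (1 - s) * H"
        using s R by (simp add: W_def powr_minus field_simps)
      also have "L * (s * (1 - s)) * R powr (s * p) * (H + C0 * (1 - s) * H) \<le> L * (s * (1 - s)) * R powr (s * p) * (H + C0 * 1 * H)"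
        using L s R C0 H by (intro mult_left_mono add_left_mono mult_right_mono) auto
      also have "\<dots> = lam powr p * R ^ DIM('a) * Y0"
      proof -
        have "L * (s * (1 - s)) * R powr (s * p) * (H + C0 * 1 * H) = L * (1 + C0) * (s * (1 - s) * R powr (s * p) * H)"
          by (simp add: algebra_simps)
        also have "s * (1 - s) * R powr (s * p) * H = E * R ^ DIM('a)"
          unfolding E_def Rsp by (simp only: mult_ac)
        also have "L * (1 + C0) * (E * R ^ DIM('a)) = lam powr p * R ^ DIM('a) * Y0"
          using C0 \<theta> by (simp add: lamp Y0_def)
        finally show ?thesis .
      qed
      finally show ?thesis using lam R by simp
    qed
    obtain n where n: "K \<le> lam * 2 ^ n"
    proof -
      obtain n where "K / lam < 2 ^ n" using real_arch_pow[of 2 "K / lam"] by auto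
      then show ?thesis using lam that[of n] by (simp add: field_simps)
    qed
    have sumb: "(\<Sum>k<n. 2 powr (q * k) * b k) \<le> X0 powr (Q / p)"
    proof -
      have "(\<Sum>k<n. 2 powr (q * k) * b k) = (\<Sum>k<n. (2 powr (p * k) * b k powr (p / q)) powr (q / p))"
        using pq0 b(1) by (intro sum.cong) (auto simp: powr_mult powr_powr mult.commute[of q])
      also have "\<dots> \<le> (\<Sum>k<n. 2 powr (p * k) * b k powr (p / q)) powr (q / p)"
        using pq0 q by (intro sum_powr_le) auto
      also have "\<dots> \<le> X0 powr (q / p)"
      proof (rule powr_mono2)
        have "(\<Sum>k<n. 2 powr (p * k) * b k powr (p / q)) \<le> 2 + 2 powr ((p + 1) * (q / p)) * Y0"
          by (rule level_sequence_sum_le[where b = b, OF b p q(1) Y0 bY])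
        also have "\<dots> \<le> X0" unfolding X0_def using q pq0 Y0
          by (intro add_left_mono mult_right_mono powr_mono mult_left_mono divide_right_mono) auto
        finally show "(\<Sum>k<n. 2 powr (p * k) * b k powr (p / q)) \<le> X0" .
      qed (use pq0 in \<open>auto intro!: sum_nonneg\<close>)
      also have "\<dots> \<le> X0 powr (Q / p)" using X0 q pq0 by (intro powr_mono divide_right_mono) auto
      finally show ?thesis .
    qed
    have "power_integral q (ball x0 R) w
      \<le> (\<integral>\<^sup>+x. ennreal (lam powr q) * indicator (ball x0 R) x
            + (\<Sum>k<n. ennreal ((lam * 2 ^ Suc k) powr q) * indicator {x \<in> ball x0 R. l k < \<bar>w x\<bar>} x) \<partial>lborel)"
    proof (intro nn_integral_mono)
      fix x
      show "ennreal (\<bar>w x\<bar> powr q) * indicator (ball x0 R) x \<le> ennreal (lam powr q) * indicator (ball x0 R) x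
            + (\<Sum>k<n. ennreal ((lam * 2 ^ Suc k) powr q) * indicator {x \<in> ball x0 R. l k < \<bar>w x\<bar>} x)"
      proof (cases "x \<in> ball x0 R")
        case True
        have "\<bar>w x\<bar> powr q \<le> lam powr q + (\<Sum>k<n. if lam * 2 ^ k < \<bar>w x\<bar> then (lam * 2 ^ Suc k) powr q else 0)"
          using lam pq0 order_trans[OF K n] by (intro dyadic_layers_powr_le) auto
        then have "ennreal (\<bar>w x\<bar> powr q) \<le> ennreal (lam powr q) + ennreal (\<Sum>k<n. if lam * 2 ^ k < \<bar>w x\<bar> then (lam * 2 ^ Suc k) powr q else 0)"
          by (subst ennreal_plus[symmetric]) (auto intro!: sum_nonneg ennreal_leI)
        also have "ennreal (\<Sum>k<n. if lam * 2 ^ k < \<bar>w x\<bar> then (lam * 2 ^ Suc k) powr q else 0)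
          = (\<Sum>k<n. ennreal ((lam * 2 ^ Suc k) powr q) * indicator {x \<in> ball x0 R. l k < \<bar>w x\<bar>} x)"
        proof -
          have "(\<Sum>k<n. ennreal ((lam * 2 ^ Suc k) powr q) * indicator {x \<in> ball x0 R. l k < \<bar>w x\<bar>} x)
            = (\<Sum>k<n. ennreal (if lam * 2 ^ k < \<bar>w x\<bar> then (lam * 2 ^ Suc k) powr q else 0))"
            using True by (intro sum.cong refl) (auto simp: l_def indicator_def)
          also have "\<dots> = ennreal (\<Sum>k<n. if lam * 2 ^ k < \<bar>w x\<bar> then (lam * 2 ^ Suc k) powr q else 0)"
            by (rule sum_ennreal) auto
          finally show ?thesis ..
        qed
        finally show ?thesis using True by simp
      qed auto
    qed
    also have "\<dots> = ennreal (lam powr q) * emeasure lborel (ball x0 R)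
         + (\<Sum>k<n. ennreal ((lam * 2 ^ Suc k) powr q) * emeasure lborel {x \<in> ball x0 R. l k < \<bar>w x\<bar>})"
    proof -
      have m: "{x \<in> ball x0 R. l k < \<bar>w x\<bar>} \<in> sets lborel" for k using superlevel_volume_set_measurable[OF w] by simp
      define g where "g k x = ennreal ((lam * 2 ^ Suc k) powr q) * indicator {x \<in> ball x0 R. l k < \<bar>w x\<bar>} x" for k x
      define h where "h x = ennreal (lam powr q) * indicator (ball x0 R) x" for x
      have g: "g k \<in> borel_measurable lborel" for k
        unfolding g_def by (intro borel_measurable_times_ennreal borel_measurable_const borel_measurable_indicator m)
      have h: "h \<in> borel_measurable lborel"
        unfolding h_def by (intro borel_measurable_times_ennreal borel_measurable_const borel_measurable_indicator) simp
      have "(\<integral>\<^sup>+x. h x + (\<Sum>k<n. g k x) \<partial>lborel) = integral\<^sup>N lborel h + (\<integral>\<^sup>+x. (\<Sum>k<n. g k x) \<partial>lborel)"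
        by (rule nn_integral_add[OF h]) (rule borel_measurable_sum, rule g)
      also have "(\<integral>\<^sup>+x. (\<Sum>k<n. g k x) \<partial>lborel) = (\<Sum>k<n. integral\<^sup>N lborel (g k))"
        by (rule nn_integral_sum) (rule g)
      also have "integral\<^sup>N lborel h = ennreal (lam powr q) * emeasure lborel (ball x0 R)"
        unfolding h_def by (rule nn_integral_cmult_indicator) simp
      also have "(\<Sum>k<n. integral\<^sup>N lborel (g k)) = (\<Sum>k<n. ennreal ((lam * 2 ^ Suc k) powr q) * emeasure lborel {x \<in> ball x0 R. l k < \<bar>w x\<bar>})"
        unfolding g_def by (intro sum.cong refl nn_integral_cmult_indicator m)
      finally show ?thesis unfolding g_def h_def .
    qed
    also have "\<dots> = ennreal (lam powr q * (unit_ball_vol N * R ^ DIM('a)) + (\<Sum>k<n. (lam * 2 ^ Suc k) powr q * a k))"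
      using R a0 by (subst ennreal_plus) (auto simp: emeasure_ball N_def superlevel_volume_emeasure[OF w R] a_def ennreal_mult[symmetric] superlevel_volume_nonneg simp del: mem_ball intro!: sum_nonneg)
    also have "\<dots> \<le> ennreal ((C * R powr (N / q) * E powr (1 / p)) powr q)"
    proof (rule ennreal_leI)
      have "(\<Sum>k<n. (lam * 2 ^ Suc k) powr q * a k) = lam powr q * R ^ DIM('a) * (2 powr q * (\<Sum>k<n. 2 powr (q * k) * b k))"
        unfolding sum_distrib_left
      proof (intro sum.cong refl)
        fix k
        have "(lam * 2 ^ Suc k) powr q = lam powr q * (2 powr q * (2 powr real k) powr q)"
          using lam by (simp add: powr_mult powr_realpow)
        then show "(lam * 2 ^ Suc k) powr q * a k = lam powr q * R ^ DIM('a) * (2 powr q * (2 powr (q * k) * b k))"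
          using R by (simp add: powr_powr b_def mult_ac)
      qed
      also have "\<dots> \<le> lam powr q * R ^ DIM('a) * (2 powr Q * X0 powr (Q / p))"
        using R sumb q b by (intro mult_left_mono mult_mono powr_mono) (auto intro!: sum_nonneg)
      finally have "lam powr q * (unit_ball_vol N * R ^ DIM('a)) + (\<Sum>k<n. (lam * 2 ^ Suc k) powr q * a k)
        \<le> lam powr q * R ^ DIM('a) * (unit_ball_vol N + 2 powr Q * X0 powr (Q / p))"
        by (simp add: algebra_simps)
      also have "\<dots> \<le> lam powr q * R ^ DIM('a) * Z powr q"
      proof (intro mult_left_mono)
        have "Z powr 1 \<le> Z powr q" using Z p q by (intro powr_mono) auto
        then have "Z \<le> Z powr q" using Z by simp
        then show "unit_ball_vol N + 2 powr Q * X0 powr (Q / p) \<le> Z powr q" unfolding Z_def by linarith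
      qed (use R in auto)
      also have "\<dots> = (lam * R powr (N / q) * Z) powr q"
        using lam R Z pq0 by (simp add: powr_mult powr_powr RN)
      also have "lam * R powr (N / q) * Z = C * R powr (N / q) * E powr (1 / p)"
      proof -
        have "lam = (C0 / \<theta>) powr (1 / p) * E powr (1 / p)"
          unfolding lam_def using C0 \<theta> E by (simp add: powr_mult[symmetric])
        then show ?thesis by (simp add: C_def)
      qed
      finally show "lam powr q * (unit_ball_vol N * R ^ DIM('a)) + (\<Sum>k<n. (lam * 2 ^ Suc k) powr q * a k)
        \<le> (C * R powr (N / q) * E powr (1 / p)) powr q" .
    qed
    finally show "power_integral q (ball x0 R) w
      \<le> ennreal ((C * R powr (real DIM('a) / q) * (s * (1 - s) * R powr (s * p - real DIM('a)) * H) powr (1 / p)) powr q)"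
      by (simp add: E_def N_def)
  qed
qed

section \<open>The supremum bound in the supercritical range\<close>

text \<open>De Giorgi's iteration. The levels increase from \<open>lam\<close> to \<open>2 * lam\<close> with gaps $2^{-k-1} lam$, and the
  level estimate bounds each normalised volume by $2^{kp}$ times the power \<open>s * p / N > 1\<close> of the preceding
  one. If \<open>lam\<close> is large enough this forces geometric decay, so $|w| > 2 lam$ only on a null set. The ratio
  of the decay depends only on \<open>p\<close> and the lower bound \<open>\<epsilon>\<close> for \<open>s * p / N - 1\<close>.\<close>

lemma sup_bound_by_iteration:
  fixes p \<epsilon> C0 :: real
  assumes p: "1 \<le> p" and \<epsilon>: "0 < \<epsilon>" and C0: "0 < C0"
  shows "\<exists>C>0. \<forall>(x0::'a::euclidean_space) R s H w.
    0 < R \<longrightarrow> 0 < s \<longrightarrow> s < 1 \<longrightarrow> real DIM('a) * (1 + \<epsilon>) \<le> s * p \<longrightarrow> 0 < H \<longrightarrow>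
    w \<in> borel_measurable borel \<longrightarrow>
    energy_on p s (ball x0 R) w \<le> ennreal H \<longrightarrow>
    power_integral p (ball x0 R) w \<le> ennreal (C0 * (s * (1 - s)) * R powr (s * p) * H) \<longrightarrow>
    (AE x in lborel. x \<in> ball x0 R \<longrightarrow> \<bar>w x\<bar> \<le> C * (s * (1 - s) * R powr (s * p - real DIM('a)) * H) powr (1 / p))"
proof -
  define N where "N = real DIM('a)"
  define \<theta> where "\<theta> = small_fraction DIM('a)"
  define L where "L = level_const DIM('a) p"
  \<comment> \<open>The decay ratio for which $\nu^{\epsilon} = 2^{-p}$ compensates the growth of the weights $2^{kp}$.\<close>
  define \<nu> where "\<nu> = (2::real) powr - (p / \<epsilon>)"
  \<comment> \<open>The first entry makes the initial superlevel set small, the second starts the decay.\<close>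
  define C1 where "C1 = max (C0 / \<theta>) (L * (1 + C0) * 2 powr p / \<nu>)"
  define C where "C = 2 * C1 powr (1 / p)"
  have N: "1 \<le> N" using DIM_positive[where 'a='a] unfolding N_def by linarith
  have \<theta>: "0 < \<theta>" "\<theta> \<le> 1" by (auto simp: \<theta>_def small_fraction)
  have L: "0 < L" unfolding L_def by (rule level_const_nonneg[OF p])
  have \<nu>: "0 < \<nu>" "\<nu> < 1" using p \<epsilon> by (auto simp: \<nu>_def intro!: powr_less_one)
  have C1: "0 < C1" using C0 \<theta> by (simp add: C1_def less_max_iff_disj)
  have C1a: "C0 \<le> C1 * \<theta>" 
  proof -
    have "C0 / \<theta> \<le> C1" unfolding C1_def by (rule max.cobounded1)
    then show ?thesis using \<theta> by (simp add: pos_divide_le_eq)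
  qed
  have C1b: "L * (1 + C0) * 2 powr p \<le> C1 * \<nu>"
  proof -
    have "L * (1 + C0) * 2 powr p / \<nu> \<le> C1" unfolding C1_def by (rule max.cobounded2)
    then show ?thesis using \<nu> by (simp add: pos_divide_le_eq)
  qed
  have C: "0 < C" using C1 by (simp add: C_def)
  show ?thesis
  proof (intro exI[of _ C] conjI C allI impI)
    fix x0 :: 'a and R s H :: real and w :: "'a \<Rightarrow> real"
    assume R: "0 < R" and s: "0 < s" "s < 1" and sig: "real DIM('a) * (1 + \<epsilon>) \<le> s * p"
      and H: "0 < H" and w: "w \<in> borel_measurable borel"
      and gw: "energy_on p s (ball x0 R) w \<le> ennreal H"
      and ww: "power_integral p (ball x0 R) w \<le> ennreal (C0 * (s * (1 - s)) * R powr (s * p) * H)"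
    define E where "E = s * (1 - s) * R powr (s * p - N) * H"
    define lam where "lam = (C1 * E) powr (1 / p)"
    define l where "l k = lam * (2 - 1 / 2 ^ k)" for k :: nat
    define a where "a k = superlevel_volume w x0 R (l k)" for k
    define b where "b k = a k / R ^ DIM('a)" for k
    define W where "W = C0 * (s * (1 - s)) * R powr (s * p) * H"
    have RN: "R powr N = R ^ DIM('a)" using R by (simp add: N_def powr_realpow)
    have E: "0 < E" using s R H by (simp add: E_def)
    have lam: "0 < lam" using E C1 by (simp add: lam_def)
    have lamp: "lam powr p = C1 * E" using E C1 p by (simp add: lam_def powr_powr)
    have Rsp: "R powr (s * p) = R powr (s * p - N) * R ^ DIM('a)"
      unfolding RN[symmetric] powr_add[symmetric] by simp
    have ER: "s * (1 - s) * R powr (s * p) * H = E * R ^ DIM('a)"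
      unfolding E_def Rsp by (simp only: mult_ac)
    have WE: "W = C0 * E * R ^ DIM('a)"
    proof -
      have "W = C0 * (s * (1 - s) * R powr (s * p) * H)" by (simp add: W_def)
      then show ?thesis unfolding ER by simp
    qed
    have W0: "0 < W" using WE C0 E R by simp
    have l_diff: "l (Suc k) - l k = lam / 2 ^ Suc k" for k by (simp add: l_def field_simps)
    have pw: "1 / 2 ^ k \<le> (1::real)" for k :: nat by simp
    have l_pos: "lam \<le> l k" for k
      unfolding l_def using lam pw[of k] by (simp only: mult_le_cancel_left1) auto
    have l: "0 < l k" "l k < l (Suc k)" for k
      using l_pos[of k] lam l_diff[of k] by (auto simp: algebra_simps intro: less_le_trans)
    have l_le: "l k \<le> 2 * lam" for k using lam by (simp add: l_def field_simps)
    have a0: "0 \<le> a k" for k by (simp add: a_def superlevel_volume_nonneg)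
    have a_dec: "a (Suc k) \<le> a k" for k
      unfolding a_def by (intro superlevel_volume_antimono w R less_imp_le[OF l(2)])
    have a_small: "a k \<le> \<theta> * R ^ DIM('a)" for k
    proof (induction k)
      case 0
      have "lam powr p * a 0 \<le> W" unfolding a_def l_def W_def
        using superlevel_volume_chebyshev[OF w R lam p _ ww] s R H C0 by simp
      also have "\<dots> \<le> (C1 * \<theta>) * E * R ^ DIM('a)"
        unfolding WE using C1a E R by (intro mult_right_mono) auto
      finally have "C1 * E * a 0 \<le> C1 * E * (\<theta> * R ^ DIM('a))" by (simp add: lamp mult_ac)
      then show ?case using C1 E by simp
    next
      case (Suc k)
      then show ?case using a_dec[of k] by linarith
    qed
    have b0: "0 \<le> b k" for k using a0 R by (simp add: b_def)
    have b1: "b 0 \<le> 1"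
    proof -
      have "\<theta> * R ^ DIM('a) \<le> 1 * R ^ DIM('a)" using \<theta> R by (intro mult_right_mono) auto
      then have "a 0 \<le> 1 * R ^ DIM('a)" using a_small[of 0] by linarith
      then show ?thesis using R by (simp add: b_def)
    qed
    have step: "b (Suc k) \<le> \<nu> * 2 powr (p * k) * b k powr (s * p / N)" if "0 < b k" for k
    proof -
      define g where "g = lam / 2 ^ Suc k"
      have g: "0 < g" using lam by (simp add: g_def)
      have "energy_on p s (ball x0 R) (\<lambda>x. slice (l k) (l (Suc k)) \<bar>w x\<bar>) \<le> ennreal H"
      proof -
        have "(\<Sum>j<1. energy_on p s (ball x0 R) (\<lambda>x. slice (l (k + j)) (l (Suc (k + j))) \<bar>w x\<bar>)) \<le> energy_on p s (ball x0 R) w"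
          using l(2) p w sum_gagliardo_slice_le[of "\<lambda>j. l (k + j)" p "ball x0 R" w s 1] by (auto intro: less_imp_le)
        then show ?thesis using gw by (auto intro: order_trans)
      qed
      then have est: "g powr p * a (Suc k) * b k powr - (s * p / N)
        \<le> L * (s * (1 - s)) * R powr (s * p) * (H + g powr p * a (Suc k) * R powr - (s * p) / s)"
        using slice_level_estimate[OF w l(1)[of k] l(2)[of k] R p s less_imp_le[OF H], of x0] a_small[of k]
        unfolding l_diff L_def N_def b_def a_def \<theta>_def g_def by simp
      have "g powr p * a (Suc k) \<le> l (Suc k) powr p * a (Suc k)"
      proof (intro mult_right_mono powr_mono2)
        show "g \<le> l (Suc k)" using l(1)[of k] l_diff[of k] by (simp add: g_def)
      qed (use g a0 p in auto)
      also have "\<dots> \<le> W" unfolding a_def W_def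
        using superlevel_volume_chebyshev[OF w R l(1) p _ ww] s R H C0 by simp
      finally have gW: "g powr p * a (Suc k) \<le> W" .
      have "g powr p * a (Suc k) * R powr - (s * p) / s \<le> W * R powr - (s * p) / s"
        using gW s R by (intro divide_right_mono mult_right_mono) auto
      also have "\<dots> = C0 * (1 - s) * H" using s R by (simp add: W_def powr_minus field_simps)
      also have "\<dots> \<le> C0 * 1 * H" using s C0 H by (intro mult_left_mono mult_right_mono) auto
      finally have "L * (s * (1 - s)) * R powr (s * p) * (H + g powr p * a (Suc k) * R powr - (s * p) / s)
        \<le> L * (s * (1 - s)) * R powr (s * p) * (H + C0 * 1 * H)"
        using L s R by (intro mult_left_mono add_left_mono) auto
      also have "\<dots> = L * (1 + C0) * (s * (1 - s) * R powr (s * p) * H)" by (simp add: algebra_simps)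
      also have "\<dots> = L * (1 + C0) * (E * R ^ DIM('a))" unfolding ER ..
      finally have "g powr p * a (Suc k) * b k powr - (s * p / N) \<le> L * (1 + C0) * (E * R ^ DIM('a))"
        using est by linarith
      moreover have "g powr p = C1 * E / (2 powr p * 2 powr (p * k))"
      proof -
        have "g powr p = lam powr p / (2 powr real (Suc k)) powr p"
        proof -
          have "(2::real) ^ Suc k = 2 powr real (Suc k)" by (rule powr_realpow[symmetric]) simp
          then show ?thesis unfolding g_def using lam by (subst powr_divide[symmetric]) auto
        qed
        also have "(2 powr real (Suc k)) powr p = 2 powr p * 2 powr (p * k)"
          unfolding powr_powr powr_add[symmetric] by (simp add: algebra_simps)
        finally show ?thesis by (simp add: lamp)
      qed
      ultimately have "C1 * E / (2 powr p * 2 powr (p * k)) * (b (Suc k) * R ^ DIM('a)) * b k powr - (s * p / N)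
        \<le> L * (1 + C0) * (E * R ^ DIM('a))"
        using R by (simp add: b_def)
      then have "(E * R ^ DIM('a)) * (C1 * (b (Suc k) * b k powr - (s * p / N)))
        \<le> (E * R ^ DIM('a)) * (L * (1 + C0) * 2 powr p * 2 powr (p * k))"
        by (simp add: field_simps)
      then have "C1 * (b (Suc k) * b k powr - (s * p / N)) \<le> L * (1 + C0) * 2 powr p * 2 powr (p * k)"
        using E R by (subst (asm) mult_le_cancel_left_pos) auto
      also have "\<dots> \<le> C1 * \<nu> * 2 powr (p * k)" using C1b by (intro mult_right_mono) auto
      finally have "C1 * (b (Suc k) * b k powr - (s * p / N)) \<le> C1 * (\<nu> * 2 powr (p * k))" by (simp add: mult.assoc)
      then have "b (Suc k) * b k powr - (s * p / N) \<le> \<nu> * 2 powr (p * k)"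
        using C1 by (subst (asm) mult_le_cancel_left_pos) auto
      then have "b (Suc k) * b k powr - (s * p / N) * b k powr (s * p / N) \<le> \<nu> * 2 powr (p * k) * b k powr (s * p / N)"
        by (intro mult_right_mono) auto
      moreover have "b k powr - (s * p / N) * b k powr (s * p / N) = 1"
        unfolding powr_add[symmetric] using that by simp
      ultimately show ?thesis by (simp add: mult.assoc)
    qed
    have decay: "b k \<le> \<nu> ^ k" for k
    proof (induction k)
      case 0
      then show ?case using b1 by simp
    next
      case (Suc k)
      show ?case
      proof (cases "b k = 0")
        case True
        then have "b (Suc k) \<le> 0" using a_dec[of k] R by (simp add: b_def divide_nonpos_pos)
        then show ?thesis using \<nu> by (smt (verit) zero_le_power)
      next
        case False
        then have bk: "0 < b k" using b0[of k] by simp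
        have bk1: "b k \<le> 1" using Suc \<nu> power_le_one[of \<nu> k] by linarith
        have "1 + \<epsilon> \<le> s * p / N" using sig N by (simp add: N_def field_simps)
        then have "b k powr (s * p / N) \<le> b k powr (1 + \<epsilon>)" using bk bk1 by (intro powr_mono') auto
        also have "\<dots> = b k * b k powr \<epsilon>" using bk by (simp add: powr_add)
        also have "\<dots> \<le> \<nu> ^ k * (\<nu> ^ k) powr \<epsilon>"
          using bk Suc \<epsilon> \<nu> by (intro mult_mono powr_mono2) auto
        also have "(\<nu> ^ k) powr \<epsilon> = 2 powr - (p * k)"
          using \<epsilon> by (simp add: \<nu>_def powr_power powr_powr mult.commute)
        finally have "\<nu> * 2 powr (p * k) * b k powr (s * p / N) \<le> \<nu> * 2 powr (p * k) * (\<nu> ^ k * 2 powr - (p * k))"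
          using \<nu> by (intro mult_left_mono) auto
        also have "\<dots> = \<nu> ^ Suc k * (2 powr (p * k) * 2 powr - (p * k))" by simp
        also have "\<dots> = \<nu> ^ Suc k" unfolding powr_add[symmetric] by simp
        finally show ?thesis using step[OF bk] by linarith
      qed
    qed
    have "superlevel_volume w x0 R (2 * lam) / R ^ DIM('a) \<le> 0"
    proof (rule LIMSEQ_le_const)
      show "(\<lambda>k. \<nu> ^ k) \<longlonglongrightarrow> 0" using \<nu> by (intro LIMSEQ_realpow_zero) auto
      have "superlevel_volume w x0 R (2 * lam) / R ^ DIM('a) \<le> \<nu> ^ k" for k
      proof -
        have "superlevel_volume w x0 R (2 * lam) \<le> a k" unfolding a_def by (intro superlevel_volume_antimono w R l_le)
        then have "superlevel_volume w x0 R (2 * lam) / R ^ DIM('a) \<le> b k" using R by (simp add: b_def divide_right_mono)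
        then show ?thesis using decay[of k] by linarith
      qed
      then show "\<exists>n. \<forall>k\<ge>n. superlevel_volume w x0 R (2 * lam) / R ^ DIM('a) \<le> \<nu> ^ k" by blast
    qed
    then have "superlevel_volume w x0 R (2 * lam) = 0" using zero_less_power[OF R, of "DIM('a)"] superlevel_volume_nonneg[of w x0 R "2 * lam"] by (auto simp: divide_le_0_iff)
    then have null: "{x \<in> ball x0 R. 2 * lam < \<bar>w x\<bar>} \<in> null_sets lborel"
      using superlevel_volume_emeasure[OF w R, of x0 "2 * lam"] superlevel_volume_set_measurable[OF w] by (intro null_setsI) auto
    have C_eq: "C * E powr (1 / p) = 2 * lam"
      using C1 E by (simp add: C_def lam_def powr_mult)
    have "AE x in lborel. x \<in> ball x0 R \<longrightarrow> \<bar>w x\<bar> \<le> C * E powr (1 / p)"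
      using AE_not_in[OF null] by (rule AE_mp) (auto intro!: AE_I2 simp: C_eq not_less)
    then show "AE x in lborel. x \<in> ball x0 R \<longrightarrow> \<bar>w x\<bar> \<le> C * (s * (1 - s) * R powr (s * p - real DIM('a)) * H) powr (1 / p)"
      by (simp add: E_def N_def)
  qed
qed

section \<open>Smooth cutoff functions\<close>

text \<open>Smoothness is handled through explicit derivatives; this replaces the Frechet derivative in the
  definition by any known derivative.\<close>

lemma C_class_SucI:
  assumes "\<And>x. (f has_derivative f' x) (at x)" "\<And>b. b \<in> Basis \<Longrightarrow> C_class k (\<lambda>x. f' x b)"
  shows "C_class (Suc k) f"
proof -
  have "frechet_derivative f (at x) = f' x" for x
    using frechet_derivative_at[OF assms(1)] by simp
  then show ?thesis using assms by (auto simp: differentiable_def)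
qed

lemma C_class_Suc_derivative:
  assumes "C_class (Suc k) f"
  shows "(f has_derivative frechet_derivative f (at x)) (at x)"
  using assms by (simp add: frechet_derivative_works[symmetric])

lemma C_class_Suc_imp: "C_class (Suc k) f \<Longrightarrow> C_class k f"
proof (induction k arbitrary: f)
  case 0
  then show ?case
    by (auto intro!: continuous_at_imp_continuous_on differentiable_imp_continuous_within)
next
  case (Suc k)
  show ?case unfolding C_class.simps(2)[of k]
  proof (intro conjI ballI allI)
    fix b :: 'a and x
    assume "b \<in> Basis"
    then have "C_class (Suc k) (\<lambda>x. frechet_derivative f (at x) b)"
      using Suc.prems C_class.simps(2)[of "Suc k" f] by blast
    then show "C_class k (\<lambda>x. frechet_derivative f (at x) b)" by (rule Suc.IH)
  qed (use Suc.prems in simp)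
qed

lemma C_class_const: "C_class k (\<lambda>x. c)"
proof (induction k arbitrary: c)
  case (Suc k)
  show ?case by (rule C_class_SucI[where f' = "\<lambda>_ _. 0"]) (auto intro: Suc)
qed simp

lemma C_class_add: "C_class k f \<Longrightarrow> C_class k g \<Longrightarrow> C_class k (\<lambda>x. f x + g x)"
proof (induction k arbitrary: f g)
  case 0
  then show ?case by (auto intro: continuous_intros)
next
  case (Suc k)
  show ?case
    by (rule C_class_SucI[where f' = "\<lambda>x h. frechet_derivative f (at x) h + frechet_derivative g (at x) h"])
       (use Suc in \<open>auto intro!: has_derivative_add C_class_Suc_derivative\<close>)
qed

lemma C_class_mult: "C_class k f \<Longrightarrow> C_class k g \<Longrightarrow> C_class k (\<lambda>x. f x * g x)"
proof (induction k arbitrary: f g)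
  case 0
  then show ?case by (auto intro: continuous_intros)
next
  case (Suc k)
  have fg: "C_class k f" "C_class k g" by (rule C_class_Suc_imp, rule Suc.prems)+
  show ?case
  proof (rule C_class_SucI[where f' = "\<lambda>x h. f x * frechet_derivative g (at x) h + frechet_derivative f (at x) h * g x"])
    show "((\<lambda>x. f x * g x) has_derivative (\<lambda>h. f x * frechet_derivative g (at x) h + frechet_derivative f (at x) h * g x)) (at x)" for x
      by (intro has_derivative_mult C_class_Suc_derivative[OF Suc.prems(1)] C_class_Suc_derivative[OF Suc.prems(2)])
    show "C_class k (\<lambda>x. f x * frechet_derivative g (at x) b + frechet_derivative f (at x) b * g x)" if "b \<in> Basis" for b
      using Suc.prems that by (intro C_class_add Suc.IH fg) auto
  qed
qed

lemma C_class_inner: "C_class k (\<lambda>x. (x - x0) \<bullet> b)"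
proof (cases k)
  case (Suc j)
  show ?thesis unfolding Suc
    by (rule C_class_SucI[where f' = "\<lambda>x h. h \<bullet> b"]) (auto intro!: derivative_eq_intros C_class_const)
qed (auto intro!: continuous_intros)

text \<open>The functions $t^{-n} e^{-1/t}$, extended by zero. They are closed under differentiation up to linear
  combinations, which makes the composition with a smooth function smooth by induction on the order.\<close>

definition flat_exp :: "nat \<Rightarrow> real \<Rightarrow> real" where
  "flat_exp n t = (if t \<le> 0 then 0 else exp (- (1 / t)) / t ^ n)"

lemma flat_exp_tendsto_0: "(flat_exp n \<longlongrightarrow> 0) (at 0)"
proof (rule filterlim_split_at)
  have "eventually (\<lambda>t. 0 = flat_exp n t) (at_left 0)"
    by (auto simp: flat_exp_def eventually_at_left_field intro!: exI[of _ "-1"])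
  then show "(flat_exp n \<longlongrightarrow> 0) (at_left 0)" by (rule Lim_transform_eventually[OF tendsto_const])
next
  have "((\<lambda>t. inverse t ^ n / exp (inverse t)) \<longlongrightarrow> 0) (at_right (0::real))"
    by (rule filterlim_compose[OF tendsto_power_div_exp_0 filterlim_inverse_at_top_right])
  moreover have "eventually (\<lambda>t. inverse t ^ n / exp (inverse t) = flat_exp n t) (at_right 0)"
    by (auto simp: flat_exp_def eventually_at_right_field exp_minus field_simps intro!: exI[of _ 1])
  ultimately show "(flat_exp n \<longlongrightarrow> 0) (at_right 0)" by (rule Lim_transform_eventually)
qed

lemma flat_exp_has_derivative:
  "(flat_exp n has_real_derivative flat_exp (n + 2) t - real n * flat_exp (n + 1) t) (at t)"
proof -
  consider "t < 0" | "t = 0" | "0 < t" by linarith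
  then show ?thesis
  proof cases
    case 1
    have "eventually (\<lambda>t. flat_exp n t = 0) (nhds t)"
      using eventually_nhds_in_open[of "{..<0}" t] 1 by (auto elim!: eventually_mono simp: flat_exp_def)
    then have "(flat_exp n has_real_derivative 0) (at t)" by (subst DERIV_cong_ev) auto
    then show ?thesis using 1 by (simp add: flat_exp_def)
  next
    case 2
    have "((\<lambda>h. (flat_exp n (0 + h) - flat_exp n 0) / h) \<longlongrightarrow> 0) (at 0)"
      by (rule Lim_transform_eventually[OF flat_exp_tendsto_0[of "Suc n"]])
         (auto simp: eventually_at flat_exp_def mult_ac intro!: exI[of _ 1])
    then show ?thesis using 2 by (simp add: DERIV_def flat_exp_def)
  next
    case 3
    have "eventually (\<lambda>t. flat_exp n t = exp (- (1 / t)) / t ^ n) (nhds t)"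
      using eventually_nhds_in_open[of "{0<..}" t] 3 by (auto elim!: eventually_mono simp: flat_exp_def)
    moreover have "((\<lambda>t. exp (- (1 / t)) / t ^ n) has_real_derivative flat_exp (n + 2) t - real n * flat_exp (n + 1) t) (at t)"
    proof -
      have "((\<lambda>t. exp (- (1 / t)) / t ^ n) has_real_derivative
          (exp (- (1 / t)) * (1 / t ^ 2) * t ^ n - exp (- (1 / t)) * (real n * t ^ (n - 1))) / (t ^ n * t ^ n)) (at t)"
        using 3 by (auto intro!: derivative_eq_intros simp: power2_eq_square field_simps)
      also have "(exp (- (1 / t)) * (1 / t ^ 2) * t ^ n - exp (- (1 / t)) * (real n * t ^ (n - 1))) / (t ^ n * t ^ n)
          = flat_exp (n + 2) t - real n * flat_exp (n + 1) t"
        using 3 by (cases n) (auto simp: flat_exp_def power2_eq_square field_simps)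
      finally show ?thesis .
    qed
    ultimately show ?thesis by (subst DERIV_cong_ev) auto
  qed
qed

lemma C_class_flat_exp_compose:
  assumes \<tau>: "\<And>x. (\<tau> has_derivative \<tau>' x) (at x)" "\<And>k b. b \<in> Basis \<Longrightarrow> C_class k (\<lambda>x. \<tau>' x b)"
  shows "C_class k (\<lambda>x. flat_exp n (\<tau> x))"
proof (induction k arbitrary: n)
  case 0
  have "continuous_on UNIV (flat_exp n)"
    by (intro continuous_at_imp_continuous_on ballI DERIV_isCont[OF flat_exp_has_derivative])
  moreover have "continuous_on UNIV \<tau>"
    by (intro continuous_at_imp_continuous_on ballI has_derivative_continuous[OF \<tau>(1)])
  ultimately show ?case by (auto intro: continuous_on_compose2)
next
  case (Suc k)
  show ?case
  proof (rule C_class_SucI)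
    show "((\<lambda>x. flat_exp n (\<tau> x)) has_derivative
      (\<lambda>h. \<tau>' x h * (flat_exp (n + 2) (\<tau> x) + (- real n) * flat_exp (n + 1) (\<tau> x)))) (at x)" for x
      using DERIV_compose_FDERIV[OF flat_exp_has_derivative \<tau>(1), of n x] by simp
    show "C_class k (\<lambda>x. \<tau>' x b * (flat_exp (n + 2) (\<tau> x) + (- real n) * flat_exp (n + 1) (\<tau> x)))" if "b \<in> Basis" for b
      using that by (intro C_class_mult C_class_add C_class_const \<tau>(2) Suc.IH)
  qed
qed

lemma flat_exp_bounds: "0 \<le> flat_exp 0 t" "flat_exp 0 t \<le> 1"
  by (auto simp: flat_exp_def)

text \<open>The derivative $t^{-2} e^{-1/t}$ is at most 2 because $e^y \ge y^2/2$.\<close>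

lemma flat_exp_lipschitz: "\<bar>flat_exp 0 t - flat_exp 0 t'\<bar> \<le> 2 * \<bar>t - t'\<bar>"
proof -
  have "\<bar>flat_exp 2 t\<bar> \<le> 2" for t
  proof (cases "t \<le> 0")
    case False
    have "(1 / t)\<^sup>2 / 2 \<le> exp (1 / t)" using exp_lower_Taylor_quadratic[of "1 / t"] False
      by (smt (verit) divide_pos_pos)
    then have "(1 / t)\<^sup>2 \<le> 2 * exp (1 / t)" by linarith
    then have "(1 / t)\<^sup>2 / exp (1 / t) \<le> 2" unfolding pos_divide_le_eq[OF exp_gt_zero] .
    then have "exp (- (1 / t)) * (1 / t)\<^sup>2 \<le> 2" by (simp add: exp_minus field_simps)
    then show ?thesis using False by (simp add: flat_exp_def power_divide)
  qed (simp add: flat_exp_def)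
  then have "norm (flat_exp 0 t - flat_exp 0 t') \<le> 2 * norm (t - t')"
    using flat_exp_has_derivative[of 0]
    by (intro field_differentiable_bound[where S = UNIV and f' = "flat_exp 2"]) (auto simp: numeral_2_eq_2)
  then show ?thesis by simp
qed

text \<open>The function $e \cdot e^{-1/\tau}$ with $\tau = (c^2 - |x - x_0|^2)/(c^2 - r^2)$ and \<open>c\<close> half-way between
  \<open>r\<close> and \<open>R\<close>. On the inner ball it is at least 1 but not constant, which is all that the capacity
  requires and avoids normalising by a quotient.\<close>

lemma exists_cutoff:
  fixes x0 :: "'a::euclidean_space"
  assumes r: "0 < r" "r < R"
  shows "\<exists>\<eta>. (\<forall>k. C_class k \<eta>) \<and> (\<exists>c<R. \<forall>x. c \<le> dist x0 x \<longrightarrow> \<eta> x = 0) \<and>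
    (\<forall>x\<in>cball x0 r. 1 \<le> \<eta> x) \<and> (\<forall>x. 0 \<le> \<eta> x \<and> \<eta> x \<le> 3) \<and>
    (\<forall>x y. \<bar>\<eta> x - \<eta> y\<bar> \<le> 24 / (R - r) * dist x y)"
proof -
  define c where "c = (r + R) / 2"
  define d where "d = c\<^sup>2 - r\<^sup>2"
  define \<tau> where "\<tau> x = (c\<^sup>2 - (x - x0) \<bullet> (x - x0)) / d" for x
  define \<eta> where "\<eta> x = exp 1 * flat_exp 0 (\<tau> x)" for x
  have c: "r < c" "c < R" "c - r = (R - r) / 2" using r by (auto simp: c_def field_simps)
  have dd: "d = (c - r) * (c + r)" by (simp add: d_def power2_eq_square algebra_simps)
  have d: "0 < d" unfolding dd using c r by simp
  have dc: "(c - r) * c \<le> d" unfolding dd using c r by (intro mult_left_mono) auto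
  have \<tau>_norm: "\<tau> x = (c\<^sup>2 - (dist x0 x)\<^sup>2) / d" for x
    by (simp add: \<tau>_def dist_norm norm_minus_commute dot_square_norm)
  have e1: "exp (1::real) \<le> 3" by (rule exp_le)
  have smooth: "C_class k \<eta>" for k
    unfolding \<eta>_def
  proof (intro C_class_mult C_class_const C_class_flat_exp_compose)
    show "(\<tau> has_derivative (\<lambda>h. (- 2 / d) * ((x - x0) \<bullet> h))) (at x)" for x
      unfolding \<tau>_def using d
      by (auto intro!: derivative_eq_intros simp: inner_commute field_simps)
    show "C_class k (\<lambda>x. (- 2 / d) * ((x - x0) \<bullet> b))" for k and b :: 'a
      by (intro C_class_mult C_class_const C_class_inner)
  qed
  have supp: "\<eta> x = 0" if "c \<le> dist x0 x" for x
  proof -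
    have "c\<^sup>2 \<le> (dist x0 x)\<^sup>2" using that c r by (intro power_mono) auto
    then have "\<tau> x \<le> 0" unfolding \<tau>_norm using d by (simp add: divide_nonpos_pos)
    then show ?thesis by (simp add: \<eta>_def flat_exp_def)
  qed
  have ge1: "1 \<le> \<eta> x" if "x \<in> cball x0 r" for x
  proof -
    have "(dist x0 x)\<^sup>2 \<le> r\<^sup>2" using that by (intro power_mono) auto
    then have "1 \<le> \<tau> x" unfolding \<tau>_norm using d by (simp add: d_def)
    then have "exp 1 * exp (- 1) \<le> \<eta> x" unfolding \<eta>_def
      by (intro mult_left_mono) (auto simp: flat_exp_def field_simps)
    then show ?thesis by (simp add: exp_minus)
  qed
  have bnd: "0 \<le> \<eta> x \<and> \<eta> x \<le> 3" for x
  proof -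
    have "exp 1 * flat_exp 0 (\<tau> x) \<le> 3 * 1"
      using e1 flat_exp_bounds by (intro mult_mono) auto
    then show ?thesis using flat_exp_bounds by (simp add: \<eta>_def)
  qed
  have lip: "\<bar>\<eta> x - \<eta> y\<bar> \<le> 24 / (R - r) * dist x y" for x y
  proof -
    \<comment> \<open>Truncating the distance at \<open>c\<close> changes nothing, as the cutoff vanishes beyond, and makes its square
      Lipschitz.\<close>
    define m where "m x = min (dist x0 x) c" for x
    have fe: "flat_exp 0 (\<tau> x) = flat_exp 0 ((c\<^sup>2 - (m x)\<^sup>2) / d)" for x
    proof (cases "dist x0 x \<le> c")
      case True
      then show ?thesis by (simp add: \<tau>_norm m_def)
    next
      case False
      then have "c\<^sup>2 \<le> (dist x0 x)\<^sup>2" using c r by (intro power_mono) auto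
      then have "\<tau> x \<le> 0" unfolding \<tau>_norm using d by (simp add: divide_nonpos_pos)
      then show ?thesis using False by (simp add: m_def flat_exp_def)
    qed
    have mc: "0 \<le> m x" "m x \<le> c" for x using c r by (auto simp: m_def)
    have m_lip: "\<bar>m y - m x\<bar> \<le> dist x y"
      using dist_triangle[of x0 x y] dist_triangle[of x0 y x] by (auto simp: m_def min_def dist_commute)
    have "\<bar>(m y)\<^sup>2 - (m x)\<^sup>2\<bar> = \<bar>m y - m x\<bar> * (m y + m x)"
      using mc[of x] mc[of y] by (simp add: power2_eq_square square_diff_square_factored abs_mult mult.commute)
    also have "\<dots> \<le> dist x y * (2 * c)"
      using m_lip mc[of x] mc[of y] by (intro mult_mono) auto
    finally have sq: "\<bar>(m y)\<^sup>2 - (m x)\<^sup>2\<bar> \<le> dist x y * (2 * c)" .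
    have "\<bar>\<eta> x - \<eta> y\<bar> = exp 1 * \<bar>flat_exp 0 ((c\<^sup>2 - (m x)\<^sup>2) / d) - flat_exp 0 ((c\<^sup>2 - (m y)\<^sup>2) / d)\<bar>"
      unfolding \<eta>_def fe by (simp add: right_diff_distrib[symmetric] abs_mult)
    also have "\<dots> \<le> 3 * (2 * \<bar>(c\<^sup>2 - (m x)\<^sup>2) / d - (c\<^sup>2 - (m y)\<^sup>2) / d\<bar>)"
      using e1 by (intro mult_mono flat_exp_lipschitz) auto
    also have "\<bar>(c\<^sup>2 - (m x)\<^sup>2) / d - (c\<^sup>2 - (m y)\<^sup>2) / d\<bar> = \<bar>(m y)\<^sup>2 - (m x)\<^sup>2\<bar> / d"
      using d by (simp add: diff_divide_distrib[symmetric])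
    also have "3 * (2 * (\<bar>(m y)\<^sup>2 - (m x)\<^sup>2\<bar> / d)) \<le> 3 * (2 * (dist x y * (2 * c) / ((c - r) * c)))"
      using sq dc c(1) r d by (intro mult_left_mono frac_le) auto
    also have "\<dots> = 12 / (c - r) * dist x y" using c(1) r by (simp add: field_simps)
    also have "\<dots> = 24 / (R - r) * dist x y" unfolding c(3) by simp
    finally show ?thesis .
  qed
  show ?thesis using smooth supp ge1 bnd lip c by (intro exI[of _ \<eta>]) blast
qed

lemma dyadic_bracket:
  fixes z :: real
  assumes "1 \<le> z"
  shows "\<exists>j::nat. 2 ^ j \<le> z \<and> z < 2 ^ Suc j"
proof -
  define n where "n = (LEAST n. z < 2 ^ n)"
  have ex: "\<exists>n. z < 2 ^ n" using real_arch_pow[of 2 z] by auto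
  have n: "z < 2 ^ n" unfolding n_def by (rule LeastI_ex[OF ex])
  then have "n \<noteq> 0" using assms by (cases n) auto
  then obtain j where j: "n = Suc j" by (cases n) auto
  have "\<not> z < 2 ^ j" using not_less_Least[of j "\<lambda>n. z < 2 ^ n"] unfolding n_def[symmetric] by (simp add: j)
  then show ?thesis using n j by (intro exI[of _ j]) auto
qed

section \<open>Competitors for the relative capacity\<close>

lemma suminf_ennreal_geometric:
  assumes "0 \<le> c" "0 < x" "x < 1"
  shows "(\<Sum>j. ennreal (c * x ^ j)) = ennreal (c / (1 - x))"
proof (rule suminf_ennreal_eq)
  show "(\<lambda>j. c * x ^ j) sums (c / (1 - x))"
    using sums_mult[OF geometric_sums[of x], of c] assms by simp
qed (use assms in auto)

text \<open>A sum over dyadic annuli around \<open>x\<close>, of radii $2^{-j} d$ and $2^j d$. The inner ones give a geometric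
  series of ratio $2^{-(1-s)p}$, the outer ones a series of ratio $2^{-sp}$; together they are of the order
  $1/(1-s) + 1/s = 1/(s(1-s))$.\<close>

lemma cutoff_kernel_le:
  fixes x :: "'a::euclidean_space"
  assumes p: "1 \<le> p" and s: "0 < s" "s < 1" and d: "0 < d"
  shows "(\<integral>\<^sup>+y. ennreal (min 1 (norm (x - y) / d) powr p / norm (x - y) powr (real DIM('a) + s * p)) \<partial>lborel)
    \<le> ennreal (cutoff_energy DIM('a) p s d)"
proof -
  define N where "N = real DIM('a)"
  define a where "a = N + s * p"
  define \<omega> where "\<omega> = unit_ball_vol N"
  define A where "A j = ennreal ((1 / 2 ^ j) powr p * (d / 2 ^ Suc j) powr - a)" for j :: nat
  define B where "B j = ennreal ((d * 2 ^ j) powr - a)" for j :: nat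
  define f where "f j y = A j * indicator (ball x (2 * d / 2 ^ j)) y" for j y
  define g where "g j y = B j * indicator (ball x (d * 2 ^ Suc j)) y" for j y
  have \<omega>: "0 < \<omega>" by (simp add: \<omega>_def N_def)
  have sp: "0 < s * p" "s * p < p" using s p by auto
  have N: "0 < N" by (simp add: N_def)
  have a: "0 < a" using N sp by (simp add: a_def)
  have fm: "f j \<in> borel_measurable lborel" for j
    unfolding f_def by (intro borel_measurable_times_ennreal borel_measurable_const borel_measurable_indicator) simp
  have gm: "g j \<in> borel_measurable lborel" for j
    unfolding g_def by (intro borel_measurable_times_ennreal borel_measurable_const borel_measurable_indicator) simp
  have pt: "ennreal (min 1 (norm (x - y) / d) powr p / norm (x - y) powr a) \<le> (\<Sum>j. f j y) + (\<Sum>j. g j y)" for y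
  proof -
    define h where "h = norm (x - y)"
    consider "h = 0" | "0 < h" "h \<le> d" | "d \<le> h" using norm_ge_zero[of "x - y"] unfolding h_def by linarith
    then show ?thesis
    proof cases
      case 1
      then show ?thesis by (simp add: h_def)
    next
      case 2
      then obtain j :: nat where j: "2 ^ j \<le> d / h" "d / h < 2 ^ Suc j" using dyadic_bracket[of "d / h"] by auto
      have h1: "h \<le> d / 2 ^ j" "d / 2 ^ Suc j \<le> h" using j 2 d by (auto simp: field_simps)
      have hd: "h / d \<le> 1 / 2 ^ j" using h1(1) d by (simp add: field_simps)
      have k1: "min 1 (h / d) powr p \<le> (1 / 2 ^ j) powr p"
        using p d 2(1) min.coboundedI2[OF hd, of 1] by (intro powr_mono2) auto
      have k2: "h powr - a \<le> (d / 2 ^ Suc j) powr - a"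
        using a d h1(2) by (intro powr_mono2') auto
      have "min 1 (h / d) powr p / h powr a = min 1 (h / d) powr p * h powr - a"
        by (simp add: powr_minus divide_inverse)
      also have "\<dots> \<le> (1 / 2 ^ j) powr p * (d / 2 ^ Suc j) powr - a"
        using k1 k2 by (intro mult_mono) auto
      finally have "ennreal (min 1 (h / d) powr p / h powr a) \<le> A j" unfolding A_def by (rule ennreal_leI)
      moreover have "y \<in> ball x (2 * d / 2 ^ j)"
      proof -
        have "0 < d / 2 ^ j" using d by simp
        then have "h < 2 * (d / 2 ^ j)" using h1(1) by linarith
        then show ?thesis by (simp add: dist_norm h_def)
      qed
      ultimately have "ennreal (min 1 (h / d) powr p / h powr a) \<le> f j y" by (simp add: f_def del: mem_ball)
      also have "\<dots> \<le> (\<Sum>j. f j y)" using sum_le_suminf[OF summableI, of "{j}" "\<lambda>j. f j y"] by simp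
      also have "\<dots> \<le> (\<Sum>j. f j y) + (\<Sum>j. g j y)" by simp
      finally show ?thesis by (simp add: h_def)
    next
      case 3
      then obtain j :: nat where j: "2 ^ j \<le> h / d" "h / d < 2 ^ Suc j" using dyadic_bracket[of "h / d"] d by auto
      have h1: "d * 2 ^ j \<le> h" "h < d * 2 ^ Suc j" using j d by (auto simp: field_simps)
      have k1: "min 1 (h / d) powr p \<le> 1"
        using p d 3 by (intro powr_le1) (auto simp: min_def)
      have k2: "h powr - a \<le> (d * 2 ^ j) powr - a"
        using a d h1(1) by (intro powr_mono2') auto
      have "min 1 (h / d) powr p / h powr a = min 1 (h / d) powr p * h powr - a"
        by (simp add: powr_minus divide_inverse)
      also have "\<dots> \<le> 1 * (d * 2 ^ j) powr - a"
        using k1 k2 by (intro mult_mono) auto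
      finally have "ennreal (min 1 (h / d) powr p / h powr a) \<le> B j" unfolding B_def by (simp add: ennreal_leI)
      moreover have "y \<in> ball x (d * 2 ^ Suc j)"
        using h1(2) by (simp add: dist_norm h_def)
      ultimately have "ennreal (min 1 (h / d) powr p / h powr a) \<le> g j y" by (simp add: g_def del: mem_ball)
      also have "\<dots> \<le> (\<Sum>j. g j y)" using sum_le_suminf[OF summableI, of "{j}" "\<lambda>j. g j y"] by simp
      also have "\<dots> \<le> (\<Sum>j. f j y) + (\<Sum>j. g j y)" by simp
      finally show ?thesis by (simp add: h_def)
    qed
  qed
  have pow2: "(2 ^ j) powr e = (2 powr e) ^ j" for e :: real and j :: nat
  proof -
    have "(2 ^ j) powr e = (2 powr real j) powr e" by (simp add: powr_realpow)
    then show ?thesis by (simp add: powr_powr powr_power)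
  qed
  have If: "integral\<^sup>N lborel (f j) = ennreal (\<omega> * d powr - (s * p) * 2 powr (a + N) * (2 powr - ((1 - s) * p)) ^ j)" for j
  proof -
    have "integral\<^sup>N lborel (f j) = A j * emeasure lborel (ball x (2 * d / 2 ^ j))"
      unfolding f_def by (rule nn_integral_cmult_indicator) simp
    also have "\<dots> = ennreal ((1 / 2 ^ j) powr p * (d / 2 ^ Suc j) powr - a * (\<omega> * (2 * d / 2 ^ j) powr N))"
      using d \<omega> by (simp add: A_def emeasure_ball \<omega>_def N_def powr_realpow ennreal_mult)
    also have "(1 / 2 ^ j) powr p * (d / 2 ^ Suc j) powr - a * (\<omega> * (2 * d / 2 ^ j) powr N)
      = \<omega> * d powr - (s * p) * 2 powr (a + N) * (2 powr - ((1 - s) * p)) ^ j"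
    proof -
      have e1: "(1 / 2 ^ j) powr p = (2 ^ j) powr - p" by (simp add: powr_divide powr_minus_divide)
      have e2: "(d / 2 ^ Suc j) powr - a = d powr - a * (2 powr a * (2 ^ j) powr a)"
        using d by (subst powr_div_minus) (auto simp: powr_mult)
      have e3: "(2 * d / 2 ^ j) powr N = 2 powr N * d powr N * (2 ^ j) powr - N"
        using d by (simp add: powr_divide powr_mult powr_minus_divide)
      have e4: "(2 ^ j) powr - p * (2 ^ j) powr a * (2 ^ j) powr - N = (2 powr - ((1 - s) * p)) ^ j"
      proof -
        have "(2 ^ j) powr - p * (2 ^ j) powr a * (2 ^ j) powr - N = (2 ^ j) powr (- p + a + - N)"
          by (simp only: powr_add)
        also have "- p + a + - N = - ((1 - s) * p)" by (simp add: a_def algebra_simps)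
        finally show ?thesis by (simp only: pow2)
      qed
      have e5: "d powr - a * d powr N = d powr - (s * p)"
        unfolding powr_add[symmetric] by (simp add: a_def)
      have "(1 / 2 ^ j) powr p * (d / 2 ^ Suc j) powr - a * (\<omega> * (2 * d / 2 ^ j) powr N)
        = \<omega> * (d powr - a * d powr N) * (2 powr a * 2 powr N) * ((2 ^ j) powr - p * (2 ^ j) powr a * (2 ^ j) powr - N)"
        unfolding e1 e2 e3 by (simp only: mult_ac)
      then show ?thesis unfolding e4 e5 by (simp only: powr_add)
    qed
    finally show ?thesis .
  qed
  have Ig: "integral\<^sup>N lborel (g j) = ennreal (\<omega> * d powr - (s * p) * 2 powr N * (2 powr - (s * p)) ^ j)" for j
  proof -
    have "integral\<^sup>N lborel (g j) = B j * emeasure lborel (ball x (d * 2 ^ Suc j))"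
      unfolding g_def by (rule nn_integral_cmult_indicator) simp
    also have "\<dots> = ennreal ((d * 2 ^ j) powr - a * (\<omega> * (d * 2 ^ Suc j) powr N))"
    proof -
      have "(d * 2 ^ Suc j) powr N = (d * 2 ^ Suc j) ^ DIM('a)" unfolding N_def using d by (intro powr_realpow) auto
      moreover have "emeasure lborel (ball x (d * 2 ^ Suc j)) = ennreal (\<omega> * (d * 2 ^ Suc j) ^ DIM('a))"
        unfolding \<omega>_def N_def using d by (intro emeasure_ball) auto
      ultimately show ?thesis unfolding B_def
        using \<omega> d by (simp only:) (rule ennreal_mult[symmetric], auto)
    qed
    also have "(d * 2 ^ j) powr - a * (\<omega> * (d * 2 ^ Suc j) powr N)
      = \<omega> * d powr - (s * p) * 2 powr N * (2 powr - (s * p)) ^ j"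
    proof -
      have e2: "(d * 2 ^ j) powr - a = d powr - a * (2 ^ j) powr - a" using d by (simp add: powr_mult)
      have e3: "(d * 2 ^ Suc j) powr N = d powr N * (2 powr N * (2 ^ j) powr N)" using d by (simp add: powr_mult)
      have e4: "(2 ^ j) powr - a * (2 ^ j) powr N = (2 powr - (s * p)) ^ j"
      proof -
        have "(2 ^ j) powr - a * (2 ^ j) powr N = (2 ^ j) powr (- a + N)" by (simp only: powr_add)
        also have "- a + N = - (s * p)" by (simp add: a_def)
        finally show ?thesis by (simp only: pow2)
      qed
      have e5: "d powr - a * d powr N = d powr - (s * p)"
        unfolding powr_add[symmetric] by (simp add: a_def)
      have "(d * 2 ^ j) powr - a * (\<omega> * (d * 2 ^ Suc j) powr N)
        = \<omega> * (d powr - a * d powr N) * 2 powr N * ((2 ^ j) powr - a * (2 ^ j) powr N)"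
        unfolding e2 e3 by (simp only: mult_ac)
      then show ?thesis unfolding e4 e5 .
    qed
    finally show ?thesis .
  qed
  define r1 where "r1 = (2::real) powr - ((1 - s) * p)"
  define r2 where "r2 = (2::real) powr - (s * p)"
  define D where "D = \<omega> * d powr - (s * p)"
  have D: "0 < D" using \<omega> d by (simp add: D_def)
  have r1: "0 < r1" "r1 < 1" using s p by (auto simp: r1_def intro!: powr_less_one)
  have r2: "0 < r2" "r2 < 1" using sp by (auto simp: r2_def intro!: powr_less_one)
  have i1: "1 / (1 - r1) \<le> 2 / (1 - s)"
  proof -
    have "(1 - s) / 2 \<le> 1 - 2 powr - (1 - s)" using s by (intro one_minus_two_powr_ge) auto
    also have "\<dots> \<le> 1 - r1"
    proof -
      have "(1 - s) * 1 \<le> (1 - s) * p" using s p by (intro mult_left_mono) auto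
      then show ?thesis unfolding r1_def by (intro diff_left_mono powr_mono) auto
    qed
    finally show ?thesis using r1 s by (simp add: field_simps)
  qed
  have i2: "1 / (1 - r2) \<le> 2 / s"
  proof -
    have "s / 2 \<le> 1 - 2 powr - s" using s by (intro one_minus_two_powr_ge) auto
    also have "\<dots> \<le> 1 - r2" unfolding r2_def using s p by (intro diff_left_mono powr_mono) (auto simp: mult_le_cancel_left1)
    finally show ?thesis using r2 s by (simp add: field_simps)
  qed
  have "(\<integral>\<^sup>+y. ennreal (min 1 (norm (x - y) / d) powr p / norm (x - y) powr a) \<partial>lborel)
    \<le> (\<integral>\<^sup>+y. (\<Sum>j. f j y) + (\<Sum>j. g j y) \<partial>lborel)"
    by (intro nn_integral_mono pt)
  also have "\<dots> = (\<integral>\<^sup>+y. (\<Sum>j. f j y) \<partial>lborel) + (\<integral>\<^sup>+y. (\<Sum>j. g j y) \<partial>lborel)"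
    using fm gm by (intro nn_integral_add borel_measurable_suminf) auto
  also have "(\<integral>\<^sup>+y. (\<Sum>j. f j y) \<partial>lborel) = (\<Sum>j. ennreal (D * 2 powr (a + N) * r1 ^ j))"
    using fm by (subst nn_integral_suminf) (auto simp: If D_def r1_def)
  also have "(\<integral>\<^sup>+y. (\<Sum>j. g j y) \<partial>lborel) = (\<Sum>j. ennreal (D * 2 powr N * r2 ^ j))"
    using gm by (subst nn_integral_suminf) (auto simp: Ig D_def r2_def)
  also have "(\<Sum>j. ennreal (D * 2 powr (a + N) * r1 ^ j)) + (\<Sum>j. ennreal (D * 2 powr N * r2 ^ j))
    = ennreal (D * 2 powr (a + N) / (1 - r1) + D * 2 powr N / (1 - r2))"
  proof -
    have "(\<Sum>j. ennreal (D * 2 powr (a + N) * r1 ^ j)) = ennreal (D * 2 powr (a + N) / (1 - r1))"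
      "(\<Sum>j. ennreal (D * 2 powr N * r2 ^ j)) = ennreal (D * 2 powr N / (1 - r2))"
      using D r1 r2 by (intro suminf_ennreal_geometric, auto)+
    then show ?thesis using D r1 r2 by (simp only:) (rule ennreal_plus[symmetric], auto)
  qed
  also have "\<dots> \<le> ennreal (\<omega> * 2 powr (2 * N + p + 1) * d powr - (s * p) / (s * (1 - s)))"
  proof (rule ennreal_leI)
    have "D * 2 powr (a + N) / (1 - r1) + D * 2 powr N / (1 - r2)
       = D * 2 powr (a + N) * (1 / (1 - r1)) + D * 2 powr N * (1 / (1 - r2))" by simp
    also have "\<dots> \<le> D * 2 powr (2 * N + p) * (2 / (1 - s)) + D * 2 powr (2 * N + p) * (2 / s)"
    proof -
      have q1: "2 powr (a + N) \<le> (2::real) powr (2 * N + p)" unfolding a_def using sp by (intro powr_mono) linarith+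
      have q2: "2 powr N \<le> (2::real) powr (2 * N + p)" using N p by (intro powr_mono) auto
      show ?thesis
        using D s r1 r2 by (intro add_mono mult_mono[OF mult_left_mono[OF q1] i1] mult_mono[OF mult_left_mono[OF q2] i2]) auto
    qed
    also have "\<dots> = D * (2 powr (2 * N + p) * 2) * (1 / (1 - s) + 1 / s)" by (simp add: algebra_simps)
    also have "1 / (1 - s) + 1 / s = 1 / (s * (1 - s))" using s by (simp add: field_simps)
    also have "2 powr (2 * N + p) * 2 = 2 powr (2 * N + p + 1)" by (simp add: powr_add)
    finally show "D * 2 powr (a + N) / (1 - r1) + D * 2 powr N / (1 - r2)
      \<le> \<omega> * 2 powr (2 * N + p + 1) * d powr - (s * p) / (s * (1 - s))"
      by (simp add: D_def mult_ac)
  qed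
  finally show ?thesis unfolding a_def N_def \<omega>_def .
qed

lemma C_class_measurable: "C_class 0 u \<Longrightarrow> u \<in> borel_measurable borel"
  by (simp add: borel_measurable_continuous_onI)

text \<open>The competitor is $\varphi = (1 - u/m)\eta$, which is at least 1 on \<open>K\<close> because \<open>u\<close> vanishes there. As
  it vanishes outside \<open>ball x0 R\<close>, its energy is at most twice the energy on \<open>ball x0 R \<times> UNIV\<close>, and
  $m(\varphi(x) - \varphi(y)) = (m - u(x))(\eta(x) - \eta(y)) - \eta(y)(u(x) - u(y))$.\<close>

lemma capacity_le:
  fixes x0 :: "'a::euclidean_space"
  assumes p: "1 \<le> p" and s: "0 < s" "s < 1" and r: "0 < r" "r < R"
    and K: "K \<subseteq> cball x0 r" and u: "\<And>k. C_class k u" "\<And>x. x \<in> K \<Longrightarrow> u x = 0"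
    and W: "0 \<le> W" "power_integral p (ball x0 R) (\<lambda>x. u x - m) \<le> ennreal W"
    and G: "0 \<le> G" "gagliardo p s (ball x0 R) UNIV u \<le> ennreal G"
  shows "ennreal (\<bar>m\<bar> powr p) * rel_capacity p s K (ball x0 R)
    \<le> ennreal (2 * 48 powr p * (G + cutoff_energy DIM('a) p s (R - r) * W))"
proof (cases "m = 0")
  case True
  then show ?thesis by simp
next
  case m: False
  define a where "a = real DIM('a) + s * p"
  define d where "d = R - r"
  define \<kappa> where "\<kappa> = cutoff_energy DIM('a) p s d"
  have d: "0 < d" using r by (simp add: d_def)
  have \<kappa>: "0 \<le> \<kappa>" using s by (simp add: \<kappa>_def)
  obtain \<eta> c where \<eta>: "\<And>k. C_class k \<eta>" "c < R" "\<And>x. c \<le> dist x0 x \<Longrightarrow> \<eta> x = 0"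
      "\<And>x. x \<in> cball x0 r \<Longrightarrow> 1 \<le> \<eta> x" "\<And>x. 0 \<le> \<eta> x \<and> \<eta> x \<le> 3"
      "\<And>x y. \<bar>\<eta> x - \<eta> y\<bar> \<le> 24 / d * dist x y"
    using exists_cutoff[OF r, where ?x0.0 = x0] unfolding d_def by blast
  define \<phi> where "\<phi> x = (1 + (- 1 / m) * u x) * \<eta> x" for x
  have um[measurable]: "u \<in> borel_measurable borel" by (rule C_class_measurable[OF u(1)])
  have \<phi>C: "C_class k \<phi>" for k unfolding \<phi>_def by (intro C_class_mult C_class_add C_class_const u \<eta>)
  have \<phi>m[measurable]: "\<phi> \<in> borel_measurable borel" by (rule C_class_measurable[OF \<phi>C])
  have \<eta>m[measurable]: "\<eta> \<in> borel_measurable borel" by (rule C_class_measurable[OF \<eta>(1)])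
  have \<phi>0: "\<phi> x = 0" if "x \<notin> ball x0 R" for x
    using that \<eta>(2) \<eta>(3)[of x] by (simp add: \<phi>_def)
  have test: "\<phi> \<in> test_functions (ball x0 R)"
  proof -
    have "support_on UNIV \<phi> \<subseteq> cball x0 c"
    proof
      fix x assume "x \<in> support_on UNIV \<phi>"
      then have "\<eta> x \<noteq> 0" by (simp add: support_on_def \<phi>_def)
      then have "\<not> c \<le> dist x0 x" using \<eta>(3) by blast
      then show "x \<in> cball x0 c" by simp
    qed
    then have cl: "closure (support_on UNIV \<phi>) \<subseteq> cball x0 c" by (rule closure_minimal) simp
    moreover have "compact (closure (support_on UNIV \<phi>))"
      using cl by (intro iffD2[OF compact_eq_bounded_closed]) (auto intro: bounded_subset)
    moreover have "cball x0 c \<subseteq> ball x0 R" using \<eta>(2) by auto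
    ultimately show ?thesis using \<phi>C by (auto simp: test_functions_def)
  qed
  have "1 \<le> \<phi> x" if "x \<in> K" for x using \<eta>(4)[of x] K u(2)[OF that] that by (auto simp: \<phi>_def)
  then have cap: "rel_capacity p s K (ball x0 R) \<le> gagliardo p s UNIV UNIV \<phi>"
    unfolding rel_capacity_def using test by (intro INF_lower) auto
  define F where "F x y = ennreal (\<bar>\<phi> x - \<phi> y\<bar> powr p / norm (x - y) powr a)" for x y
  define g where "g x y = indicator (ball x0 R) x * F x y" for x y
  have ballm[measurable]: "ball x0 R \<in> sets borel" by simp
  have Fm[measurable]: "case_prod F \<in> borel_measurable (borel \<Otimes>\<^sub>M borel)" unfolding F_def by measurable
  have gm[measurable]: "case_prod g \<in> borel_measurable (borel \<Otimes>\<^sub>M borel)" unfolding g_def by measurable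
  \<comment> \<open>Symmetry reduces the energy of \<open>\<phi>\<close> on the whole space to pairs whose first point lies in the ball.\<close>
  have Fsym: "F x y = F y x" for x y by (simp add: F_def abs_minus_commute norm_minus_commute)
  have "gagliardo p s UNIV UNIV \<phi> = (\<integral>\<^sup>+x. \<integral>\<^sup>+y. F x y \<partial>lborel \<partial>lborel)"
    by (subst gagliardo_iterated) (auto intro!: nn_integral_cong simp: F_def a_def)
  also have "\<dots> \<le> (\<integral>\<^sup>+x. \<integral>\<^sup>+y. g x y + g y x \<partial>lborel \<partial>lborel)"
  proof (intro nn_integral_mono)
    fix x y
    show "F x y \<le> g x y + g y x"
    proof (cases "x \<in> ball x0 R")
      case True
      then show ?thesis by (simp add: g_def)
    next
      case x: False
      show ?thesis
      proof (cases "y \<in> ball x0 R")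
        case True
        then show ?thesis by (simp add: g_def Fsym[of x y])
      next
        case False
        then show ?thesis using x by (simp add: F_def \<phi>0)
      qed
    qed
  qed
  also have "\<dots> = (\<integral>\<^sup>+x. \<integral>\<^sup>+y. g x y \<partial>lborel \<partial>lborel) + (\<integral>\<^sup>+x. \<integral>\<^sup>+y. g y x \<partial>lborel \<partial>lborel)"
    by (simp add: nn_integral_add)
  also have "(\<integral>\<^sup>+x. \<integral>\<^sup>+y. g y x \<partial>lborel \<partial>lborel) = (\<integral>\<^sup>+x. \<integral>\<^sup>+y. g x y \<partial>lborel \<partial>lborel)"
  proof -
    have "(\<lambda>(x, y). g x y) \<in> borel_measurable (lborel \<Otimes>\<^sub>M lborel)" by measurable
    from lborel_pair.Fubini'[OF this] show ?thesis .
  qed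
  finally have cap2: "rel_capacity p s K (ball x0 R) \<le> 2 * (\<integral>\<^sup>+x. \<integral>\<^sup>+y. g x y \<partial>lborel \<partial>lborel)"
    using cap by (simp add: mult_2)
  define k where "k x y = min 1 (norm (x - y) / d) powr p / norm (x - y) powr a" for x y :: 'a
  define U where "U x y = \<bar>u x - u y\<bar> powr p / norm (x - y) powr a" for x y
  have km[measurable]: "case_prod k \<in> borel_measurable (borel \<Otimes>\<^sub>M borel)" unfolding k_def by measurable
  have Um[measurable]: "case_prod U \<in> borel_measurable (borel \<Otimes>\<^sub>M borel)" unfolding U_def by measurable
  have pt: "ennreal (\<bar>m\<bar> powr p) * F x y \<le> ennreal (48 powr p) * (ennreal (\<bar>u x - m\<bar> powr p) * ennreal (k x y) + ennreal (U x y))" for x y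
  proof -
    have e: "m * (\<phi> x - \<phi> y) = (m - u x) * (\<eta> x - \<eta> y) - \<eta> y * (u x - u y)"
      using m by (simp add: \<phi>_def field_simps)
    have e1: "\<bar>\<eta> x - \<eta> y\<bar> \<le> 24 * min 1 (norm (x - y) / d)"
    proof -
      have "\<bar>\<eta> x - \<eta> y\<bar> \<le> 24" using \<eta>(5)[of x] \<eta>(5)[of y] by auto
      then show ?thesis using \<eta>(6)[of x y] by (simp add: dist_norm min_def)
    qed
    have "\<bar>m\<bar> * \<bar>\<phi> x - \<phi> y\<bar> = \<bar>(m - u x) * (\<eta> x - \<eta> y) - \<eta> y * (u x - u y)\<bar>"
      unfolding abs_mult[symmetric] e ..
    also have "\<dots> \<le> \<bar>m - u x\<bar> * \<bar>\<eta> x - \<eta> y\<bar> + \<bar>\<eta> y\<bar> * \<bar>u x - u y\<bar>"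
      unfolding abs_mult[symmetric] by (rule abs_triangle_ineq4)
    also have "\<dots> \<le> \<bar>m - u x\<bar> * (24 * min 1 (norm (x - y) / d)) + 24 * \<bar>u x - u y\<bar>"
      using e1 \<eta>(5)[of y] by (intro add_mono mult_left_mono mult_right_mono) auto
    finally have "(\<bar>m\<bar> * \<bar>\<phi> x - \<phi> y\<bar>) powr p \<le> (24 * (\<bar>u x - m\<bar> * min 1 (norm (x - y) / d)) + 24 * \<bar>u x - u y\<bar>) powr p"
      using p by (intro powr_mono2) (auto simp: mult_ac abs_minus_commute)
    also have "\<dots> \<le> 2 powr (p - 1) * ((24 * (\<bar>u x - m\<bar> * min 1 (norm (x - y) / d))) powr p + (24 * \<bar>u x - u y\<bar>) powr p)"
      using p d by (intro powr_add_le) auto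
    also have "\<dots> \<le> 2 powr p * ((24 * (\<bar>u x - m\<bar> * min 1 (norm (x - y) / d))) powr p + (24 * \<bar>u x - u y\<bar>) powr p)"
      by (intro mult_right_mono powr_mono) auto
    also have "\<dots> = (2 powr p * 24 powr p) * (\<bar>u x - m\<bar> powr p * min 1 (norm (x - y) / d) powr p + \<bar>u x - u y\<bar> powr p)"
      using d by (simp add: powr_mult distrib_left mult_ac)
    also have "2 powr p * 24 powr p = (48 powr p :: real)" by (simp add: powr_mult[symmetric])
    finally have "\<bar>m\<bar> powr p * \<bar>\<phi> x - \<phi> y\<bar> powr p \<le> 48 powr p * (\<bar>u x - m\<bar> powr p * min 1 (norm (x - y) / d) powr p + \<bar>u x - u y\<bar> powr p)"
      by (simp add: powr_mult)
    then have "\<bar>m\<bar> powr p * \<bar>\<phi> x - \<phi> y\<bar> powr p / norm (x - y) powr a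
      \<le> 48 powr p * (\<bar>u x - m\<bar> powr p * min 1 (norm (x - y) / d) powr p + \<bar>u x - u y\<bar> powr p) / norm (x - y) powr a"
      by (rule divide_right_mono) simp
    also have "\<dots> = 48 powr p * (\<bar>u x - m\<bar> powr p * k x y + U x y)"
      by (simp add: k_def U_def add_divide_distrib distrib_left)
    finally show ?thesis
      unfolding F_def by (simp add: ennreal_mult[symmetric] ennreal_plus[symmetric] k_def U_def del: ennreal_plus)
  qed
  have I: "ennreal (\<bar>m\<bar> powr p) * (\<integral>\<^sup>+x. \<integral>\<^sup>+y. g x y \<partial>lborel \<partial>lborel) \<le> ennreal (48 powr p) * (ennreal W * ennreal \<kappa> + ennreal G)"
  proof -
    define w where "w x = indicator (ball x0 R) x * ennreal (\<bar>u x - m\<bar> powr p)" for x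
    have wm[measurable]: "w \<in> borel_measurable borel"
    proof -
      have i: "(indicator (ball x0 R) :: 'a \<Rightarrow> ennreal) \<in> borel_measurable borel" by (rule borel_measurable_indicator) simp
      show ?thesis unfolding w_def by (intro borel_measurable_times_ennreal i) simp
    qed
    define h where "h x y = (if x \<in> ball x0 R \<and> y \<in> (UNIV :: 'a set) then ennreal (U x y) else 0)" for x y
    have hm[measurable]: "case_prod h \<in> borel_measurable (borel \<Otimes>\<^sub>M borel)" unfolding h_def by measurable
    have "ennreal (\<bar>m\<bar> powr p) * (\<integral>\<^sup>+x. \<integral>\<^sup>+y. g x y \<partial>lborel \<partial>lborel) = (\<integral>\<^sup>+x. \<integral>\<^sup>+y. ennreal (\<bar>m\<bar> powr p) * g x y \<partial>lborel \<partial>lborel)"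
      by (simp add: nn_integral_cmult)
    also have "\<dots> \<le> (\<integral>\<^sup>+x. \<integral>\<^sup>+y. ennreal (48 powr p) * (w x * ennreal (k x y) + h x y) \<partial>lborel \<partial>lborel)"
    proof (intro nn_integral_mono)
      fix x y
      show "ennreal (\<bar>m\<bar> powr p) * g x y \<le> ennreal (48 powr p) * (w x * ennreal (k x y) + h x y)"
        using pt[of x y] by (cases "x \<in> ball x0 R") (auto simp: g_def w_def h_def simp del: mem_ball)
    qed
    also have "\<dots> = ennreal (48 powr p) * ((\<integral>\<^sup>+x. w x * (\<integral>\<^sup>+y. ennreal (k x y) \<partial>lborel) \<partial>lborel) + (\<integral>\<^sup>+x. \<integral>\<^sup>+y. h x y \<partial>lborel \<partial>lborel))"
      by (simp add: nn_integral_cmult nn_integral_add)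
    also have "(\<integral>\<^sup>+x. \<integral>\<^sup>+y. h x y \<partial>lborel \<partial>lborel) = gagliardo p s (ball x0 R) UNIV u"
      by (subst gagliardo_iterated) (auto intro!: nn_integral_cong simp: h_def U_def a_def)
    also have "ennreal (48 powr p) * ((\<integral>\<^sup>+x. w x * (\<integral>\<^sup>+y. ennreal (k x y) \<partial>lborel) \<partial>lborel) + gagliardo p s (ball x0 R) UNIV u)
      \<le> ennreal (48 powr p) * (power_integral p (ball x0 R) (\<lambda>x. u x - m) * ennreal \<kappa> + gagliardo p s (ball x0 R) UNIV u)"
    proof (intro mult_left_mono add_right_mono)
      have "(\<integral>\<^sup>+x. w x * (\<integral>\<^sup>+y. ennreal (k x y) \<partial>lborel) \<partial>lborel) \<le> (\<integral>\<^sup>+x. w x * ennreal \<kappa> \<partial>lborel)"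
        unfolding k_def a_def \<kappa>_def using p s d by (intro nn_integral_mono mult_left_mono cutoff_kernel_le) auto
      also have "\<dots> = (\<integral>\<^sup>+x. w x \<partial>lborel) * ennreal \<kappa>"
        by (rule nn_integral_multc) simp
      also have "(\<integral>\<^sup>+x. w x \<partial>lborel) = power_integral p (ball x0 R) (\<lambda>x. u x - m)"
        by (simp add: w_def mult.commute)
      finally show "(\<integral>\<^sup>+x. w x * (\<integral>\<^sup>+y. ennreal (k x y) \<partial>lborel) \<partial>lborel)
        \<le> power_integral p (ball x0 R) (\<lambda>x. u x - m) * ennreal \<kappa>" .
    qed auto
    also have "\<dots> \<le> ennreal (48 powr p) * (ennreal W * ennreal \<kappa> + ennreal G)"
      by (intro mult_left_mono add_mono mult_right_mono W G) auto
    finally show ?thesis .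
  qed
  have "ennreal (\<bar>m\<bar> powr p) * rel_capacity p s K (ball x0 R)
    \<le> ennreal (\<bar>m\<bar> powr p) * (2 * (\<integral>\<^sup>+x. \<integral>\<^sup>+y. g x y \<partial>lborel \<partial>lborel))"
    by (intro mult_left_mono cap2) auto
  also have "\<dots> = 2 * (ennreal (\<bar>m\<bar> powr p) * (\<integral>\<^sup>+x. \<integral>\<^sup>+y. g x y \<partial>lborel \<partial>lborel))" by (simp only: mult_ac)
  also have "\<dots> \<le> 2 * (ennreal (48 powr p) * (ennreal W * ennreal \<kappa> + ennreal G))"
    by (intro mult_left_mono I) auto
  also have "\<dots> = ennreal (2 * (48 powr p * (W * \<kappa> + G)))"
    using W G \<kappa> by (simp add: ennreal_mult ennreal_plus)
  also have "2 * (48 powr p * (W * \<kappa> + G)) = 2 * 48 powr p * (G + \<kappa> * W)" by (simp add: algebra_simps)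
  finally show ?thesis unfolding \<kappa>_def d_def .
qed

section \<open>The Sobolev-Poincare inequality in Lebesgue norms\<close>

lemma powr_add_ge:
  fixes a b q :: real
  assumes "0 \<le> a" "0 \<le> b" "1 \<le> q"
  shows "a powr q + b powr q \<le> (a + b) powr q"
  using sum_powr_le[of "\<lambda>k. if k = 0 then a else b" q 2] assms by (simp add: numeral_2_eq_2)

lemma Lq_norm_finite_le:
  assumes "0 < q" "0 \<le> Y" "power_integral q A u \<le> ennreal (Y powr q)"
  shows "Lq_norm (ereal q) A u \<le> ennreal Y"
proof -
  define I where "I = power_integral q A u"
  have "I \<le> ennreal (Y powr q)" using assms by (simp add: I_def)
  then obtain i where i: "I = ennreal i" "0 \<le> i" "i \<le> Y powr q"
    by (cases I) (auto simp: top_unique)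
  have "i powr (1 / q) \<le> (Y powr q) powr (1 / q)" using i assms by (intro powr_mono2) auto
  also have "\<dots> = Y" using assms by (simp add: powr_powr)
  finally show ?thesis using i by (simp add: Lq_norm_def I_def[symmetric] ennreal_powr_def ennreal_leI)
qed

text \<open>A crude form of Minkowski's inequality; the volume of the ball is raised to the power $1/q$ by a
  constant that does not depend on \<open>q\<close>.\<close>

lemma Lq_norm_shift_le:
  fixes u :: "'a::euclidean_space \<Rightarrow> real"
  assumes q: "1 \<le> q" and R: "0 < R" and rR: "r \<le> R" and Y: "0 \<le> Y" and [measurable]: "u \<in> borel_measurable borel"
    and I: "power_integral q (ball x0 R) (\<lambda>x. u x - m) \<le> ennreal (Y powr q)"
  shows "Lq_norm (ereal q) (ball x0 r) u
    \<le> ennreal (2 * (Y + \<bar>m\<bar> * (max 1 (unit_ball_vol (real DIM('a))) * R powr (real DIM('a) / q))))"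
proof (rule Lq_norm_finite_le)
  define \<omega> where "\<omega> = unit_ball_vol (real DIM('a))"
  define V where "V = max 1 \<omega> * R powr (real DIM('a) / q)"
  have \<omega>: "0 < \<omega>" by (simp add: \<omega>_def)
  have V: "0 < V" using R by (simp add: V_def)
  have RN: "R powr real DIM('a) = R ^ DIM('a)" using R by (simp add: powr_realpow)
  have ballm[measurable]: "ball x0 R \<in> sets borel" by simp
  have VR: "\<omega> * R ^ DIM('a) \<le> V powr q"
  proof -
    have "max 1 \<omega> powr 1 \<le> max 1 \<omega> powr q" using q by (intro powr_mono) auto
    then have "\<omega> \<le> max 1 \<omega> powr q" by simp
    then show ?thesis using q R by (simp add: V_def powr_mult powr_powr RN mult_right_mono)
  qed
  have "power_integral q (ball x0 r) u
    \<le> (\<integral>\<^sup>+x. ennreal (2 powr q) * (ennreal (\<bar>u x - m\<bar> powr q) * indicator (ball x0 R) x + ennreal (\<bar>m\<bar> powr q) * indicator (ball x0 R) x) \<partial>lborel)"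
  proof (intro nn_integral_mono)
    fix x
    have "\<bar>u x\<bar> powr q \<le> (\<bar>u x - m\<bar> + \<bar>m\<bar>) powr q" using q by (intro powr_mono2) auto
    also have "\<dots> \<le> 2 powr (q - 1) * (\<bar>u x - m\<bar> powr q + \<bar>m\<bar> powr q)" using q by (intro powr_add_le) auto
    also have "\<dots> \<le> 2 powr q * (\<bar>u x - m\<bar> powr q + \<bar>m\<bar> powr q)" by (intro mult_right_mono powr_mono) auto
    finally have "ennreal (\<bar>u x\<bar> powr q) \<le> ennreal (2 powr q * (\<bar>u x - m\<bar> powr q + \<bar>m\<bar> powr q))" by (rule ennreal_leI)
    also have "\<dots> = ennreal (2 powr q) * (ennreal (\<bar>u x - m\<bar> powr q) + ennreal (\<bar>m\<bar> powr q))"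
      by (simp add: ennreal_mult ennreal_plus)
    finally show "ennreal (\<bar>u x\<bar> powr q) * indicator (ball x0 r) x
      \<le> ennreal (2 powr q) * (ennreal (\<bar>u x - m\<bar> powr q) * indicator (ball x0 R) x + ennreal (\<bar>m\<bar> powr q) * indicator (ball x0 R) x)"
      using rR by (cases "x \<in> ball x0 r") auto
  qed
  also have "\<dots> = ennreal (2 powr q) * (power_integral q (ball x0 R) (\<lambda>x. u x - m) + ennreal (\<bar>m\<bar> powr q) * emeasure lborel (ball x0 R))"
  proof -
    define i where "i = (indicator (ball x0 R) :: 'a \<Rightarrow> ennreal)"
    have i[measurable]: "i \<in> borel_measurable lborel" unfolding i_def by (rule borel_measurable_indicator) simp
    have ii: "integral\<^sup>N lborel i = emeasure lborel (ball x0 R)" unfolding i_def by (rule nn_integral_indicator) simp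
    have "(\<integral>\<^sup>+x. ennreal (2 powr q) * (ennreal (\<bar>u x - m\<bar> powr q) * i x + ennreal (\<bar>m\<bar> powr q) * i x) \<partial>lborel)
      = ennreal (2 powr q) * ((\<integral>\<^sup>+x. ennreal (\<bar>u x - m\<bar> powr q) * i x \<partial>lborel) + ennreal (\<bar>m\<bar> powr q) * emeasure lborel (ball x0 R))"
      by (simp add: nn_integral_cmult nn_integral_add ii)
    then show ?thesis unfolding i_def .
  qed
  also have "\<dots> \<le> ennreal (2 powr q) * (ennreal (Y powr q) + ennreal (\<bar>m\<bar> powr q) * ennreal (V powr q))"
    using R VR by (intro mult_left_mono add_mono I) (auto simp: emeasure_ball \<omega>_def[symmetric] ennreal_leI)
  also have "\<dots> = ennreal (2 powr q * (Y powr q + (\<bar>m\<bar> * V) powr q))"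
    using V by (simp add: ennreal_mult ennreal_plus powr_mult)
  also have "\<dots> \<le> ennreal (2 powr q * (Y + \<bar>m\<bar> * V) powr q)"
    using Y V q by (intro ennreal_leI mult_left_mono powr_add_ge) auto
  also have "2 powr q * (Y + \<bar>m\<bar> * V) powr q = (2 * (Y + \<bar>m\<bar> * V)) powr q"
    by (rule powr_mult[symmetric])
  finally show "power_integral q (ball x0 r) u
    \<le> ennreal ((2 * (Y + \<bar>m\<bar> * (max 1 (unit_ball_vol (real DIM('a))) * R powr (real DIM('a) / q)))) powr q)"
    by (simp add: V_def \<omega>_def)
qed (use q Y in auto)

lemma Lq_norm_infinity_le:
  fixes u :: "'a::euclidean_space \<Rightarrow> real"
  assumes [measurable]: "u \<in> borel_measurable borel" and rR: "r \<le> R"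
    and "AE x in lborel. x \<in> ball x0 R \<longrightarrow> \<bar>u x\<bar> \<le> Y"
  shows "Lq_norm \<infinity> (ball x0 r) u \<le> ennreal Y"
proof -
  have "AE x in lborel. x \<in> ball x0 r \<longrightarrow> ennreal \<bar>u x\<bar> \<le> ennreal Y"
    using assms(3) by (rule AE_mp) (use rR in \<open>auto intro!: AE_I2 ennreal_leI\<close>)
  then have "AE x in restrict_space lborel (ball x0 r). ennreal \<bar>u x\<bar> \<le> ennreal Y"
    by (subst AE_restrict_space_iff) auto
  moreover have "(\<lambda>x. ennreal \<bar>u x\<bar>) \<in> borel_measurable (restrict_space lborel (ball x0 r))"
    by (intro measurable_restrict_space1) simp
  ultimately show ?thesis unfolding Lq_norm_def by (simp add: esssup_I)
qed

lemma test_function_facts: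
  fixes u :: "'a::euclidean_space \<Rightarrow> real"
  assumes "u \<in> test_functions E"
  shows "C_class k u" "u \<in> borel_measurable borel" "\<exists>B. \<forall>x. \<bar>u x\<bar> \<le> B"
proof -
  show C: "C_class k u" for k using assms by (simp add: test_functions_def)
  show "u \<in> borel_measurable borel" by (rule C_class_measurable[OF C])
  have "compact (closure (support_on UNIV u))" using assms by (simp add: test_functions_def)
  moreover have "continuous_on (closure (support_on UNIV u)) u"
    using C[of 0] by (auto intro: continuous_on_subset)
  ultimately have "bounded (u ` closure (support_on UNIV u))"
    by (intro compact_imp_bounded compact_continuous_image)
  then obtain B where B: "\<And>x. x \<in> closure (support_on UNIV u) \<Longrightarrow> \<bar>u x\<bar> \<le> B"
    unfolding bounded_iff by auto
  have "\<bar>u x\<bar> \<le> max 0 B" for x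
  proof (cases "u x = 0")
    case False
    then have "x \<in> closure (support_on UNIV u)" by (intro subsetD[OF closure_subset]) (simp add: support_on_def)
    then show ?thesis using B[of x] by simp
  qed simp
  then show "\<exists>B. \<forall>x. \<bar>u x\<bar> \<le> B" by blast
qed

text \<open>The Sobolev-Poincare inequality on every ball, with constant \<open>C\<close> for one triple of exponents. The same
  constant \<open>m\<close> serves for the exponents \<open>p\<close> and \<open>q\<close>. The energy enters through a positive bound \<open>H\<close>,
  which avoids treating functions of zero energy separately.\<close>

definition poincare_sobolev :: "'a::euclidean_space itself \<Rightarrow> real \<Rightarrow> real \<Rightarrow> real \<Rightarrow> ereal \<Rightarrow> bool" where
  "poincare_sobolev (T :: 'a itself) C p s q \<longleftrightarrow>
    (\<forall>(x0::'a) r R u H. 0 < R \<longrightarrow> r \<le> R \<longrightarrow> 0 < H \<longrightarrow> u \<in> test_functions UNIV \<longrightarrow>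
      gagliardo p s (ball x0 R) UNIV u \<le> ennreal H \<longrightarrow>
      (\<exists>m. power_integral p (ball x0 R) (\<lambda>x. u x - m) \<le> ennreal (C * (s * (1 - s)) * R powr (s * p) * H) \<and>
        Lq_norm q (ball x0 r) u \<le> ennreal (C * R powr div_exponent DIM('a) q *
          (\<bar>m\<bar> + (s * (1 - s) * R powr (s * p - real DIM('a)) * H) powr (1 / p)))))"

lemma poincare:
  fixes u :: "'a::euclidean_space \<Rightarrow> real"
  assumes u: "u \<in> borel_measurable borel"
    and R: "0 < R" and s: "0 < s" "s < 1" and p: "1 \<le> p" and H: "0 < H"
    and GH: "gagliardo p s (ball x0 R) UNIV u \<le> ennreal H"
  shows "\<exists>m. power_integral p (ball x0 R) (\<lambda>x. u x - m)
    \<le> ennreal (32 * p * 2 powr (real DIM('a) + 3 * p) / unit_ball_vol (real DIM('a)) * (s * (1 - s)) * R powr (s * p) * H)"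
proof -
  define L where "L = 16 * p * 2 powr (real DIM('a) + 3 * p) * (s * (1 - s)) * R powr (s * p) * H"
  have L: "0 < L" using p s R H by (simp add: L_def)
  have "osc p (ball x0 R) (2 * R) u \<le> ennreal (L * R powr real DIM('a))"
    using poincare_osc[OF u R s p less_imp_le[OF H] GH] by (simp add: L_def powr_add mult_ac)
  from exists_good_constant[OF u R L this]
  have "\<exists>m. power_integral p (ball x0 R) (\<lambda>x. u x - m) \<le> ennreal (2 * L / unit_ball_vol (real DIM('a)))" .
  moreover have "2 * L / unit_ball_vol (real DIM('a))
    = 32 * p * 2 powr (real DIM('a) + 3 * p) / unit_ball_vol (real DIM('a)) * (s * (1 - s)) * R powr (s * p) * H"
    by (simp add: L_def)
  ultimately show ?thesis by (simp only:)
qed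

lemma gagliardo_shift: "gagliardo p s A B (\<lambda>x. u x - m) = gagliardo p s A B u"
  by (simp add: gagliardo_def)

definition poincare_const :: "nat \<Rightarrow> real \<Rightarrow> real" where
  "poincare_const n p = 32 * p * 2 powr (real n + 3 * p) / unit_ball_vol (real n)"

text \<open>Dominates the Poincare constant and, for the constant \<open>C1\<close> of a bound for \<open>u - m\<close>, what the
  passage from \<open>u - m\<close> back to \<open>u\<close> costs.\<close>

definition sobolev_const :: "nat \<Rightarrow> real \<Rightarrow> real \<Rightarrow> real" where
  "sobolev_const n p C1 = max (poincare_const n p) (2 * max C1 (max 1 (unit_ball_vol (real n))))"

lemma poincare_const_pos: "1 \<le> p \<Longrightarrow> 0 < poincare_const n p"
  by (simp add: poincare_const_def)

lemma sobolev_const_ge: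
  "poincare_const n p \<le> sobolev_const n p C1" "2 * C1 \<le> sobolev_const n p C1"
  "2 \<le> sobolev_const n p C1" "2 * max 1 (unit_ball_vol (real n)) \<le> sobolev_const n p C1"
  by (auto simp: sobolev_const_def)

text \<open>The constant \<open>m\<close> comes from the Poincare inequality in every case, so only a bound of the norm with
  exponent \<open>q\<close> for this \<open>m\<close> remains to be supplied.\<close>

lemma poincare_sobolevI:
  assumes p: "1 \<le> p" and s: "0 < s" "s < 1"
    and bound: "\<And>(x0::'a::euclidean_space) r R u m H. 0 < R \<Longrightarrow> r \<le> R \<Longrightarrow> 0 < H \<Longrightarrow> u \<in> borel_measurable borel \<Longrightarrow>
      (\<exists>K. \<forall>x. \<bar>u x - m\<bar> \<le> K) \<Longrightarrow> energy_on p s (ball x0 R) (\<lambda>x. u x - m) \<le> ennreal H \<Longrightarrow>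
      power_integral p (ball x0 R) (\<lambda>x. u x - m) \<le> ennreal (poincare_const DIM('a) p * (s * (1 - s)) * R powr (s * p) * H) \<Longrightarrow>
      Lq_norm q (ball x0 r) u \<le> ennreal (sobolev_const DIM('a) p C1 * R powr div_exponent DIM('a) q *
        (\<bar>m\<bar> + (s * (1 - s) * R powr (s * p - real DIM('a)) * H) powr (1 / p)))"
  shows "poincare_sobolev TYPE('a) (sobolev_const DIM('a) p C1) p s q"
  unfolding poincare_sobolev_def
proof (intro allI impI)
  fix x0 :: 'a and r R u H
  assume R: "0 < R" "r \<le> R" and H: "0 < H" and u: "u \<in> test_functions UNIV"
    and GH: "gagliardo p s (ball x0 R) UNIV u \<le> ennreal H"
  let ?P = "poincare_const DIM('a) p" and ?C = "sobolev_const DIM('a) p C1"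
  note um = test_function_facts(2)[OF u]
  obtain m where m: "power_integral p (ball x0 R) (\<lambda>x. u x - m) \<le> ennreal (?P * (s * (1 - s)) * R powr (s * p) * H)"
    using poincare[OF um R(1) s p H GH] unfolding poincare_const_def by blast
  obtain B where B: "\<And>x. \<bar>u x\<bar> \<le> B" using test_function_facts(3)[OF u] by blast
  have "\<bar>u x - m\<bar> \<le> B + \<bar>m\<bar>" for x using B[of x] by linarith
  then have bd: "\<exists>K. \<forall>x. \<bar>u x - m\<bar> \<le> K" by blast
  have gw: "energy_on p s (ball x0 R) (\<lambda>x. u x - m) \<le> ennreal H"
    unfolding gagliardo_shift by (rule order_trans[OF gagliardo_mono_set GH]) auto
  have "?P * (s * (1 - s)) * R powr (s * p) * H \<le> ?C * (s * (1 - s)) * R powr (s * p) * H"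
    using s H sobolev_const_ge(1) by (intro mult_right_mono) auto
  then have "power_integral p (ball x0 R) (\<lambda>x. u x - m) \<le> ennreal (?C * (s * (1 - s)) * R powr (s * p) * H)"
    using m by (meson ennreal_leI order_trans)
  with bound[OF R H um bd gw m]
  show "\<exists>m. power_integral p (ball x0 R) (\<lambda>x. u x - m) \<le> ennreal (?C * (s * (1 - s)) * R powr (s * p) * H) \<and>
    Lq_norm q (ball x0 r) u \<le> ennreal (?C * R powr div_exponent DIM('a) q *
      (\<bar>m\<bar> + (s * (1 - s) * R powr (s * p - real DIM('a)) * H) powr (1 / p)))"
    by blast
qed

lemma Lq_norm_le_sobolev_const:
  fixes u :: "'a::euclidean_space \<Rightarrow> real"
  assumes q: "1 \<le> q" and R: "0 < R" "r \<le> R" and u: "u \<in> borel_measurable borel" and C1: "0 < C1" and Y: "0 \<le> Y"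
    and I: "power_integral q (ball x0 R) (\<lambda>x. u x - m) \<le> ennreal ((C1 * R powr (real DIM('a) / q) * Y) powr q)"
  shows "Lq_norm (ereal q) (ball x0 r) u
    \<le> ennreal (sobolev_const DIM('a) p C1 * R powr div_exponent DIM('a) (ereal q) * (\<bar>m\<bar> + Y))"
proof -
  let ?C = "sobolev_const DIM('a) p C1" and ?\<omega> = "max 1 (unit_ball_vol (real DIM('a)))"
  define \<rho> where "\<rho> = R powr (real DIM('a) / q)"
  have "Lq_norm (ereal q) (ball x0 r) u \<le> ennreal (2 * (C1 * \<rho> * Y + \<bar>m\<bar> * (?\<omega> * \<rho>)))"
    unfolding \<rho>_def using q R C1 Y u I by (intro Lq_norm_shift_le) auto
  also have "2 * (C1 * \<rho> * Y + \<bar>m\<bar> * (?\<omega> * \<rho>)) = \<rho> * ((2 * ?\<omega>) * \<bar>m\<bar> + (2 * C1) * Y)"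
    by (simp add: algebra_simps)
  also have "\<dots> \<le> \<rho> * (?C * \<bar>m\<bar> + ?C * Y)"
    using sobolev_const_ge[where n = "DIM('a)" and p = p and ?C1.0 = C1] Y
    by (intro mult_left_mono add_mono mult_right_mono) (auto simp: \<rho>_def)
  also have "\<rho> * (?C * \<bar>m\<bar> + ?C * Y) = ?C * R powr div_exponent DIM('a) (ereal q) * (\<bar>m\<bar> + Y)"
    by (simp add: \<rho>_def div_exponent_def algebra_simps)
  finally show ?thesis by (simp add: ennreal_leI)
qed

lemma poincare_sobolev_finite_exponents:
  assumes p: "1 \<le> p" and Q: "p \<le> Q"
  shows "\<exists>C>0. \<forall>s q. 0 < s \<longrightarrow> s < 1 \<longrightarrow> ereal p \<le> q \<longrightarrow> q \<le> ereal Q \<longrightarrow>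
    (s * p < real DIM('a) \<longrightarrow> q \<le> ereal (sobolev_exponent DIM('a) p s)) \<longrightarrow>
    poincare_sobolev TYPE('a::euclidean_space) C p s q"
proof -
  define N where "N = real DIM('a)"
  have N: "0 < N" by (simp add: N_def)
  from sobolev_by_slicing[OF p Q poincare_const_pos[OF p, of "DIM('a)"]] obtain C1 where C1: "0 < C1" and
    sob: "\<And>(x0::'a) R s q H w. 0 < R \<Longrightarrow> 0 < s \<Longrightarrow> s < 1 \<Longrightarrow> p \<le> q \<Longrightarrow> q \<le> Q \<Longrightarrow> 1 - p / q \<le> s * p / real DIM('a) \<Longrightarrow> 0 < H \<Longrightarrow>
    w \<in> borel_measurable borel \<Longrightarrow> (\<exists>K. \<forall>x. \<bar>w x\<bar> \<le> K) \<Longrightarrow>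
    energy_on p s (ball x0 R) w \<le> ennreal H \<Longrightarrow>
    power_integral p (ball x0 R) w \<le> ennreal (poincare_const DIM('a) p * (s * (1 - s)) * R powr (s * p) * H) \<Longrightarrow>
    power_integral q (ball x0 R) w
      \<le> ennreal ((C1 * R powr (real DIM('a) / q) * (s * (1 - s) * R powr (s * p - real DIM('a)) * H) powr (1 / p)) powr q)"
    by blast
  show ?thesis
  proof (intro exI[of _ "sobolev_const DIM('a) p C1"] conjI allI impI)
    show "0 < sobolev_const DIM('a) p C1" using sobolev_const_ge(3) by (rule less_le_trans[rotated]) simp
    fix s q assume s: "0 < s" "s < 1" and pq: "ereal p \<le> q" "q \<le> ereal Q"
      and crit: "s * p < real DIM('a) \<longrightarrow> q \<le> ereal (sobolev_exponent DIM('a) p s)"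
    then obtain q' where q': "q = ereal q'" by (cases q) auto
    have pq': "p \<le> q'" "q' \<le> Q" "0 < q'" "1 \<le> q'" using pq p by (auto simp: q')
    have sig: "1 - p / q' \<le> s * p / real DIM('a)"
    proof (cases "s * p < N")
      case True
      then have "q' \<le> N * p / (N - s * p)" using crit by (simp add: q' N_def sobolev_exponent_def)
      then have "q' * (N - s * p) \<le> N * p" using True by (simp add: pos_le_divide_eq)
      then show ?thesis using N pq' unfolding N_def[symmetric] by (simp add: field_simps)
    next
      case False
      then have "1 \<le> s * p / N" using N by simp
      moreover have "0 \<le> p / q'" using p pq' by simp
      ultimately show ?thesis unfolding N_def by linarith
    qed
    show "poincare_sobolev TYPE('a) (sobolev_const DIM('a) p C1) p s q" unfolding q'
      using sob[OF _ s pq'(1,2) sig] pq' C1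
      by (intro poincare_sobolevI[OF p s] Lq_norm_le_sobolev_const) auto
  qed
qed

lemma poincare_sobolev_supercritical:
  assumes p: "1 \<le> p" and \<epsilon>: "0 < \<epsilon>"
  shows "\<exists>C>0. \<forall>s q. 0 < s \<longrightarrow> s < 1 \<longrightarrow> ereal p \<le> q \<longrightarrow> real DIM('a) * (1 + \<epsilon>) \<le> s * p \<longrightarrow>
    poincare_sobolev TYPE('a::euclidean_space) C p s q"
proof -
  define \<omega> where "\<omega> = unit_ball_vol (real DIM('a))"
  have \<omega>: "0 < \<omega>" by (simp add: \<omega>_def)
  from sup_bound_by_iteration[OF p \<epsilon> poincare_const_pos[OF p, of "DIM('a)"]] obtain C1 where C1: "0 < C1" and
    sup: "\<And>(x0::'a) R s H w. 0 < R \<Longrightarrow> 0 < s \<Longrightarrow> s < 1 \<Longrightarrow> real DIM('a) * (1 + \<epsilon>) \<le> s * p \<Longrightarrow> 0 < H \<Longrightarrow>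
    w \<in> borel_measurable borel \<Longrightarrow>
    energy_on p s (ball x0 R) w \<le> ennreal H \<Longrightarrow>
    power_integral p (ball x0 R) w \<le> ennreal (poincare_const DIM('a) p * (s * (1 - s)) * R powr (s * p) * H) \<Longrightarrow>
    (AE x in lborel. x \<in> ball x0 R \<longrightarrow> \<bar>w x\<bar> \<le> C1 * (s * (1 - s) * R powr (s * p - real DIM('a)) * H) powr (1 / p))"
    by blast
  define C2 where "C2 = C1 * max 1 \<omega>"
  define C where "C = sobolev_const DIM('a) p C2"
  have C2: "0 < C2" "C1 \<le> C2" using C1 mult_left_mono[of 1 "max 1 \<omega>" C1] by (auto simp: C2_def)
  have C: "1 \<le> C" "C1 \<le> C" using sobolev_const_ge[where n = "DIM('a)" and p = p and ?C1.0 = C2] C2 C1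
    unfolding C_def by linarith+
  show ?thesis
  proof (intro exI[of _ C] conjI allI impI)
    show "0 < C" using C by linarith
    fix s q assume s: "0 < s" "s < 1" and pq: "ereal p \<le> q" and sig: "real DIM('a) * (1 + \<epsilon>) \<le> s * p"
    show "poincare_sobolev TYPE('a) C p s q" unfolding C_def
    proof (rule poincare_sobolevI[OF p s])
      fix x0 :: 'a and r R u m H
      assume R: "0 < R" "r \<le> R" and H: "0 < H" and um[measurable]: "u \<in> borel_measurable borel"
        and gw: "energy_on p s (ball x0 R) (\<lambda>x. u x - m) \<le> ennreal H"
        and m: "power_integral p (ball x0 R) (\<lambda>x. u x - m) \<le> ennreal (poincare_const DIM('a) p * (s * (1 - s)) * R powr (s * p) * H)"
      define E where "E = (s * (1 - s) * R powr (s * p - real DIM('a)) * H) powr (1 / p)"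
      have E: "0 \<le> E" by (simp add: E_def)
      have wm: "(\<lambda>x. u x - m) \<in> borel_measurable borel" by simp
      have AE: "AE x in lborel. x \<in> ball x0 R \<longrightarrow> \<bar>u x - m\<bar> \<le> C1 * E"
        unfolding E_def by (rule sup[OF R(1) s sig H wm gw m])
      have "Lq_norm q (ball x0 r) u \<le> ennreal (C * R powr div_exponent DIM('a) q * (\<bar>m\<bar> + E))"
      proof (cases "q = \<infinity>")
        case True
        have "1 * \<bar>m\<bar> + C1 * E \<le> C * \<bar>m\<bar> + C * E"
          using C E by (intro add_mono mult_right_mono) auto
        then have le: "\<bar>m\<bar> + C1 * E \<le> C * (\<bar>m\<bar> + E)" by (simp add: distrib_left)
        have "AE x in lborel. x \<in> ball x0 R \<longrightarrow> \<bar>u x\<bar> \<le> \<bar>m\<bar> + C1 * E"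
          using AE by (rule AE_mp) (auto intro!: AE_I2)
        then have "Lq_norm \<infinity> (ball x0 r) u \<le> ennreal (\<bar>m\<bar> + C1 * E)"
          by (rule Lq_norm_infinity_le[OF um R(2)])
        also have "\<dots> \<le> ennreal (C * (\<bar>m\<bar> + E))" by (rule ennreal_leI[OF le])
        finally show ?thesis using True R by (simp add: div_exponent_def)
      next
        case False
        with pq obtain q' where q': "q = ereal q'" by (cases q) auto
        have pq': "1 \<le> q'" "0 < q'" using pq p by (auto simp: q')
        have RN: "R powr real DIM('a) = R ^ DIM('a)" using R by (simp add: powr_realpow)
        have "power_integral q' (ball x0 R) (\<lambda>x. u x - m) \<le> (\<integral>\<^sup>+x. ennreal ((C1 * E) powr q') * indicator (ball x0 R) x \<partial>lborel)"
          using AE by (intro nn_integral_mono_AE, rule AE_mp)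
            (use pq' in \<open>auto intro!: AE_I2 ennreal_leI powr_mono2 simp: indicator_def\<close>)
        also have "\<dots> = ennreal ((C1 * E) powr q' * (\<omega> * R powr real DIM('a)))"
          using R by (subst nn_integral_cmult_indicator) (auto simp: emeasure_ball ennreal_mult \<omega>_def RN)
        also have "\<dots> \<le> ennreal ((C2 * R powr (real DIM('a) / q') * E) powr q')"
        proof (rule ennreal_leI)
          have "max 1 \<omega> powr 1 \<le> max 1 \<omega> powr q'" using pq' by (intro powr_mono) auto
          then have "\<omega> \<le> max 1 \<omega> powr q'" by simp
          then have "(C1 * E) powr q' * (\<omega> * R powr real DIM('a)) \<le> (C1 * E) powr q' * (max 1 \<omega> powr q' * R powr real DIM('a))"
            by (intro mult_left_mono mult_right_mono) auto
          also have "\<dots> = (C2 * R powr (real DIM('a) / q') * E) powr q'"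
            using pq' by (simp add: C2_def powr_mult powr_powr)
          finally show "(C1 * E) powr q' * (\<omega> * R powr real DIM('a)) \<le> (C2 * R powr (real DIM('a) / q') * E) powr q'" .
        qed
        finally show ?thesis unfolding q' C_def
          using pq' R C2 E by (intro Lq_norm_le_sobolev_const um) auto
      qed
      then show "Lq_norm q (ball x0 r) u \<le> ennreal (sobolev_const DIM('a) p C2 * R powr div_exponent DIM('a) q *
        (\<bar>m\<bar> + (s * (1 - s) * R powr (s * p - real DIM('a)) * H) powr (1 / p)))"
        by (simp add: C_def E_def)
    qed
  qed
qed

section \<open>From Sobolev-Poincare to the capacitary inequality\<close>

text \<open>The capacitary inequality with constant $c\,\delta^s (R/r)^{-N/q}$ where
  $\delta = \min(1, R/r - \sqrt N)$; the powers of \<open>r\<close> have been cancelled, so only \<open>R\<close> remains as a scale.\<close>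

definition mazya_ineq :: "'a::euclidean_space itself \<Rightarrow> real \<Rightarrow> real \<Rightarrow> real \<Rightarrow> ereal \<Rightarrow> bool" where
  "mazya_ineq (T :: 'a itself) c p s q \<longleftrightarrow>
    (\<forall>(x0::'a) r R K u. 0 < r \<longrightarrow> sqrt (real DIM('a)) * r < R \<longrightarrow> K \<subseteq> cball x0 r \<longrightarrow>
      u \<in> test_functions UNIV \<longrightarrow> (\<forall>x\<in>K. u x = 0) \<longrightarrow>
      ennreal (c * min 1 (R / r - sqrt (real DIM('a))) powr s * R powr - div_exponent DIM('a) q)
        * ennreal_powr (rel_capacity p s K (ball x0 R)) (1 / p) * Lq_norm q (ball x0 r) u
      \<le> ennreal_powr (gagliardo p s (ball x0 R) UNIV u) (1 / p))"

text \<open>The true gap is $R - r$, which for $N \ge 2$ stays comparable to \<open>R\<close>. For $N = 1$ it degenerates as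
  $R/r \to 1$, which is the source of the factor $(R/r - \sqrt N)^s$.\<close>

lemma gap_lower_bound:
  fixes r R \<sigma> :: real
  assumes "0 < r" "1 \<le> \<sigma>" "\<sigma> * r < R"
  shows "R * min 1 (R / r - \<sigma>) / 2 \<le> R - r"
proof -
  define \<rho> where "\<rho> = R / r"
  have R: "R = \<rho> * r" using assms by (simp add: \<rho>_def)
  have \<rho>: "\<sigma> < \<rho>" using assms by (simp add: \<rho>_def pos_less_divide_eq)
  have "\<rho> * min 1 (\<rho> - \<sigma>) / 2 \<le> \<rho> - 1"
  proof (cases "\<rho> \<le> 2")
    case True
    have "\<rho> * min 1 (\<rho> - \<sigma>) \<le> 2 * (\<rho> - 1)" using \<rho> assms True by (intro mult_mono) auto
    then show ?thesis by simp
  next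
    case False
    have "\<rho> * min 1 (\<rho> - \<sigma>) \<le> \<rho> * 1" using \<rho> assms by (intro mult_left_mono) auto
    then show ?thesis using False by linarith
  qed
  then have "(\<rho> * min 1 (\<rho> - \<sigma>) / 2) * r \<le> (\<rho> - 1) * r" using assms by (intro mult_right_mono) auto
  then show ?thesis unfolding \<rho>_def[symmetric] by (simp add: R algebra_simps)
qed

text \<open>Passing to the limit in bounds \<open>H\<close> for the energy, which covers the energy zero.\<close>

lemma ennreal_le_powr_limit:
  fixes X :: ennreal
  assumes p: "0 < p" and g: "0 \<le> g" and le: "\<And>H. g < H \<Longrightarrow> X \<le> ennreal (H powr (1 / p))"
  shows "X \<le> ennreal (g powr (1 / p))"
proof -
  have "X \<le> ennreal ((g + 1) powr (1 / p))" by (rule le) simp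
  then obtain x where x: "X = ennreal x" "0 \<le> x" by (cases X) (auto simp: top_unique)
  have "x powr p \<le> H" if "g < H" for H
  proof -
    have "x \<le> H powr (1 / p)" using le[OF that] x by (simp add: ennreal_le_iff)
    then have "x powr p \<le> (H powr (1 / p)) powr p" using x p by (intro powr_mono2) auto
    then show ?thesis using p g that by (simp add: powr_powr)
  qed
  then have "x powr p \<le> g" by (rule dense_ge)
  then have "(x powr p) powr (1 / p) \<le> g powr (1 / p)" using p by (intro powr_mono2) auto
  then show ?thesis using x p by (simp add: powr_powr ennreal_leI)
qed

text \<open>The triangle inequality $\|u\|_q \lesssim |m| R^{N/q} + \|u - m\|_q$ splits the left-hand side. The first
  part is the capacity estimate for \<open>u\<close> and \<open>m\<close>; the second is the Sobolev-Poincare inequality times the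
  crude bound of the capacity by the energy of a cutoff. In both the factors $s(1-s)$ cancel, whence \<open>c\<close>
  depends on \<open>s\<close> and \<open>q\<close> only through \<open>C\<close>.\<close>

lemma mazya_from_poincare_sobolev:
  assumes p: "1 \<le> p" and C: "0 < C"
  shows "\<exists>c>0. \<forall>s q. 0 < s \<longrightarrow> s < 1 \<longrightarrow> poincare_sobolev TYPE('a::euclidean_space) C p s q \<longrightarrow> mazya_ineq TYPE('a) c p s q"
proof -
  define N where "N = real DIM('a)"
  define \<sigma> where "\<sigma> = sqrt N"
  define \<omega> where "\<omega> = unit_ball_vol N"
  define \<kappa> where "\<kappa> = \<omega> * 2 powr (2 * N + p + 1)"
  \<comment> \<open>\<open>A1\<close> is the constant of the bound for $|m|^p$ times the capacity, \<open>A2\<close> that for the capacity itself.\<close>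
  define A1 where "A1 = 2 * 48 powr p * (1 + \<kappa> * 2 powr p * C)"
  define A2 where "A2 = 2 * 48 powr p * (\<kappa> * 2 powr p * \<omega>)"
  define c where "c = 1 / (C * (A1 powr (1 / p) + A2 powr (1 / p)))"
  have N: "1 \<le> N" using DIM_positive[where 'a='a] unfolding N_def by linarith
  have \<sigma>: "1 \<le> \<sigma>" using N by (simp add: \<sigma>_def)
  have \<omega>: "0 < \<omega>" by (simp add: \<omega>_def N_def)
  have \<kappa>: "0 < \<kappa>" using \<omega> by (simp add: \<kappa>_def)
  have A1: "0 < A1" using \<kappa> C by (simp add: A1_def add_pos_pos)
  have A2: "0 < A2" using \<kappa> \<omega> by (simp add: A2_def)
  have cc: "0 < C * (A1 powr (1 / p) + A2 powr (1 / p))" using C A1 A2 by (simp add: add_pos_pos)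
  have c: "0 < c" using cc by (simp add: c_def)
  have c_eq: "c * C * (A1 powr (1 / p) + A2 powr (1 / p)) = 1"
  proof -
    have "A1 powr (1 / p) + A2 powr (1 / p) \<noteq> 0" "C \<noteq> 0" using cc by auto
    then show ?thesis by (simp add: c_def)
  qed
  show ?thesis
  proof (intro exI[of _ c] conjI c allI impI)
    fix s q assume s: "0 < s" "s < 1" and PS: "poincare_sobolev TYPE('a) C p s q"
    have sp: "0 < s * p" "s * p \<le> p" using s p by (auto simp: mult_le_cancel_right1)
    show "mazya_ineq TYPE('a) c p s q" unfolding mazya_ineq_def
    proof (intro allI impI)
      fix x0 :: 'a and r R K u
      assume r: "0 < r" "sqrt (real DIM('a)) * r < R" and K: "K \<subseteq> cball x0 r"
        and u: "u \<in> test_functions UNIV" and uK: "\<forall>x\<in>K. u x = 0"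
      define \<delta> where "\<delta> = min 1 (R / r - sqrt (real DIM('a)))"
      define e where "e = div_exponent DIM('a) q"
      have \<delta>: "0 < \<delta>" "\<delta> \<le> 1" using r by (auto simp: \<delta>_def pos_less_divide_eq)
      have rR: "r < R"
      proof -
        have "1 * r \<le> sqrt (real DIM('a)) * r" using \<sigma> r unfolding \<sigma>_def N_def by (intro mult_right_mono) auto
        then show ?thesis using r by linarith
      qed
      have R: "0 < R" using r rR by linarith
      have gap: "R * \<delta> / 2 \<le> R - r"
        using gap_lower_bound[of r \<sigma> R] r \<sigma> unfolding \<delta>_def \<sigma>_def N_def by simp
      have gap_powr: "(R - r) powr - (s * p) \<le> 2 powr p * R powr - (s * p) * \<delta> powr - (s * p)"
      proof -
        have "(R - r) powr - (s * p) \<le> (R * \<delta> / 2) powr - (s * p)"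
          using gap R \<delta> sp by (intro powr_mono2') auto
        also have "\<dots> = R powr - (s * p) * \<delta> powr - (s * p) * 2 powr (s * p)"
          using R \<delta> powr_div_minus[of "R * \<delta>" 2 "s * p"] by (simp add: powr_mult)
        also have "\<dots> \<le> R powr - (s * p) * \<delta> powr - (s * p) * 2 powr p"
          using sp by (intro mult_left_mono powr_mono) auto
        finally show ?thesis by (simp add: mult_ac)
      qed
      have \<delta>1: "1 \<le> \<delta> powr - (s * p)"
        using powr_mono2'[of "- (s * p)" \<delta> 1] \<delta> sp by simp
      \<comment> \<open>The capacity estimate for the function 0 and the constant 1, whose competitor is the cutoff.\<close>
      have cap_fin: "rel_capacity p s K (ball x0 R) \<le> ennreal (A2 * \<delta> powr - (s * p) * R powr (N - s * p) / (s * (1 - s)))"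
      proof -
        have "ennreal (\<bar>1\<bar> powr p) * rel_capacity p s K (ball x0 R)
          \<le> ennreal (2 * 48 powr p * (0 + cutoff_energy DIM('a) p s (R - r) * (\<omega> * R powr N)))"
        proof (rule capacity_le[OF p s r(1) rR K, where u = "\<lambda>x. 0"])
          have "(\<integral>\<^sup>+x\<in>ball x0 R. ennreal (\<bar>(0::real) - 1\<bar> powr p) \<partial>lborel) = emeasure lborel (ball x0 R)" by simp
          also have "\<dots> = ennreal (\<omega> * R powr N)" using R by (simp add: emeasure_ball \<omega>_def N_def powr_realpow)
          finally show "(\<integral>\<^sup>+x\<in>ball x0 R. ennreal (\<bar>(0::real) - 1\<bar> powr p) \<partial>lborel) \<le> ennreal (\<omega> * R powr N)" by simp
          show "gagliardo p s (ball x0 R) UNIV (\<lambda>x. 0) \<le> ennreal 0" by (simp add: gagliardo_def)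
        qed (use \<omega> in \<open>auto intro: C_class_const\<close>)
        also have "\<dots> \<le> ennreal (A2 * \<delta> powr - (s * p) * R powr (N - s * p) / (s * (1 - s)))"
        proof (rule ennreal_leI)
          have "2 * 48 powr p * (0 + cutoff_energy DIM('a) p s (R - r) * (\<omega> * R powr N))
            = (2 * 48 powr p * \<kappa> * \<omega> * R powr N / (s * (1 - s))) * (R - r) powr - (s * p)"
            by (simp add: \<kappa>_def \<omega>_def N_def)
          also have "\<dots> \<le> (2 * 48 powr p * \<kappa> * \<omega> * R powr N / (s * (1 - s))) * (2 powr p * R powr - (s * p) * \<delta> powr - (s * p))"
            using \<kappa> \<omega> s by (intro mult_left_mono gap_powr) auto
          also have "\<dots> = A2 * \<delta> powr - (s * p) * (R powr N * R powr - (s * p)) / (s * (1 - s))"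
            by (simp add: A2_def)
          also have "R powr N * R powr - (s * p) = R powr (N - s * p)"
            unfolding powr_add[symmetric] by simp
          finally show "2 * 48 powr p * (0 + cutoff_energy DIM('a) p s (R - r) * (\<omega> * R powr N))
            \<le> A2 * \<delta> powr - (s * p) * R powr (N - s * p) / (s * (1 - s))" .
        qed
        finally show ?thesis by simp
      qed
      then obtain k where k: "rel_capacity p s K (ball x0 R) = ennreal k" "0 \<le> k"
          "k \<le> A2 * \<delta> powr - (s * p) * R powr (N - s * p) / (s * (1 - s))"
        using A2 s by (cases "rel_capacity p s K (ball x0 R)") (auto simp: top_unique ennreal_le_iff)
      define X where "X = ennreal (c * \<delta> powr s * R powr - e) * ennreal_powr (rel_capacity p s K (ball x0 R)) (1 / p) * Lq_norm q (ball x0 r) u"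
      have main: "X \<le> ennreal (H powr (1 / p))"
        if H: "0 < H" and GH: "gagliardo p s (ball x0 R) UNIV u \<le> ennreal H" for H
      proof -
        define E where "E = s * (1 - s) * R powr (s * p - N) * H"
        have E: "0 < E" using s R H by (simp add: E_def)
        from PS[unfolded poincare_sobolev_def, rule_format, OF R less_imp_le[OF rR] H u GH]
        obtain m where m: "power_integral p (ball x0 R) (\<lambda>x. u x - m) \<le> ennreal (C * (s * (1 - s)) * R powr (s * p) * H)"
          and Lq: "Lq_norm q (ball x0 r) u \<le> ennreal (C * R powr e * (\<bar>m\<bar> + E powr (1 / p)))"
          unfolding e_def E_def N_def by blast
        have "ennreal (\<bar>m\<bar> powr p) * rel_capacity p s K (ball x0 R)
          \<le> ennreal (2 * 48 powr p * (H + cutoff_energy DIM('a) p s (R - r) * (C * (s * (1 - s)) * R powr (s * p) * H)))"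
          using uK test_function_facts(1)[OF u] C s H
          by (intro capacity_le[OF p s r(1) rR K _ _ _ m _ GH]) auto
        also have "\<dots> \<le> ennreal (A1 * \<delta> powr - (s * p) * H)"
        proof (rule ennreal_leI)
          have "cutoff_energy DIM('a) p s (R - r) * (C * (s * (1 - s)) * R powr (s * p) * H)
            = \<kappa> * C * H * R powr (s * p) * (R - r) powr - (s * p)"
            using s by (simp add: \<kappa>_def \<omega>_def N_def)
          also have "\<dots> \<le> \<kappa> * C * H * R powr (s * p) * (2 powr p * R powr - (s * p) * \<delta> powr - (s * p))"
            using \<kappa> C H by (intro mult_left_mono gap_powr) auto
          also have "\<dots> = \<kappa> * 2 powr p * C * (R powr (s * p) * R powr - (s * p)) * \<delta> powr - (s * p) * H" by (simp only: mult_ac)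
          also have "R powr (s * p) * R powr - (s * p) = 1" unfolding powr_add[symmetric] using R by simp
          finally have 1: "cutoff_energy DIM('a) p s (R - r) * (C * (s * (1 - s)) * R powr (s * p) * H)
            \<le> \<kappa> * 2 powr p * C * \<delta> powr - (s * p) * H" by simp
          have "1 * H \<le> \<delta> powr - (s * p) * H" using \<delta>1 H by (intro mult_right_mono) auto
          then have "H + cutoff_energy DIM('a) p s (R - r) * (C * (s * (1 - s)) * R powr (s * p) * H)
            \<le> \<delta> powr - (s * p) * H + \<kappa> * 2 powr p * C * \<delta> powr - (s * p) * H" using 1 by linarith
          also have "\<dots> = (1 + \<kappa> * 2 powr p * C) * \<delta> powr - (s * p) * H" by (simp add: algebra_simps)
          finally have "2 * 48 powr p * (H + cutoff_energy DIM('a) p s (R - r) * (C * (s * (1 - s)) * R powr (s * p) * H))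
            \<le> 2 * 48 powr p * ((1 + \<kappa> * 2 powr p * C) * \<delta> powr - (s * p) * H)"
            by (rule mult_left_mono) simp
          then show "2 * 48 powr p * (H + cutoff_energy DIM('a) p s (R - r) * (C * (s * (1 - s)) * R powr (s * p) * H))
            \<le> A1 * \<delta> powr - (s * p) * H" by (simp only: A1_def mult.assoc)
        qed
        finally have "ennreal (\<bar>m\<bar> powr p * k) \<le> ennreal (A1 * \<delta> powr - (s * p) * H)"
          using k by (simp add: ennreal_mult)
        then have mk: "\<bar>m\<bar> powr p * k \<le> A1 * \<delta> powr - (s * p) * H"
          using A1 H by (subst (asm) ennreal_le_iff) auto
        have Ek: "E * k \<le> A2 * \<delta> powr - (s * p) * H"
        proof -
          have "E * k \<le> E * (A2 * \<delta> powr - (s * p) * R powr (N - s * p) / (s * (1 - s)))"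
            using k E by (intro mult_left_mono) auto
          also have "\<dots> = A2 * \<delta> powr - (s * p) * H * (R powr (s * p - N) * R powr (N - s * p))"
            using s by (simp add: E_def)
          also have "R powr (s * p - N) * R powr (N - s * p) = 1" unfolding powr_add[symmetric] using R by simp
          finally show ?thesis by simp
        qed
        have root: "(A * \<delta> powr - (s * p) * H) powr (1 / p) = A powr (1 / p) * \<delta> powr - s * H powr (1 / p)" for A
          using p by (simp add: powr_mult powr_powr)
        have 1: "\<bar>m\<bar> * k powr (1 / p) \<le> A1 powr (1 / p) * \<delta> powr - s * H powr (1 / p)"
        proof -
          have "\<bar>m\<bar> * k powr (1 / p) = (\<bar>m\<bar> powr p * k) powr (1 / p)" using p by (simp add: powr_mult powr_powr)
          also have "\<dots> \<le> (A1 * \<delta> powr - (s * p) * H) powr (1 / p)" using mk k p by (intro powr_mono2) auto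
          finally show ?thesis unfolding root .
        qed
        have 2: "E powr (1 / p) * k powr (1 / p) \<le> A2 powr (1 / p) * \<delta> powr - s * H powr (1 / p)"
        proof -
          have "E powr (1 / p) * k powr (1 / p) = (E * k) powr (1 / p)" by (simp add: powr_mult)
          also have "\<dots> \<le> (A2 * \<delta> powr - (s * p) * H) powr (1 / p)" using Ek E k p by (intro powr_mono2) auto
          finally show ?thesis unfolding root .
        qed
        have "X \<le> ennreal (c * \<delta> powr s * R powr - e) * ennreal (k powr (1 / p)) * ennreal (C * R powr e * (\<bar>m\<bar> + E powr (1 / p)))"
          unfolding X_def using k Lq by (intro mult_mono) (auto simp: ennreal_powr_def)
        also have "\<dots> = ennreal ((c * \<delta> powr s * R powr - e) * k powr (1 / p) * (C * R powr e * (\<bar>m\<bar> + E powr (1 / p))))"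
          using c C by (simp add: ennreal_mult)
        also have "\<dots> \<le> ennreal (H powr (1 / p))"
        proof (rule ennreal_leI)
          have "(c * \<delta> powr s * R powr - e) * k powr (1 / p) * (C * R powr e * (\<bar>m\<bar> + E powr (1 / p)))
            = c * C * \<delta> powr s * (R powr - e * R powr e) * (\<bar>m\<bar> * k powr (1 / p) + E powr (1 / p) * k powr (1 / p))"
            by (simp add: algebra_simps)
          also have "R powr - e * R powr e = 1" unfolding powr_add[symmetric] using R by simp
          also have "c * C * \<delta> powr s * 1 * (\<bar>m\<bar> * k powr (1 / p) + E powr (1 / p) * k powr (1 / p))
            \<le> c * C * \<delta> powr s * 1 * (A1 powr (1 / p) * \<delta> powr - s * H powr (1 / p) + A2 powr (1 / p) * \<delta> powr - s * H powr (1 / p))"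
            using c C by (intro mult_left_mono add_mono 1 2) auto
          also have "\<dots> = (c * C * (A1 powr (1 / p) + A2 powr (1 / p))) * (\<delta> powr s * \<delta> powr - s) * H powr (1 / p)"
            by (simp add: algebra_simps)
          also have "\<delta> powr s * \<delta> powr - s = 1" unfolding powr_add[symmetric] using \<delta> by simp
          finally show "(c * \<delta> powr s * R powr - e) * k powr (1 / p) * (C * R powr e * (\<bar>m\<bar> + E powr (1 / p))) \<le> H powr (1 / p)"
            unfolding c_eq by simp
        qed
        finally show ?thesis .
      qed
      have "X \<le> ennreal_powr (gagliardo p s (ball x0 R) UNIV u) (1 / p)"
      proof (cases "gagliardo p s (ball x0 R) UNIV u")
        case (real g)
        have "X \<le> ennreal (g powr (1 / p))"
        proof (rule ennreal_le_powr_limit)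
          fix H assume "g < H"
          then show "X \<le> ennreal (H powr (1 / p))" using real by (intro main) (auto simp: ennreal_leI)
        qed (use p real in auto)
        then show ?thesis using real by (simp add: ennreal_powr_def)
      qed (simp add: ennreal_powr_def)
      then show "ennreal (c * min 1 (R / r - sqrt (real DIM('a))) powr s * R powr - div_exponent DIM('a) q)
        * ennreal_powr (rel_capacity p s K (ball x0 R)) (1 / p) * Lq_norm q (ball x0 r) u
      \<le> ennreal_powr (gagliardo p s (ball x0 R) UNIV u) (1 / p)"
        unfolding X_def \<delta>_def e_def .
    qed
  qed
qed

lemma mazya_ineq_antimono:
  assumes "mazya_ineq TYPE('a::euclidean_space) c p s q" "0 \<le> c'" "c' \<le> c"
  shows "mazya_ineq TYPE('a) c' p s q"
  unfolding mazya_ineq_def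
proof (intro allI impI)
  fix x0 :: 'a and r R K u
  assume a: "0 < r" "sqrt (real DIM('a)) * r < R" "K \<subseteq> cball x0 r" "u \<in> test_functions UNIV" "\<forall>x\<in>K. u x = 0"
  have "ennreal (c' * min 1 (R / r - sqrt (real DIM('a))) powr s * R powr - div_exponent DIM('a) q)
    * ennreal_powr (rel_capacity p s K (ball x0 R)) (1 / p) * Lq_norm q (ball x0 r) u
    \<le> ennreal (c * min 1 (R / r - sqrt (real DIM('a))) powr s * R powr - div_exponent DIM('a) q)
    * ennreal_powr (rel_capacity p s K (ball x0 R)) (1 / p) * Lq_norm q (ball x0 r) u"
    using assms by (intro mult_right_mono ennreal_leI) auto
  also have "\<dots> \<le> ennreal_powr (gagliardo p s (ball x0 R) UNIV u) (1 / p)"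
    using assms(1) a unfolding mazya_ineq_def by blast
  finally show "ennreal (c' * min 1 (R / r - sqrt (real DIM('a))) powr s * R powr - div_exponent DIM('a) q)
    * ennreal_powr (rel_capacity p s K (ball x0 R)) (1 / p) * Lq_norm q (ball x0 r) u
    \<le> ennreal_powr (gagliardo p s (ball x0 R) UNIV u) (1 / p)" .
qed

lemma mazya_finite_exponents:
  assumes "1 \<le> p" "p \<le> Q"
  shows "\<exists>c>0. \<forall>s q. 0 < s \<longrightarrow> s < 1 \<longrightarrow> admissible DIM('a) p s q \<longrightarrow> q \<le> ereal Q \<longrightarrow>
    mazya_ineq TYPE('a::euclidean_space) c p s q"
proof -
  from poincare_sobolev_finite_exponents[OF assms, where 'a = 'a] obtain C where C: "0 < C" and
    PS: "\<And>s q. 0 < s \<Longrightarrow> s < 1 \<Longrightarrow> ereal p \<le> q \<Longrightarrow> q \<le> ereal Q \<Longrightarrow>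
    (s * p < real DIM('a) \<longrightarrow> q \<le> ereal (sobolev_exponent DIM('a) p s)) \<Longrightarrow> poincare_sobolev TYPE('a) C p s q"
    by blast
  from mazya_from_poincare_sobolev[OF assms(1) C, where 'a = 'a] obtain c where "0 < c"
    "\<And>s q. 0 < s \<Longrightarrow> s < 1 \<Longrightarrow> poincare_sobolev TYPE('a) C p s q \<Longrightarrow> mazya_ineq TYPE('a) c p s q"
    by blast
  with PS show ?thesis unfolding admissible_def by blast
qed

lemma mazya_supercritical:
  assumes "1 \<le> p" "0 < \<epsilon>"
  shows "\<exists>c>0. \<forall>s q. 0 < s \<longrightarrow> s < 1 \<longrightarrow> ereal p \<le> q \<longrightarrow> real DIM('a) * (1 + \<epsilon>) \<le> s * p \<longrightarrow>
    mazya_ineq TYPE('a::euclidean_space) c p s q"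
proof -
  from poincare_sobolev_supercritical[OF assms, where 'a = 'a] obtain C where C: "0 < C" and
    PS: "\<And>s q. 0 < s \<Longrightarrow> s < 1 \<Longrightarrow> ereal p \<le> q \<Longrightarrow> real DIM('a) * (1 + \<epsilon>) \<le> s * p \<Longrightarrow> poincare_sobolev TYPE('a) C p s q"
    by blast
  from mazya_from_poincare_sobolev[OF assms(1) C, where 'a = 'a] obtain c where "0 < c"
    "\<And>s q. 0 < s \<Longrightarrow> s < 1 \<Longrightarrow> poincare_sobolev TYPE('a) C p s q \<Longrightarrow> mazya_ineq TYPE('a) c p s q"
    by blast
  with PS show ?thesis by blast
qed

section \<open>Dependence of the constant on the parameters\<close>

text \<open>Half of the supremum of the valid constants not exceeding 1, hence itself valid. Defining it
  as a supremum makes it at least half of every constant that works uniformly in a range of \<open>s\<close> and \<open>q\<close>,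
  so lower bounds as $s \to 0$ and $s \to 1$ follow from uniform inequalities.\<close>

definition mazya_const :: "'a::euclidean_space itself \<Rightarrow> real \<Rightarrow> real \<Rightarrow> ereal \<Rightarrow> real" where
  "mazya_const T p s q = Sup {c. 0 < c \<and> c \<le> 1 \<and> mazya_ineq T c p s q} / 2"

lemma mazya_const_ge:
  assumes "mazya_ineq TYPE('a::euclidean_space) c p s q" "0 < c"
  shows "min 1 c / 2 \<le> mazya_const TYPE('a) p s q"
proof -
  have "mazya_ineq TYPE('a) (min 1 c) p s q" using assms mazya_ineq_antimono[of c p s q "min 1 c"] by auto
  then have "min 1 c \<le> Sup {c. 0 < c \<and> c \<le> 1 \<and> mazya_ineq TYPE('a) c p s q}"
    using assms by (intro cSup_upper) (auto intro!: bdd_aboveI[of _ 1])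
  then show ?thesis by (simp add: mazya_const_def)
qed

lemma mazya_const_works:
  assumes "mazya_ineq TYPE('a::euclidean_space) c p s q" "0 < c"
  shows "0 < mazya_const TYPE('a) p s q" "mazya_const TYPE('a) p s q \<le> 1" "mazya_ineq TYPE('a) (mazya_const TYPE('a) p s q) p s q"
proof -
  let ?S = "{c. 0 < c \<and> c \<le> 1 \<and> mazya_ineq TYPE('a) c p s q}"
  show pos: "0 < mazya_const TYPE('a) p s q" using mazya_const_ge[OF assms] assms(2) by (smt (verit) half_gt_zero)
  then have S: "0 < Sup ?S" by (simp add: mazya_const_def)
  have ne: "?S \<noteq> {}"
  proof -
    have "min 1 c \<in> ?S" using assms mazya_ineq_antimono[of c p s q "min 1 c"] by auto
    then show ?thesis by blast
  qed
  have "Sup ?S \<le> 1" using ne by (intro cSup_least) auto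
  then show "mazya_const TYPE('a) p s q \<le> 1" by (simp add: mazya_const_def)
  have "Sup ?S / 2 < Sup ?S" using S by simp
  then obtain b where "b \<in> ?S" "Sup ?S / 2 < b"
    by (rule less_cSupE[OF _ ne])
  then show "mazya_ineq TYPE('a) (mazya_const TYPE('a) p s q) p s q"
    using mazya_ineq_antimono[of b p s q "mazya_const TYPE('a) p s q"] pos by (auto simp: mazya_const_def)
qed

text \<open>Admissibility of \<open>q = \<infinity>\<close> forces \<open>s * p > N\<close>.\<close>

lemma exists_mazya_ineq:
  assumes "1 \<le> p" "0 < s" "s < 1" and adm: "admissible DIM('a) p s q"
  shows "\<exists>c>0. mazya_ineq TYPE('a::euclidean_space) c p s q"
proof (cases "q = \<infinity>")
  case True
  have N: "0 < real DIM('a)" by simp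
  have "real DIM('a) < s * p" using adm by (auto simp: admissible_def True)
  then have "0 < s * p / real DIM('a) - 1" using N by simp
  moreover have "real DIM('a) * (1 + (s * p / real DIM('a) - 1)) \<le> s * p" using N by simp
  ultimately show ?thesis using mazya_supercritical[OF assms(1), of "s * p / real DIM('a) - 1", where 'a = 'a] assms
    unfolding admissible_def by blast
next
  case False
  with adm obtain q' where q': "q = ereal q'" by (cases q) (auto simp: admissible_def)
  then have "p \<le> q'" using adm by (simp add: admissible_def)
  then show ?thesis using mazya_finite_exponents[OF assms(1), of q', where 'a = 'a] assms q' by blast
qed

lemma comparable_1I:
  assumes F: "F \<noteq> bot" and l: "0 < l" and ev: "\<forall>\<^sub>F x in F. l \<le> f x \<and> f x \<le> U"
  shows "comparable f (\<lambda>_. 1) F"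
proof -
  have 1: "ereal l \<le> Liminf F (\<lambda>x. ereal (f x / 1))"
    using ev by (intro Liminf_bounded) (auto elim: eventually_mono)
  have 2: "Limsup F (\<lambda>x. ereal (f x / 1)) \<le> ereal U"
    using ev by (intro Limsup_bounded) (auto elim: eventually_mono)
  have 3: "Liminf F (\<lambda>x. ereal (f x / 1)) \<le> Limsup F (\<lambda>x. ereal (f x / 1))"
    using F by (rule Liminf_le_Limsup)
  have "0 < Liminf F (\<lambda>x. ereal (f x / 1))" using l by (intro less_le_trans[OF _ 1]) simp
  moreover have "Limsup F (\<lambda>x. ereal (f x / 1)) < \<infinity>" by (rule le_less_trans[OF 2]) simp
  ultimately show ?thesis using 3 by (simp add: comparable_def)
qed

lemma div_exponent_bounds:
  assumes "1 \<le> p" "ereal p \<le> q"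
  shows "0 \<le> div_exponent N q" "div_exponent N q \<le> real N"
proof -
  have "0 \<le> div_exponent N q \<and> div_exponent N q \<le> real N"
  proof (cases q)
    case (real x)
    then have "1 \<le> x" using assms by simp
    then show ?thesis using real divide_left_mono[of 1 x "real N"] by (simp add: div_exponent_def)
  qed (use assms in \<open>auto simp: div_exponent_def\<close>)
  then show "0 \<le> div_exponent N q" "div_exponent N q \<le> real N" by auto
qed

definition mazya_bound :: "'a::euclidean_space itself \<Rightarrow> real \<Rightarrow> real \<Rightarrow> ereal \<Rightarrow> real \<Rightarrow> real" where
  "mazya_bound T p s q \<rho> = mazya_const T p s q * min 1 (\<rho> - sqrt (real DIM('a))) powr s * \<rho> powr - div_exponent DIM('a) q"

text \<open>Along any filter on which one constant works, \<open>mazya_bound\<close> lies between two positive numbers: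
  $\delta \le \delta^s \le 1$, and $\rho^{-N} \le \rho^{-N/q} \le 1$ because $\rho > 1$ and $q \ge 1$.\<close>

lemma mazya_bound_comparable:
  fixes q :: "real \<Rightarrow> ereal"
  assumes p: "1 \<le> p" and \<rho>: "sqrt (real DIM('a::euclidean_space)) < \<rho>" and F: "F \<noteq> bot" and c: "0 < c"
    and ev: "\<forall>\<^sub>F s in F. 0 < s \<and> s < 1 \<and> ereal p \<le> q s \<and> mazya_ineq TYPE('a) c p s (q s)"
  shows "comparable (\<lambda>s. mazya_bound TYPE('a) p s (q s) \<rho>) (\<lambda>_. 1) F"
proof (rule comparable_1I[OF F])
  define \<delta> where "\<delta> = min 1 (\<rho> - sqrt (real DIM('a)))"
  have "1 \<le> real DIM('a)" using DIM_positive[where 'a='a] by linarith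
  then have \<rho>1: "1 < \<rho>" using \<rho> by (smt (verit) real_sqrt_ge_one)
  have \<delta>: "0 < \<delta>" "\<delta> \<le> 1" using \<rho> by (auto simp: \<delta>_def)
  show "0 < min 1 c / 2 * \<delta> * \<rho> powr - real DIM('a)" using c \<delta> \<rho>1 by simp
  show "\<forall>\<^sub>F s in F. min 1 c / 2 * \<delta> * \<rho> powr - real DIM('a) \<le> mazya_bound TYPE('a) p s (q s) \<rho> \<and> mazya_bound TYPE('a) p s (q s) \<rho> \<le> 1"
    using ev
  proof (rule eventually_mono)
    fix s assume s: "0 < s \<and> s < 1 \<and> ereal p \<le> q s \<and> mazya_ineq TYPE('a) c p s (q s)"
    define e where "e = div_exponent DIM('a) (q s)"
    have e: "0 \<le> e" "e \<le> real DIM('a)" using div_exponent_bounds[OF p] s by (auto simp: e_def)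
    have k: "min 1 c / 2 \<le> mazya_const TYPE('a) p s (q s)" "0 < mazya_const TYPE('a) p s (q s)" "mazya_const TYPE('a) p s (q s) \<le> 1"
      using mazya_const_ge[of c p s "q s", where 'a = 'a] mazya_const_works[of c p s "q s", where 'a = 'a] s c by auto
    have d: "\<delta> \<le> \<delta> powr s" "\<delta> powr s \<le> 1"
      using powr_mono'[of s 1 \<delta>] \<delta> s powr_le1[of s \<delta>] by auto
    have r: "\<rho> powr - real DIM('a) \<le> \<rho> powr - e" "\<rho> powr - e \<le> 1"
      using powr_mono[of "- real DIM('a)" "- e" \<rho>] powr_mono[of "- e" 0 \<rho>] e \<rho>1 by auto
    have "min 1 c / 2 * \<delta> * \<rho> powr - real DIM('a) \<le> mazya_const TYPE('a) p s (q s) * \<delta> powr s * \<rho> powr - e"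
      using k d r \<delta> c by (intro mult_mono) auto
    moreover have "mazya_const TYPE('a) p s (q s) * \<delta> powr s * \<rho> powr - e \<le> 1 * 1 * 1"
      using k d r \<delta> by (intro mult_mono) auto
    ultimately show "min 1 c / 2 * \<delta> * \<rho> powr - real DIM('a) \<le> mazya_bound TYPE('a) p s (q s) \<rho> \<and> mazya_bound TYPE('a) p s (q s) \<rho> \<le> 1"
      by (simp add: mazya_bound_def \<delta>_def e_def)
  qed
qed

text \<open>As $s \to 0$ the Sobolev exponent tends to \<open>p\<close>, so eventually \<open>q s \<le> 2 * p\<close>.\<close>

lemma mazya_bound_comparable_at_0:
  assumes p: "1 \<le> p" and \<rho>: "sqrt (real DIM('a::euclidean_space)) < \<rho>"
  shows "comparable_1_at_0 DIM('a) p (\<lambda>s q. mazya_bound TYPE('a) p s q \<rho>)"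
  unfolding comparable_1_at_0_def
proof (intro allI impI)
  fix q :: "real \<Rightarrow> ereal"
  assume adm: "\<forall>\<^sub>F s in at_right 0. admissible DIM('a) p s (q s)"
  define N where "N = real DIM('a)"
  have N: "0 < N" by (simp add: N_def)
  obtain c where c: "0 < c" and mz: "\<And>s q. 0 < s \<Longrightarrow> s < 1 \<Longrightarrow> admissible DIM('a) p s q \<Longrightarrow> q \<le> ereal (2 * p) \<Longrightarrow> mazya_ineq TYPE('a) c p s q"
    using mazya_finite_exponents[of p "2 * p", where 'a = 'a] p by auto
  have ev: "\<forall>\<^sub>F s in at_right 0. 0 < s \<and> s < min 1 (N / (2 * p))"
    using N p by (auto simp: eventually_at_right_field intro!: exI[of _ "min 1 (N / (2 * p))"])
  show "comparable (\<lambda>s. mazya_bound TYPE('a) p s (q s) \<rho>) (\<lambda>_. 1) (at_right 0)"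
  proof (rule mazya_bound_comparable[OF p \<rho> _ c])
    show "\<forall>\<^sub>F s in at_right 0. 0 < s \<and> s < 1 \<and> ereal p \<le> q s \<and> mazya_ineq TYPE('a) c p s (q s)"
      using adm ev
    proof eventually_elim
      case (elim s)
      then have s: "0 < s" "s < 1" "s * p \<le> N / 2" using p by (auto simp: field_simps)
      have "s * p < N" using s N by linarith
      then have "q s \<le> ereal (sobolev_exponent DIM('a) p s)"
        using elim(1) unfolding admissible_def by (auto simp: N_def)
      also have "\<dots> \<le> ereal (2 * p)"
      proof -
        have "N * p \<le> 2 * p * (N - s * p)" using mult_left_mono[of "N / 2" "N - s * p" "2 * p"] s p by simp
        then show ?thesis using s N by (simp add: sobolev_exponent_def N_def[symmetric] pos_divide_le_eq)
      qed
      finally show ?case using s elim(1) mz[of s "q s"] by (auto simp: admissible_def)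
    qed
  qed simp
qed

text \<open>If the limit exponent is finite, \<open>q s\<close> is eventually bounded. If it is infinite, admissibility for
  \<open>s = 1\<close> gives \<open>p > N\<close>, and \<open>s * p\<close> eventually exceeds \<open>N\<close> by a fixed proportion.\<close>

lemma mazya_bound_comparable_at_1:
  assumes p: "1 \<le> p" and \<rho>: "sqrt (real DIM('a::euclidean_space)) < \<rho>"
  shows "comparable_1_at_1 DIM('a) p (\<lambda>s q. mazya_bound TYPE('a) p s q \<rho>)"
  unfolding comparable_1_at_1_def
proof (intro allI impI, elim conjE)
  fix q :: "real \<Rightarrow> ereal" and q1
  assume adm: "\<forall>\<^sub>F s in at_left 1. admissible DIM('a) p s (q s)"
    and lim: "(q \<longlongrightarrow> q1) (at_left 1)" and adm1: "admissible DIM('a) p 1 q1"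
  define N where "N = real DIM('a)"
  have N: "0 < N" by (simp add: N_def)
  have ev01: "\<forall>\<^sub>F s in at_left 1. b < s \<and> s < 1" if "b < 1" for b :: real
    using that by (auto simp: eventually_at_left_field intro!: exI[of _ b])
  have "\<exists>c>0. \<forall>\<^sub>F s in at_left 1. 0 < s \<and> s < 1 \<and> ereal p \<le> q s \<and> mazya_ineq TYPE('a) c p s (q s)"
  proof (cases "q1 = \<infinity>")
    case True
    then have pN: "N < p" using adm1 by (auto simp: admissible_def N_def)
    \<comment> \<open>Half of the excess at \<open>s = 1\<close>, so that the condition on \<open>s * p\<close> holds for \<open>s\<close> close to 1.\<close>
    define \<epsilon> where "\<epsilon> = (p / N - 1) / 2"
    have \<epsilon>: "0 < \<epsilon>" using pN N by (simp add: \<epsilon>_def)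
    obtain c where c: "0 < c" and mz: "\<And>s q. 0 < s \<Longrightarrow> s < 1 \<Longrightarrow> ereal p \<le> q \<Longrightarrow> real DIM('a) * (1 + \<epsilon>) \<le> s * p \<Longrightarrow> mazya_ineq TYPE('a) c p s q"
      using mazya_supercritical[OF p \<epsilon>, where 'a = 'a] by auto
    have b: "(N + p) / (2 * p) < 1" using pN p by simp
    have "\<forall>\<^sub>F s in at_left 1. 0 < s \<and> s < 1 \<and> ereal p \<le> q s \<and> mazya_ineq TYPE('a) c p s (q s)"
      using adm ev01[OF b]
    proof eventually_elim
      case (elim s)
      have "0 < (N + p) / (2 * p)" using N p by simp
      then have s: "0 < s" "s < 1" using elim by auto
      have "N * (1 + \<epsilon>) = (N + p) / 2" using N by (simp add: \<epsilon>_def field_simps)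
      also have "\<dots> \<le> s * p" using elim(2) p by (simp add: field_simps)
      finally show ?case using s elim(1) mz[of s "q s"] by (auto simp: admissible_def N_def)
    qed
    then show ?thesis using c by blast
  next
    case False
    then obtain x where x: "q1 = ereal x" using adm1 by (cases q1) (auto simp: admissible_def)
    define Q where "Q = max p (x + 1)"
    obtain c where c: "0 < c" and mz: "\<And>s q. 0 < s \<Longrightarrow> s < 1 \<Longrightarrow> admissible DIM('a) p s q \<Longrightarrow> q \<le> ereal Q \<Longrightarrow> mazya_ineq TYPE('a) c p s q"
      using mazya_finite_exponents[of p Q, where 'a = 'a] p by (auto simp: Q_def)
    have "\<forall>\<^sub>F s in at_left 1. q s < ereal (x + 1)"
      using order_tendstoD(2)[OF lim] by (simp add: x)
    then have "\<forall>\<^sub>F s in at_left 1. 0 < s \<and> s < 1 \<and> ereal p \<le> q s \<and> mazya_ineq TYPE('a) c p s (q s)"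
      using adm ev01[of 0, simplified]
    proof eventually_elim
      case (elim s)
      have "q s \<le> ereal (x + 1)" using elim(1) by (rule less_imp_le)
      also have "\<dots> \<le> ereal Q" by (simp add: Q_def)
      finally show ?case using elim mz[of s "q s"] by (auto simp: admissible_def)
    qed
    then show ?thesis using c by blast
  qed
  then obtain c where "0 < c" "\<forall>\<^sub>F s in at_left 1. 0 < s \<and> s < 1 \<and> ereal p \<le> q s \<and> mazya_ineq TYPE('a) c p s (q s)"
    by blast
  then show "comparable (\<lambda>s. mazya_bound TYPE('a) p s (q s) \<rho>) (\<lambda>_. 1) (at_left 1)"
    by (intro mazya_bound_comparable[OF p \<rho>]) auto
qed

theorem lemma4p11:
  shows "\<exists>M :: real \<Rightarrow> real \<Rightarrow> ereal \<Rightarrow> real \<Rightarrow> real.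
    (\<forall>p s q. 1 \<le> p \<and> 0 < s \<and> s < 1 \<and> admissible DIM('a::euclidean_space) p s q \<longrightarrow>
      (\<forall>\<rho>. sqrt (real DIM('a)) < \<rho> \<longrightarrow> 0 < M p s q \<rho>) \<and>
      (\<forall>(x0::'a) r R K u.
        0 < r \<and> sqrt (real DIM('a)) * r < R \<and>
        compact K \<and> K \<subseteq> closure (ball x0 r) \<and>
        u \<in> test_functions UNIV \<and> (\<forall>x\<in>K. u x = 0) \<longrightarrow>
        ennreal (M p s q (R / r) / r powr div_exponent DIM('a) q)
          * ennreal_powr (rel_capacity p s K (ball x0 R)) (1 / p)
          * Lq_norm q (ball x0 r) u
        \<le> ennreal_powr (gagliardo p s (ball x0 R) UNIV u) (1 / p)) \<and>
      (\<exists>L>0. ((\<lambda>\<rho>. M p s q \<rho> / (\<rho> - sqrt (real DIM('a))) powr s) \<longlongrightarrow> L)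
        (at_right (sqrt (real DIM('a))))) \<and>
      (\<exists>L>0. ((\<lambda>\<rho>. \<rho> powr div_exponent DIM('a) q * M p s q \<rho>) \<longlongrightarrow> L) at_top)) \<and>
    (\<forall>p \<rho>. 1 \<le> p \<and> sqrt (real DIM('a)) < \<rho> \<longrightarrow>
      comparable_1_at_0 DIM('a) p (\<lambda>s q. M p s q \<rho>) \<and>
      comparable_1_at_1 DIM('a) p (\<lambda>s q. M p s q \<rho>))"
proof (intro exI[of _ "mazya_bound TYPE('a)"] conjI allI impI; (elim conjE)?)
  fix p s q assume p: "1 \<le> p" and s: "0 < s" "s < 1" and adm: "admissible DIM('a) p s q"
  define \<sigma> where "\<sigma> = sqrt (real DIM('a))"
  define e where "e = div_exponent DIM('a) q"
  define k where "k = mazya_const TYPE('a) p s q"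
  have "1 \<le> real DIM('a)" using DIM_positive[where 'a='a] by linarith
  then have \<sigma>: "1 \<le> \<sigma>" by (simp add: \<sigma>_def)
  obtain c where "0 < c" "mazya_ineq TYPE('a) c p s q" using exists_mazya_ineq[OF p s adm] by blast
  then have k: "0 < k" "mazya_ineq TYPE('a) k p s q" unfolding k_def by (auto intro: mazya_const_works)
  have M: "mazya_bound TYPE('a) p s q \<rho> = k * min 1 (\<rho> - \<sigma>) powr s * \<rho> powr - e" for \<rho>
    by (simp add: mazya_bound_def k_def \<sigma>_def e_def)
  show "0 < mazya_bound TYPE('a) p s q \<rho>" if "sqrt (real DIM('a)) < \<rho>" for \<rho>
    using that \<sigma> k unfolding M by (simp add: \<sigma>_def[symmetric])
  show "ennreal (mazya_bound TYPE('a) p s q (R / r) / r powr div_exponent DIM('a) q)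
          * ennreal_powr (rel_capacity p s K (ball x0 R)) (1 / p) * Lq_norm q (ball x0 r) u
        \<le> ennreal_powr (gagliardo p s (ball x0 R) UNIV u) (1 / p)"
    if r: "0 < r" "sqrt (real DIM('a)) * r < R" and K: "K \<subseteq> closure (ball x0 r)"
      and u: "u \<in> test_functions UNIV" "\<forall>x\<in>K. u x = 0"
    for x0 :: 'a and r R K u
  proof -
    have "0 < \<sigma> * r" using \<sigma> r by simp
    then have R: "0 < R" using r unfolding \<sigma>_def by linarith
    have Kc: "K \<subseteq> cball x0 r" using K r by simp
    have "(R / r) powr - e = R powr - e * r powr e" using R r(1) by (rule powr_div_minus)
    then have "mazya_bound TYPE('a) p s q (R / r) / r powr e = k * min 1 (R / r - \<sigma>) powr s * R powr - e"
      using r unfolding M by simp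
    then show ?thesis using k(2)[unfolded mazya_ineq_def, rule_format, OF r Kc u(1)] u(2)
      by (simp add: \<sigma>_def e_def)
  qed
  show "\<exists>L>0. ((\<lambda>\<rho>. mazya_bound TYPE('a) p s q \<rho> / (\<rho> - sqrt (real DIM('a))) powr s) \<longlongrightarrow> L) (at_right (sqrt (real DIM('a))))"
  proof (intro exI conjI)
    show "0 < k * \<sigma> powr - e" using k \<sigma> by simp
    have "((\<lambda>\<rho>. k * \<rho> powr - e) \<longlongrightarrow> k * \<sigma> powr - e) (at_right \<sigma>)"
      using \<sigma> by (intro tendsto_intros) auto
    \<comment> \<open>Close to $\sqrt N$ the minimum is $\rho - \sqrt N$.\<close>
    moreover have "\<forall>\<^sub>F \<rho> in at_right \<sigma>. k * \<rho> powr - e = mazya_bound TYPE('a) p s q \<rho> / (\<rho> - \<sigma>) powr s"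
    proof -
      have "\<forall>\<^sub>F \<rho> in at_right \<sigma>. \<sigma> < \<rho> \<and> \<rho> < \<sigma> + 1"
        by (auto simp: eventually_at_right_field intro!: exI[of _ "\<sigma> + 1"])
      then show ?thesis by (rule eventually_mono) (auto simp: M min_def)
    qed
    ultimately show "((\<lambda>\<rho>. mazya_bound TYPE('a) p s q \<rho> / (\<rho> - sqrt (real DIM('a))) powr s) \<longlongrightarrow> k * \<sigma> powr - e) (at_right (sqrt (real DIM('a))))"
      unfolding \<sigma>_def[symmetric] by (rule Lim_transform_eventually)
  qed
  show "\<exists>L>0. ((\<lambda>\<rho>. \<rho> powr div_exponent DIM('a) q * mazya_bound TYPE('a) p s q \<rho>) \<longlongrightarrow> L) at_top"
  proof (intro exI conjI)
    show "0 < k" by (rule k)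
    have "\<forall>\<^sub>F \<rho> in at_top. k = \<rho> powr e * mazya_bound TYPE('a) p s q \<rho>"
      using eventually_ge_at_top[of "\<sigma> + 1"]
    proof (rule eventually_mono)
      fix \<rho> assume \<rho>: "\<sigma> + 1 \<le> \<rho>"
      then have "min 1 (\<rho> - \<sigma>) = 1" "0 < \<rho>" using \<sigma> by auto
      then show "k = \<rho> powr e * mazya_bound TYPE('a) p s q \<rho>" by (simp add: M powr_minus)
    qed
    then show "((\<lambda>\<rho>. \<rho> powr div_exponent DIM('a) q * mazya_bound TYPE('a) p s q \<rho>) \<longlongrightarrow> k) at_top"
      unfolding e_def by (rule Lim_transform_eventually[OF tendsto_const])
  qed
next
  fix p \<rho> :: real assume "1 \<le> p" "sqrt (real DIM('a)) < \<rho>"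
  then show "comparable_1_at_0 DIM('a) p (\<lambda>s q. mazya_bound TYPE('a) p s q \<rho>)"
    by (rule mazya_bound_comparable_at_0)
next
  fix p \<rho> :: real assume "1 \<le> p" "sqrt (real DIM('a)) < \<rho>"
  then show "comparable_1_at_1 DIM('a) p (\<lambda>s q. mazya_bound TYPE('a) p s q \<rho>)"
    by (rule mazya_bound_comparable_at_1)
qed

end
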